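(* Let $\tau=x+iy$ with $x\in\mathbb{R}$, $y>0$, and $q=e^{2\pi i\tau}$. Let \[ \overline{\mathscr{O}}(q)=\sum_{m\ge0}\frac{(-1;q)_m q^{m(m+1)/2}}{(q^2;q^2)_m}=(-q;q)_\infty f(q),\qquad f(q)=\sum_{n\ge0}\frac{q^{n^2}}{(-q;q)_n^2}. \] Fix $M>0$. Then: (i) For $|x|\le My$, as $y\to0^+$, \[ \overline{\mathscr{O}}(q)=\frac{2\sqrt2}{3}e^{\frac{\pi i}{24\tau}}+O\!\left(y\,e^{\frac{\pi}{24}\operatorname{Im}\left(-\frac1\tau\right)}\right). \] (ii) For $My<|x|\le 1/2$, as $y\to0^+$, \[ \overline{\mathscr{O}}(q)\ll\frac{1}{y\sqrt2}\exp\!\left[\frac1y\left(\frac\pi8-\frac1\pi\left(1-\frac{1}{\sqrt{1+M^2}}\right)\right)\right]. \]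
   Context: $(a;q)_m=\prod_{j=1}^m(1-aq^{j-1})$ for $m\in\mathbb{N}_0\cup\{\infty\}$. $\overline{\mathscr{O}}(q)$ is the generating function of odd-even overpartitions and $f(q)$ is Ramanujan's third order mock theta function. *)

theory Defs
  imports "HOL-Complex_Analysis.Complex_Analysis"
begin

definition qpoch :: "complex \<Rightarrow> complex \<Rightarrow> nat \<Rightarrow> complex" where
  "qpoch a q m = (\<Prod>j=1..m. 1 - a * q ^ (j - 1))"

text \<open>The index is shifted: the factor \<open>1 - a * q ^ (j - 1)\<close> with \<open>j \<ge> 1\<close> is the one
  at index \<open>j - 1\<close> here.\<close>

definition qpoch_inf :: "complex \<Rightarrow> complex \<Rightarrow> complex" where
  "qpoch_inf a q = (\<Prod>j. 1 - a * q ^ j)"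

definition mock_theta_f :: "complex \<Rightarrow> complex" where
  "mock_theta_f q = (\<Sum>n. q ^ (n ^ 2) / (qpoch (- q) q n) ^ 2)"

text \<open>Generating function of odd-even overpartitions.  The \<open>div\<close> is exact, since
  \<open>m * (m + 1)\<close> is even.\<close>

definition odd_even_gf :: "complex \<Rightarrow> complex" where
  "odd_even_gf q =
     (\<Sum>m. qpoch (- 1) q m * q ^ (m * (m + 1) div 2) / qpoch (q ^ 2) (q ^ 2) m)"

definition nome :: "complex \<Rightarrow> complex" where
  "nome \<tau> = exp (2 * of_real pi * \<i> * \<tau>)"

end

theory Submission
  imports Defs "HOL-Probability.Distributions" "HOL-Real_Asymp.Real_Asymp"
begin

text \<open>Finite forms of the identities of Watson and Gauss (both proved by recursion in the order \<open>N\<close>)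
  give, with \<open>q = exp (- z)\<close>, the quotient representation
  \<open>odd_even_gf q = (\<Sum>n. (-1)^n * q^(3*n^2/2) / cosh (n*z/2)) / (\<Sum>n. (-1)^n * q^(n^2))\<close> over all
  integers \<open>n\<close>. Both bilateral sums are contour integrals against \<open>1 / sin (pi*s)\<close>; moving the line of
  integration through the saddle points \<open>-\<i>*pi/(3*z)\<close> and \<open>-\<i>*pi/(2*z)\<close> turns them into Gaussian
  integrals with relative error \<open>O(z)\<close>, uniformly in every sector \<open>\<bar>Im z\<bar> \<le> M * Re z\<close>, which is (i).
  For (ii) the terms \<open>2 * q^(m*(m+1)/2) / ((1 + q^m) * (q;q)_m)\<close> are bounded absolutely, except that
  the first term \<open>\<Sum>j. q^j\<close> of \<open>- ln (q;q)_m\<close> is summed before taking the modulus.\<close>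

section \<open>Finite q-series identities\<close>

text \<open>Estimating \<open>(-q;q)_inf\<close> and \<open>f(q)\<close> separately near
  \<open>q = 1\<close> would call for modular transformations. Gauss's
  \<open>theta * (-q;q)_inf = (q;q)_inf\<close> and Watson's \<open>f(q) = S / (q;q)_inf\<close>
  remove every infinite product and leave \<open>S / theta\<close>, two series of one type. At
  finite order the factors \<open>1 / ((q;q)_(N-r) * (q;q)_(N+r))\<close> make all sums finite, so
  that these identities follow by elementary recursion; in the limit they become a common constant.
  In (i) the saddle exponents are \<open>- pi^2/(6*z)\<close> and \<open>- pi^2/(4*z)\<close>, with
  difference \<open>pi^2/(12*z)\<close>. The constant is the value \<open>2 / sqrt 3\<close> of
  \<open>1 / cosh\<close> at the saddle times the ratio \<open>sqrt (2/3)\<close> of the two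
  Gaussian integrals. The linear Taylor term integrates to zero, which improves the relative error
  from \<open>sqrt z\<close> to \<open>z\<close>. In (ii), with \<open>\<alpha> = 2*pi*y\<close>,
  the exponent \<open>(pi^2/4 - 2 + 2 / sqrt (1+M^2)) / \<alpha>\<close> is made of three parts:
  \<open>2 / sqrt (1+M^2)\<close> from the oscillating sum of \<open>q^j\<close>, doubled because
  only \<open>norm (1 - q^m) \<le> 2\<close> is used; \<open>-1\<close> from the sum of the
  \<open>norm q ^ j\<close>; and \<open>pi^2/4 - 1\<close> from a sum of positive terms.\<close>

definition inv_qpoch :: "'a::real_normed_field \<Rightarrow> int \<Rightarrow> 'a" where
  "inv_qpoch q k = (if k < 0 then 0 else inverse (\<Prod>i=1..nat k. 1 - q ^ i))"

definition qneg :: "'a::real_normed_field \<Rightarrow> nat \<Rightarrow> 'a" where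
  "qneg q n = (\<Prod>i=1..n. 1 + q ^ i)"

lemma tri_Suc: "Suc m * (Suc m + 1) div 2 = m * (m + 1) div 2 + Suc m"
proof -
  have "Suc m * (Suc m + 1) = m * (m + 1) + Suc m * 2" by (simp add: algebra_simps)
  then show ?thesis by simp
qed

lemma tri_int_add_1: "(r + 1) * (r + 2) div 2 = r * (r + 1) div 2 + (r + 1)" for r :: int
proof -
  have "(r + 1) * (r + 2) = r * (r + 1) + (r + 1) * 2" by (simp add: algebra_simps)
  then show ?thesis by simp
qed

lemma sum_int_shift:
  fixes g :: "int \<Rightarrow> 'a::ab_group_add"
  shows "(\<Sum>r=-int L..int L. g (r + 1)) = (\<Sum>r=-int L..int L. g r) + g (int L + 1) - g (- int L)"
proof -
  have 1: "(\<Sum>r=-int L..int L. g (r + 1)) = (\<Sum>r=-int L+1..int L+1. g r)"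
    by (rule sum.reindex_bij_witness[of _ "\<lambda>r. r - 1" "\<lambda>r. r + 1"]) auto
  have 2: "insert (- int L) {-int L+1..int L+1} = insert (int L + 1) {-int L..int L}" by auto
  have "g (- int L) + (\<Sum>r=-int L+1..int L+1. g r) = g (int L + 1) + (\<Sum>r=-int L..int L. g r)"
    using arg_cong[OF 2, of "sum g"] by simp
  then show ?thesis unfolding 1 by (simp add: algebra_simps)
qed

lemma sum_int_uminus:
  fixes g :: "int \<Rightarrow> 'a::comm_monoid_add"
  shows "(\<Sum>r=-int L..int L. g (- r)) = (\<Sum>r=-int L..int L. g r)"
  by (rule sum.reindex_bij_witness[of _ uminus uminus]) auto

lemma sum_int_even:
  fixes g :: "int \<Rightarrow> 'a::real_normed_field"
  assumes "\<And>r. g (- r) = g r"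
  shows "(\<Sum>r=-int L..int L. g r) = (\<Sum>r\<le>L. (if r = 0 then 1 else 2) * g (int r))"
proof (induction L)
  case (Suc L)
  have "{-int (Suc L)..int (Suc L)} = insert (- int (Suc L)) (insert (int (Suc L)) {-int L..int L})"
    by auto
  then have "(\<Sum>r=-int (Suc L)..int (Suc L). g r)
      = g (- int (Suc L)) + (g (int (Suc L)) + (\<Sum>r=-int L..int L. g r))"
    by (simp del: of_nat_Suc)
  then show ?case using Suc assms[of "int (Suc L)"] by simp
qed simp

context
  fixes q :: "'a::real_normed_field"
  assumes q1: "norm q < 1" and q0: "q \<noteq> 0"
begin

lemma one_minus_pow_nz: "0 < n \<Longrightarrow> 1 - q ^ n \<noteq> 0"
  and one_plus_pow_nz: "0 < n \<Longrightarrow> 1 + q ^ n \<noteq> 0"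
proof -
  assume "0 < n"
  then have "norm (q ^ n) < 1" using q1 by (simp add: norm_power power_less_one_iff)
  then show "1 - q ^ n \<noteq> 0" "1 + q ^ n \<noteq> 0"
    by (auto simp: add_eq_0_iff)
qed

lemma one_plus_pow_nz': "1 + q ^ n \<noteq> 0"
  using one_plus_pow_nz[of n] by (cases n) (auto simp: add_eq_0_iff)

lemma one_plus_powi_nz: "1 + q powi r \<noteq> 0"
proof (cases "r \<ge> 0")
  case True
  then show ?thesis using one_plus_pow_nz'[of "nat r"] by (simp add: power_int_def)
next
  case False
  have "1 + inverse (q ^ n) \<noteq> 0" for n
  proof -
    have "1 + inverse (q ^ n) = (1 + q ^ n) / q ^ n" using q0 by (simp add: field_simps)
    then show ?thesis using one_plus_pow_nz' q0 by simp
  qed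
  then show ?thesis using False by (simp add: power_int_def power_inverse)
qed

lemma powi_add: "q powi (m + n) = q powi m * q powi n"
  using q0 by (simp add: power_int_add)

lemma qneg_nz: "qneg q n \<noteq> 0"
  unfolding qneg_def using one_plus_pow_nz by simp

lemma qneg_Suc: "qneg q (Suc n) = (1 + q ^ Suc n) * qneg q n"
  unfolding qneg_def by (simp add: prod.nat_ivl_Suc' algebra_simps)

lemma inv_qpoch_Suc: "(1 - q ^ Suc n) * inv_qpoch q (int (Suc n)) = inv_qpoch q (int n)"
  using one_minus_pow_nz[of "Suc n"]
  by (simp add: inv_qpoch_def prod.nat_ivl_Suc' nat_add_distrib del: power_Suc)

text \<open>Setting the reciprocal to 0 at negative indices makes the recursion valid for all
  integers: at \<open>k = 0\<close> the factor \<open>1 - q^0\<close> vanishes together with the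
  right side. Sums over too large a range then truncate themselves.\<close>

lemma inv_qpoch_rec: "(1 - q powi k) * inv_qpoch q k = inv_qpoch q (k - 1)"
proof (cases "k > 0")
  case True
  then obtain n where n: "k = int (Suc n)" by (metis gr0_implies_Suc pos_int_cases)
  show ?thesis using inv_qpoch_Suc[of n] unfolding n by (simp del: power_Suc of_nat_Suc) simp
next
  case False
  then show ?thesis by (cases "k = 0") (auto simp: inv_qpoch_def)
qed

text \<open>Rothe's q-binomial theorem divided by \<open>(q;q)_N\<close>, so that the Gaussian
  binomial turns into two reciprocals to which the recursion of \<open>inv_qpoch\<close> applies.
  Its limit in \<open>N\<close>, Euler's product, is used again for (ii).\<close>

lemma q_binomial_finite:
  "(\<Sum>m\<le>N. q ^ (m * (m + 1) div 2) * x ^ m * inv_qpoch q (int m) * inv_qpoch q (int N - int m))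
     = inv_qpoch q (int N) * (\<Prod>i=1..N. 1 + x * q ^ i)"
proof (induction N)
  case 0
  show ?case by (simp add: inv_qpoch_def)
next
  case (Suc N)
  define t where "t m = q ^ (m * (m + 1) div 2) * x ^ m" for m
  define B where "B N = (\<Sum>m\<le>N. t m * inv_qpoch q (int m) * inv_qpoch q (int N - int m))" for N
  have tS: "t (Suc m) = x * q ^ Suc m * t m" for m
    unfolding t_def tri_Suc by (simp add: power_add algebra_simps)
  \<comment> \<open>\<open>1 - q^(N+1) = (1 - q^(N+1-m)) + q^(N+1-m) * (1 - q^m)\<close>: each
    summand lowers the index of one reciprocal.\<close>
  have 1: "(1 - q ^ Suc N) * (t m * inv_qpoch q (int m) * inv_qpoch q (int (Suc N) - int m))
     = t m * inv_qpoch q (int m) * inv_qpoch q (int N - int m)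
      + t m * q ^ (Suc N - m) * inv_qpoch q (int m - 1) * inv_qpoch q (int (Suc N) - int m)"
    if "m \<le> Suc N" for m
  proof -
    have e: "q ^ Suc N = q ^ m * q ^ (Suc N - m)" using that by (metis le_add_diff_inverse power_add)
    have p: "q powi (int (Suc N) - int m) = q ^ (Suc N - m)"
      using that by (metis of_nat_diff power_int_of_nat)
    have a: "(1 - q ^ m) * inv_qpoch q (int m) = inv_qpoch q (int m - 1)"
      using inv_qpoch_rec[of "int m"] by simp
    have b: "(1 - q ^ (Suc N - m)) * inv_qpoch q (int (Suc N) - int m) = inv_qpoch q (int N - int m)"
      using inv_qpoch_rec[of "int (Suc N) - int m"] unfolding p by (simp add: algebra_simps)
    show ?thesis unfolding a[symmetric] b[symmetric] e by (simp add: algebra_simps)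
  qed
  have "(1 - q ^ Suc N) * B (Suc N) =
     (\<Sum>m\<le>Suc N. t m * inv_qpoch q (int m) * inv_qpoch q (int N - int m))
    + (\<Sum>m\<le>Suc N. t m * q ^ (Suc N - m) * inv_qpoch q (int m - 1) * inv_qpoch q (int (Suc N) - int m))"
    unfolding B_def sum_distrib_left sum.distrib[symmetric] using 1 by (intro sum.cong) auto
  \<comment> \<open>The top term contains \<open>inv_qpoch q (-1) = 0\<close>. In the other sum it
    is the bottom term that vanishes, which permits the index shift.\<close>
  also have "(\<Sum>m\<le>Suc N. t m * inv_qpoch q (int m) * inv_qpoch q (int N - int m)) = B N"
    by (simp add: B_def inv_qpoch_def)
  also have "(\<Sum>m\<le>Suc N. t m * q ^ (Suc N - m) * inv_qpoch q (int m - 1) * inv_qpoch q (int (Suc N) - int m))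
     = (\<Sum>m\<le>N. t (Suc m) * q ^ (N - m) * inv_qpoch q (int m) * inv_qpoch q (int N - int m))"
    by (subst sum.atMost_Suc_shift) (simp add: inv_qpoch_def)
  also have "\<dots> = x * q ^ Suc N * B N"
    unfolding B_def sum_distrib_left
  proof (intro sum.cong refl)
    fix m assume "m \<in> {..N}"
    then have e: "q ^ Suc N = q ^ Suc m * q ^ (N - m)" by (simp flip: power_add)
    show "t (Suc m) * q ^ (N - m) * inv_qpoch q (int m) * inv_qpoch q (int N - int m)
       = x * q ^ Suc N * (t m * inv_qpoch q (int m) * inv_qpoch q (int N - int m))"
      unfolding tS e by (simp add: mult_ac)
  qed
  finally have "(1 - q ^ Suc N) * B (Suc N) = (1 + x * q ^ Suc N) * B N" by (simp add: algebra_simps)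
  also have "B N = inv_qpoch q (int N) * (\<Prod>i=1..N. 1 + x * q ^ i)"
    using Suc by (simp add: B_def t_def)
  also have "inv_qpoch q (int N) = (1 - q ^ Suc N) * inv_qpoch q (int (Suc N))"
    by (rule inv_qpoch_Suc[symmetric])
  finally have "(1 - q ^ Suc N) * B (Suc N)
     = (1 - q ^ Suc N) * (inv_qpoch q (int (Suc N)) * (\<Prod>i=1..Suc N. 1 + x * q ^ i))"
    by (simp add: prod.nat_ivl_Suc' algebra_simps del: power_Suc of_nat_Suc)
  then show ?case using one_minus_pow_nz[of "Suc N"]
    by (simp add: B_def t_def del: power_Suc of_nat_Suc)
qed

lemma pred_tri_Suc: "Suc n * (Suc n - 1) div 2 = n * (n - 1) div 2 + n"
  using tri_Suc[of "n - 1"] by (cases n) (auto simp: algebra_simps)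

text \<open>Converts the factor \<open>2 / (1 + q^m)\<close> of the overpartition series into terms
  \<open>1 / (-q;q)_n\<close>, the origin of the denominators of the mock theta function. The
  splitting \<open>1 + q^(m+1) = (1 - q^(m+1-n)) + q^(m+1-n) * (1 + q^n)\<close> gives a recursion,
  since \<open>1 + q^n\<close> cancels the last factor of \<open>(-q;q)_n\<close>.\<close>

lemma two_over_one_plus_expansion:
  "(\<Sum>n\<le>m. q ^ (n * (n - 1) div 2) * inv_qpoch q (int m - int n) / qneg q n)
     = 2 * inv_qpoch q (int m) / (1 + q ^ m)"
proof (induction m)
  case 0
  show ?case by (simp add: inv_qpoch_def qneg_def)
next
  case (Suc m)
  define c where "c n = q ^ (n * (n - 1) div 2)" for n
  have cS: "c (Suc n) = q ^ n * c n" for n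
    unfolding c_def pred_tri_Suc by (simp add: power_add)
  define Y where "Y m = (\<Sum>n\<le>m. c n * inv_qpoch q (int m - int n) / qneg q n)" for m
  have 1: "(1 + q ^ Suc m) * (c n * inv_qpoch q (int (Suc m) - int n) / qneg q n)
     = c n * inv_qpoch q (int m - int n) / qneg q n
      + q ^ (Suc m - n) * (1 + q ^ n) * c n * inv_qpoch q (int (Suc m) - int n) / qneg q n"
    if "n \<le> Suc m" for n
  proof -
    have e: "q ^ Suc m = q ^ n * q ^ (Suc m - n)" using that by (metis le_add_diff_inverse power_add)
    have p: "q powi (int (Suc m) - int n) = q ^ (Suc m - n)"
      using that by (metis of_nat_diff power_int_of_nat)
    have b: "(1 - q ^ (Suc m - n)) * inv_qpoch q (int (Suc m) - int n) = inv_qpoch q (int m - int n)"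
      using inv_qpoch_rec[of "int (Suc m) - int n"] unfolding p by (simp add: algebra_simps)
    show ?thesis unfolding b[symmetric] e using qneg_nz by (simp add: field_simps)
  qed
  have "(1 + q ^ Suc m) * Y (Suc m) =
     (\<Sum>n\<le>Suc m. c n * inv_qpoch q (int m - int n) / qneg q n)
   + (\<Sum>n\<le>Suc m. q ^ (Suc m - n) * (1 + q ^ n) * c n * inv_qpoch q (int (Suc m) - int n) / qneg q n)"
    unfolding Y_def sum_distrib_left sum.distrib[symmetric] using 1 by (intro sum.cong) auto
  also have "(\<Sum>n\<le>Suc m. c n * inv_qpoch q (int m - int n) / qneg q n) = Y m"
    by (simp add: Y_def inv_qpoch_def)
  \<comment> \<open>At \<open>n = 0\<close> nothing cancels; \<open>1 + q^0 = 2\<close> leaves the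
    inhomogeneous term that completes the recursion.\<close>
  also have "(\<Sum>n\<le>Suc m. q ^ (Suc m - n) * (1 + q ^ n) * c n * inv_qpoch q (int (Suc m) - int n) / qneg q n)
     = 2 * q ^ Suc m * inv_qpoch q (int (Suc m)) +
       (\<Sum>n\<le>m. q ^ (m - n) * (1 + q ^ Suc n) * c (Suc n) * inv_qpoch q (int m - int n) / qneg q (Suc n))"
    by (subst sum.atMost_Suc_shift) (simp add: qneg_def c_def)
  also have "(\<Sum>n\<le>m. q ^ (m - n) * (1 + q ^ Suc n) * c (Suc n) * inv_qpoch q (int m - int n) / qneg q (Suc n))
      = q ^ m * Y m"
    unfolding Y_def sum_distrib_left
  proof (intro sum.cong refl)
    fix n assume "n \<in> {..m}"
    then have e: "q ^ m = q ^ n * q ^ (m - n)" by (simp flip: power_add)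
    have "a * P * b * R / (P * Q) = b * a * R / Q" if "P \<noteq> 0" for a b P Q R :: 'a
      using that by simp
    from this[of "1 + q ^ Suc n" "q ^ (m - n)" "c (Suc n)" "inv_qpoch q (int m - int n)" "qneg q n"]
    show "q ^ (m - n) * (1 + q ^ Suc n) * c (Suc n) * inv_qpoch q (int m - int n) / qneg q (Suc n)
      = q ^ m * (c n * inv_qpoch q (int m - int n) / qneg q n)"
      unfolding cS qneg_Suc e using one_plus_pow_nz'[of "Suc n"] by (simp add: mult_ac del: power_Suc)
  qed
  finally have "(1 + q ^ Suc m) * Y (Suc m) = (1 + q ^ m) * Y m + 2 * q ^ Suc m * inv_qpoch q (int (Suc m))"
    by (simp add: algebra_simps)
  also have "(1 + q ^ m) * Y m = 2 * inv_qpoch q (int m)"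
    using Suc one_plus_pow_nz'[of m] by (simp add: Y_def c_def)
  also have "inv_qpoch q (int m) = (1 - q ^ Suc m) * inv_qpoch q (int (Suc m))"
    by (rule inv_qpoch_Suc[symmetric])
  finally have "(1 + q ^ Suc m) * Y (Suc m) = 2 * inv_qpoch q (int (Suc m))" by (simp add: algebra_simps)
  then show ?case using one_plus_pow_nz'[of "Suc m"]
    by (simp add: Y_def c_def field_simps del: power_Suc of_nat_Suc)
qed

text \<open>Finite form of the product \<open>(-q;q)_inf * f(q)\<close>. After the exchange of sums
  the inner one, over \<open>m = n + k\<close>, is the q-binomial sum at \<open>x = q^n\<close>; its
  product \<open>(-q;q)_N / (-q;q)_n\<close> supplies both the common factor and the second power of
  \<open>(-q;q)_n\<close>.\<close>

lemma overpartition_mock_finite: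
  "(\<Sum>m\<le>N. 2 * q ^ (m * (m + 1) div 2) * inv_qpoch q (int m) * inv_qpoch q (int N - int m) / (1 + q ^ m))
    = qneg q N * (\<Sum>n\<le>N. q ^ (n ^ 2) * inv_qpoch q (int N - int n) / (qneg q n) ^ 2)"
proof -
  define t :: "nat \<Rightarrow> nat" where "t m = m * (m + 1) div 2" for m
  define u :: "nat \<Rightarrow> nat" where "u m = m * (m - 1) div 2" for m
  \<comment> \<open>The quadratic exponents separate: \<open>t (n + k)\<close> yields the factor
    \<open>(q^n)^k\<close>, and \<open>t n\<close> joins \<open>u n\<close> to form
    \<open>n^2\<close>.\<close>
  have t_add: "t (n + k) = t n + t k + n * k" for n k
    by (induction k) (simp_all add: t_def tri_Suc[simplified])
  have ut: "u n + t n = n ^ 2" for n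
  proof (induction n)
    case (Suc n)
    have "u (Suc n) + t (Suc n) = (u n + n) + (t n + Suc n)"
      unfolding u_def t_def tri_Suc pred_tri_Suc by simp
    then show ?case using Suc by (simp add: power2_eq_square)
  qed (simp add: u_def t_def)
  have "(\<Sum>m\<le>N. 2 * q ^ t m * inv_qpoch q (int m) * inv_qpoch q (int N - int m) / (1 + q ^ m))
     = (\<Sum>m\<le>N. \<Sum>n\<le>m. q ^ t m * inv_qpoch q (int N - int m) *
          (q ^ u n * inv_qpoch q (int m - int n) / qneg q n))"
    unfolding sum_distrib_left[symmetric] u_def two_over_one_plus_expansion by (simp add: field_simps)
  also have "\<dots> = (\<Sum>n\<le>N. \<Sum>m=n..N. q ^ t m * inv_qpoch q (int N - int m) *
          (q ^ u n * inv_qpoch q (int m - int n) / qneg q n))"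
    by (subst (1 2) sum.Sigma, simp, simp, simp, simp)
       (rule sum.reindex_bij_witness[of _ prod.swap prod.swap]; auto)
  also have "\<dots> = (\<Sum>n\<le>N. qneg q N * (q ^ (n ^ 2) * inv_qpoch q (int N - int n) / (qneg q n) ^ 2))"
  proof (intro sum.cong refl)
    fix n assume n: "n \<in> {..N}"
    define K where "K = N - n"
    have N: "N = n + K" using n by (simp add: K_def)
    have "(\<Sum>m=n..N. q ^ t m * inv_qpoch q (int N - int m) * (q ^ u n * inv_qpoch q (int m - int n) / qneg q n))
       = (\<Sum>k\<le>K. q ^ t (n + k) * inv_qpoch q (int K - int k) * (q ^ u n * inv_qpoch q (int k) / qneg q n))"
      by (rule sum.reindex_bij_witness[of _ "\<lambda>k. n + k" "\<lambda>m. m - n"]) (auto simp: N diff_diff_eq2 add.commute)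
    also have "\<dots> = q ^ (n ^ 2) / qneg q n *
         (\<Sum>k\<le>K. q ^ (k * (k + 1) div 2) * (q ^ n) ^ k * inv_qpoch q (int k) * inv_qpoch q (int K - int k))"
      unfolding sum_distrib_left
    proof (intro sum.cong refl)
      fix k
      have "q ^ t (n + k) * q ^ u n = q ^ (n ^ 2) * q ^ t k * (q ^ n) ^ k"
        by (simp add: t_add ut[symmetric] power_add power_mult[symmetric] mult_ac)
      then show "q ^ t (n + k) * inv_qpoch q (int K - int k) * (q ^ u n * inv_qpoch q (int k) / qneg q n)
        = q ^ (n ^ 2) / qneg q n *
          (q ^ (k * (k + 1) div 2) * (q ^ n) ^ k * inv_qpoch q (int k) * inv_qpoch q (int K - int k))"
        using qneg_nz[of n] by (simp add: t_def field_simps)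
    qed
    also have "\<dots> = q ^ (n ^ 2) / qneg q n * (inv_qpoch q (int K) * (\<Prod>i=1..K. 1 + q ^ n * q ^ i))"
      unfolding q_binomial_finite ..
    also have "(\<Prod>i=1..K. 1 + q ^ n * q ^ i) = qneg q N / qneg q n"
    proof -
      have "qneg q (n + K) = qneg q n * (\<Prod>i=1..K. 1 + q ^ n * q ^ i)"
        by (induction K) (simp_all add: qneg_Suc prod.nat_ivl_Suc' power_add algebra_simps)
      then show ?thesis using qneg_nz[of n] by (simp add: N)
    qed
    finally show "(\<Sum>m=n..N. q ^ t m * inv_qpoch q (int N - int m) * (q ^ u n * inv_qpoch q (int m - int n) / qneg q n))
       = qneg q N * (q ^ (n ^ 2) * inv_qpoch q (int N - int n) / (qneg q n) ^ 2)"
      using qneg_nz[of n] by (simp add: N power2_eq_square field_simps)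
  qed
  finally show ?thesis unfolding t_def sum_distrib_left .
qed

text \<open>A finite Durfee rectangle identity, an instance of the q-Vandermonde sum. The offset
  \<open>c\<close> has to vary in the induction, because lowering \<open>K\<close> sends one half of
  the sum to offset \<open>c + 1\<close>.\<close>

lemma durfee_finite:
  "(\<Sum>j\<le>K. q ^ (j ^ 2 + c * j) * inv_qpoch q (int K - int j) * inv_qpoch q (int j) * inv_qpoch q (int (j + c)))
     = inv_qpoch q (int K) * inv_qpoch q (int (K + c))"
proof (induction K arbitrary: c)
  case 0
  show ?case by (simp add: inv_qpoch_def)
next
  case (Suc K)
  define W where "W K c = (\<Sum>j\<le>K. q ^ (j ^ 2 + c * j) * inv_qpoch q (int K - int j) * inv_qpoch q (int j)
     * inv_qpoch q (int (j + c)))" for K c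
  have IH: "W K c = inv_qpoch q (int K) * inv_qpoch q (int (K + c))" for c
    using Suc by (simp add: W_def)
  have 1: "(1 - q ^ Suc K) * (q ^ (j ^ 2 + c * j) * inv_qpoch q (int (Suc K) - int j) * inv_qpoch q (int j)
     * inv_qpoch q (int (j + c)))
     = q ^ (j ^ 2 + c * j) * inv_qpoch q (int K - int j) * inv_qpoch q (int j) * inv_qpoch q (int (j + c))
     + q ^ (Suc K - j) * q ^ (j ^ 2 + c * j) * inv_qpoch q (int (Suc K) - int j) * inv_qpoch q (int j - 1)
     * inv_qpoch q (int (j + c))" if "j \<le> Suc K" for j
  proof -
    have e: "q ^ Suc K = q ^ j * q ^ (Suc K - j)" using that by (metis le_add_diff_inverse power_add)
    have p: "q powi (int (Suc K) - int j) = q ^ (Suc K - j)"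
      using that by (metis of_nat_diff power_int_of_nat)
    have a: "(1 - q ^ j) * inv_qpoch q (int j) = inv_qpoch q (int j - 1)"
      using inv_qpoch_rec[of "int j"] by simp
    have b: "(1 - q ^ (Suc K - j)) * inv_qpoch q (int (Suc K) - int j) = inv_qpoch q (int K - int j)"
      using inv_qpoch_rec[of "int (Suc K) - int j"] unfolding p by (simp add: algebra_simps)
    show ?thesis unfolding a[symmetric] b[symmetric] e by (simp add: algebra_simps)
  qed
  have "(1 - q ^ Suc K) * W (Suc K) c =
     (\<Sum>j\<le>Suc K. q ^ (j ^ 2 + c * j) * inv_qpoch q (int K - int j) * inv_qpoch q (int j) * inv_qpoch q (int (j + c)))
   + (\<Sum>j\<le>Suc K. q ^ (Suc K - j) * q ^ (j ^ 2 + c * j) * inv_qpoch q (int (Suc K) - int j) * inv_qpoch q (int j - 1)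
     * inv_qpoch q (int (j + c)))"
    unfolding W_def sum_distrib_left sum.distrib[symmetric] using 1 by (intro sum.cong) auto
  also have "(\<Sum>j\<le>Suc K. q ^ (j ^ 2 + c * j) * inv_qpoch q (int K - int j) * inv_qpoch q (int j) * inv_qpoch q (int (j + c)))
      = W K c"
    by (simp add: W_def inv_qpoch_def)
  also have "(\<Sum>j\<le>Suc K. q ^ (Suc K - j) * q ^ (j ^ 2 + c * j) * inv_qpoch q (int (Suc K) - int j) * inv_qpoch q (int j - 1)
     * inv_qpoch q (int (j + c)))
    = (\<Sum>j\<le>K. q ^ (K - j) * q ^ ((Suc j) ^ 2 + c * Suc j) * inv_qpoch q (int K - int j) * inv_qpoch q (int j)
     * inv_qpoch q (int (Suc j + c)))"
    by (subst sum.atMost_Suc_shift) (simp add: inv_qpoch_def)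
  also have "\<dots> = q ^ Suc (K + c) * W K (Suc c)"
    unfolding W_def sum_distrib_left
  proof (intro sum.cong refl)
    fix j assume "j \<in> {..K}"
    then have e: "(K - j) + ((Suc j) ^ 2 + c * Suc j) = Suc (K + c) + (j ^ 2 + Suc c * j)"
      by (simp add: power2_eq_square algebra_simps)
    have "q ^ (K - j) * q ^ ((Suc j) ^ 2 + c * Suc j) = q ^ Suc (K + c) * q ^ (j ^ 2 + Suc c * j)"
      by (simp only: power_add[symmetric] e)
    then show "q ^ (K - j) * q ^ ((Suc j) ^ 2 + c * Suc j) * inv_qpoch q (int K - int j) * inv_qpoch q (int j)
        * inv_qpoch q (int (Suc j + c)) = q ^ Suc (K + c) * (q ^ (j ^ 2 + Suc c * j) * inv_qpoch q (int K - int j) *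
        inv_qpoch q (int j) * inv_qpoch q (int (j + Suc c)))"
      by (simp add: mult.assoc)
  qed
  finally have "(1 - q ^ Suc K) * W (Suc K) c = W K c + q ^ Suc (K + c) * W K (Suc c)" .
  also have "\<dots> = inv_qpoch q (int K) * (inv_qpoch q (int (K + c)) + q ^ Suc (K + c) * inv_qpoch q (int (Suc (K + c))))"
    unfolding IH by (simp add: algebra_simps)
  also have "inv_qpoch q (int (K + c)) = (1 - q ^ Suc (K + c)) * inv_qpoch q (int (Suc (K + c)))"
    by (rule inv_qpoch_Suc[symmetric])
  also have "inv_qpoch q (int K) = (1 - q ^ Suc K) * inv_qpoch q (int (Suc K))"
    by (rule inv_qpoch_Suc[symmetric])
  finally have "(1 - q ^ Suc K) * W (Suc K) c
     = (1 - q ^ Suc K) * (inv_qpoch q (int (Suc K)) * inv_qpoch q (int (Suc (K + c))))"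
    by (simp only: left_diff_distrib mult_1_left diff_add_cancel mult.assoc)
  then show ?case using one_minus_pow_nz[of "Suc K"]
    by (simp add: W_def del: power_Suc of_nat_Suc)
qed

text \<open>Finite form of Gauss's \<open>sum (-1)^r q^(r^2) = (q;q)_inf / (-q;q)_inf\<close>. The
  window \<open>L\<close> is kept apart from \<open>N\<close> so that the range of summation is the
  same on both sides of the induction step.\<close>

lemma gauss_finite:
  assumes "N \<le> L"
  shows "(\<Sum>r=-int L..int L. (-1) powi r * q powi (r ^ 2) * inv_qpoch q (int N - r) * inv_qpoch q (int N + r))
    = inv_qpoch q (int N) / qneg q N"
  using assms
proof (induction N)
  case 0
  have "(\<Sum>r=-int L..int L. (-1) powi r * q powi (r ^ 2) * inv_qpoch q (int 0 - r) * inv_qpoch q (int 0 + r))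
     = (\<Sum>r\<in>{0}. (-1) powi r * q powi (r ^ 2) * inv_qpoch q (int 0 - r) * inv_qpoch q (int 0 + r))"
    by (intro sum.mono_neutral_right) (auto simp: inv_qpoch_def)
  then show ?case by (simp add: inv_qpoch_def qneg_def)
next
  case (Suc N)
  define n where "n = int (Suc N)"
  \<comment> \<open>Telescoping certificate: termwise the recursion in \<open>N\<close> fails by
    exactly \<open>V r - V (r + 1)\<close>, and a negative index makes \<open>V\<close> vanish at
    both ends of the window.\<close>
  define V where "V r = (-1) powi r * q powi (r ^ 2 - r + n) * inv_qpoch q (n - r) * inv_qpoch q (n + r - 1)" for r
  have step: "(1 - q powi (2 * n)) * ((-1) powi r * q powi (r ^ 2) * inv_qpoch q (n - r) * inv_qpoch q (n + r))
     - (-1) powi r * q powi (r ^ 2) * inv_qpoch q (n - 1 - r) * inv_qpoch q (n - 1 + r) = V r - V (r + 1)" for r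
  proof -
    define A where "A = q powi (n - r)"
    define B where "B = q powi (n + r)"
    have AB: "q powi (2 * n) = A * B" using q0 by (simp add: A_def B_def flip: power_int_add)
    have a: "inv_qpoch q (n - 1 - r) = (1 - A) * inv_qpoch q (n - r)"
      using inv_qpoch_rec[of "n - r"] by (simp add: A_def algebra_simps)
    have b: "inv_qpoch q (n - 1 + r) = (1 - B) * inv_qpoch q (n + r)"
      using inv_qpoch_rec[of "n + r"] by (simp add: B_def algebra_simps)
    have v1: "V r = (-1) powi r * q powi (r ^ 2) * A * inv_qpoch q (n - r) * ((1 - B) * inv_qpoch q (n + r))"
    proof -
      have "r ^ 2 - r + n = r ^ 2 + (n - r)" by simp
      then have "q powi (r ^ 2 - r + n) = q powi (r ^ 2) * A"
        by (simp only: A_def powi_add)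
      moreover have "n + r - 1 = n - 1 + r" by simp
      ultimately show ?thesis unfolding V_def b[symmetric] by (simp only: mult.assoc)
    qed
    have "V (r + 1) = (-1) powi (r + 1) * q powi (r ^ 2 + (n + r)) * inv_qpoch q (n - 1 - r) * inv_qpoch q (n + r)"
      unfolding V_def by (simp add: power2_eq_square algebra_simps)
    also have "\<dots> = - ((-1) powi r * q powi (r ^ 2) * B * ((1 - A) * inv_qpoch q (n - r)) * inv_qpoch q (n + r))"
      unfolding a using q0 by (simp add: B_def power_int_add power_int_add_1)
    finally show ?thesis unfolding v1 a b AB by (simp add: algebra_simps)
  qed
  have V0: "V (int L + 1) = 0" "V (- int L) = 0"
    using Suc.prems by (auto simp: V_def n_def inv_qpoch_def)
  have "(1 - q powi (2 * n)) * (\<Sum>r=-int L..int L. (-1) powi r * q powi (r ^ 2) * inv_qpoch q (n - r) * inv_qpoch q (n + r))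
     = (\<Sum>r=-int L..int L. (-1) powi r * q powi (r ^ 2) * inv_qpoch q (n - 1 - r) * inv_qpoch q (n - 1 + r))
       + (\<Sum>r=-int L..int L. V r - V (r + 1))"
    unfolding sum_distrib_left sum.distrib[symmetric] step[symmetric] by simp
  also have "(\<Sum>r=-int L..int L. V r - V (r + 1)) = 0"
    unfolding sum_subtractf sum_int_shift by (simp add: V0)
  also have "(\<Sum>r=-int L..int L. (-1) powi r * q powi (r ^ 2) * inv_qpoch q (n - 1 - r) * inv_qpoch q (n - 1 + r))
     = inv_qpoch q (int N) / qneg q N"
    using Suc by (simp add: n_def)
  also have "inv_qpoch q (int N) = (1 - q ^ Suc N) * inv_qpoch q n"
    unfolding n_def by (rule inv_qpoch_Suc[symmetric])
  also have "q powi (2 * n) = q ^ Suc N * q ^ Suc N"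
    using q0 unfolding n_def mult_2 by (subst power_int_add) (simp_all only: power_int_of_nat, simp)
  \<comment> \<open>\<open>1 - q^(2*n)\<close> splits into the new factors of \<open>(q;q)_n\<close>
    and of \<open>(-q;q)_n\<close>.\<close>
  finally have *: "(1 - q ^ Suc N) * ((1 + q ^ Suc N) *
       (\<Sum>r=-int L..int L. (-1) powi r * q powi (r ^ 2) * inv_qpoch q (n - r) * inv_qpoch q (n + r)))
     = (1 - q ^ Suc N) * (inv_qpoch q n / qneg q N)"
    by (simp add: algebra_simps)
  have solve: "a * x = y \<Longrightarrow> a \<noteq> 0 \<Longrightarrow> x = y / a" for a x y :: 'a by (simp add: field_simps)
  from * have "(1 + q ^ Suc N) *
       (\<Sum>r=-int L..int L. (-1) powi r * q powi (r ^ 2) * inv_qpoch q (n - r) * inv_qpoch q (n + r))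
     = inv_qpoch q n / qneg q N"
    using one_minus_pow_nz[of "Suc N"] by (simp only: mult_cancel_left) simp
  then have "(\<Sum>r=-int L..int L. (-1) powi r * q powi (r ^ 2) * inv_qpoch q (n - r) * inv_qpoch q (n + r))
     = inv_qpoch q n / qneg q N / (1 + q ^ Suc N)"
    by (rule solve) (rule one_plus_pow_nz, simp)
  then show ?case unfolding qneg_Suc n_def by (simp add: mult.commute)
qed

section \<open>Partial fractions and Watson's identity at finite order\<close>

definition watson_coeff :: "int \<Rightarrow> 'a" where
  "watson_coeff r = (-1) powi r * q powi (r * (r + 1) div 2)"

lemma watson_coeff_add_1: "watson_coeff (r + 1) = - (q powi (r + 1)) * watson_coeff r"
proof -
  have "(r + 1) * (r + 1 + 1) div 2 = (r + 1) + r * (r + 1) div 2"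
    using tri_int_add_1[of r] by (simp add: algebra_simps)
  then have "watson_coeff (r + 1) = (-1) powi (r + 1) * q powi ((r + 1) + r * (r + 1) div 2)"
    by (simp only: watson_coeff_def)
  also have "\<dots> = - (q powi (r + 1)) * watson_coeff r"
    using q0 by (subst power_int_add) (simp_all add: watson_coeff_def power_int_add_1[of "-1"])
  finally show ?thesis .
qed

lemma watson_coeff_uminus: "watson_coeff (- r) = q powi (- r) * watson_coeff r"
proof -
  have "(- r) * (- r + 1) = r * (r + 1) + (- r) * 2" by (simp add: algebra_simps)
  then have e: "(- r) * (- r + 1) div 2 = r * (r + 1) div 2 + (- r)" by simp
  have e': "(-1 :: 'a) powi (- r) = (-1) powi r"
    by (rule power_int_minus_one_minus)
  show ?thesis unfolding watson_coeff_def e e' powi_add by (simp only: mult_ac)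
qed

text \<open>The reflection \<open>r -> -r\<close> gives no sign change. Multiplication by
  \<open>1 - q^(2*n)\<close> turns the sum into \<open>(1 - q^n) * G\<close>, and the summand of
  \<open>G\<close> is odd under \<open>r -> -r - 1\<close>. This is the term that must drop out of
  the recursion for the partial fractions.\<close>

lemma watson_coeff_sum_zero:
  assumes "N < L"
  shows "(\<Sum>r=-int L..int L. watson_coeff r * inv_qpoch q (int (Suc N) - r) * inv_qpoch q (int (Suc N) + r)) = 0"
proof -
  define n where "n = int (Suc N)"
  define S where "S = (\<Sum>r=-int L..int L. watson_coeff r * inv_qpoch q (n - r) * inv_qpoch q (n + r))"
  define g where "g r = watson_coeff r * inv_qpoch q (n - 1 - r) * inv_qpoch q (n + r)" for r
  define k where "k r = watson_coeff (r + 1) * inv_qpoch q (n - 1 - r) * inv_qpoch q (n + r)" for r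
  have split: "(1 - q powi (2 * n)) * (watson_coeff r * inv_qpoch q (n - r) * inv_qpoch q (n + r))
      = g r - q powi n * g (r - 1)" for r
  proof -
    have e: "q powi (2 * n) = q powi (n - r) * q powi (n + r)" using q0 by (simp flip: power_int_add)
    have c: "watson_coeff r = - (q powi r) * watson_coeff (r - 1)"
      using watson_coeff_add_1[of "r - 1"] by simp
    have c': "watson_coeff (r - 1) * q powi n = - (q powi (n - r)) * watson_coeff r"
      unfolding c using q0 by (simp add: power_int_diff)
    have a: "inv_qpoch q (n - 1 - r) = (1 - q powi (n - r)) * inv_qpoch q (n - r)"
      using inv_qpoch_rec[of "n - r"] by (simp add: algebra_simps)
    have b: "inv_qpoch q (n + r - 1) = (1 - q powi (n + r)) * inv_qpoch q (n + r)"
      using inv_qpoch_rec[of "n + r"] by (simp add: algebra_simps)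
    have "q powi n * g (r - 1) = (watson_coeff (r - 1) * q powi n) * inv_qpoch q (n - r) * inv_qpoch q (n + r - 1)"
      unfolding g_def by (simp add: algebra_simps)
    then show ?thesis unfolding c' g_def a b e by (simp add: algebra_simps)
  qed
  have g0: "g (int L) = 0" "g (- int L - 1) = 0" using assms by (auto simp: g_def n_def inv_qpoch_def)
  define G where "G = (\<Sum>r=-int L..int L. g r)"
  have sh: "(\<Sum>r=-int L..int L. g (r - 1)) = G"
    using sum_int_shift[of "\<lambda>r. g (r - 1)" L] g0 by (simp add: G_def)
  have anti: "g (- r - 1) = - g r" for r
  proof -
    have "- r - 1 = - (r + 1)" by simp
    then have "watson_coeff (- r - 1) = watson_coeff (- (r + 1))" by (simp only:)
    also have "\<dots> = - (q powi (- (r + 1)) * q powi (r + 1)) * watson_coeff r"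
      unfolding watson_coeff_uminus watson_coeff_add_1 by (simp only: mult_ac mult_minus_left mult_minus_right)
    also have "q powi (- (r + 1)) * q powi (r + 1) = 1"
      by (simp only: powi_add[symmetric] left_minus power_int_0_right)
    finally have "watson_coeff (- r - 1) = - watson_coeff r" by simp
    then show ?thesis by (simp add: g_def algebra_simps)
  qed
  have "G = (\<Sum>r=-int L..int L. g (- r - 1))"
    using sh sum_int_uminus[of "\<lambda>r. g (r - 1)" L] by simp
  also have "\<dots> = - G" by (simp add: anti G_def sum_negf)
  finally have "G + G = 0" by (metis eq_neg_iff_add_eq_0)
  then have "2 * G = 0" by (simp only: mult_2)
  then have "G = 0" by simp
  then have "(1 - q powi (2 * n)) * S = 0"
    unfolding S_def sum_distrib_left split sum_subtractf sum_distrib_left[symmetric] sh G_def[symmetric]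
    by simp
  moreover have "q powi (2 * n) = q ^ (2 * Suc N)"
    unfolding n_def by (metis of_nat_mult of_nat_numeral power_int_of_nat)
  ultimately show ?thesis using one_minus_pow_nz[of "2 * Suc N"] by (simp add: S_def n_def)
qed

text \<open>With \<open>n = N + 1\<close>, the identity \<open>(1 + q^n)^2 - (1 - q^(n-r)) * (1 -
  q^(n+r)) = q^n * (1 + q^r) * (1 + q^(-r))\<close> cancels the denominator \<open>1 + q^r\<close>
  in the step from \<open>N\<close> to \<open>N + 1\<close>; the defect is then a multiple of the
  vanishing sum above.\<close>

lemma watson_partial_fraction:
  assumes "N < L"
  shows "(\<Sum>r=-int L..int L. watson_coeff r / (1 + q powi r) * inv_qpoch q (int N - r) * inv_qpoch q (int N + r))
    = 1 / (2 * (qneg q N) ^ 2)"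
  using assms
proof (induction N)
  case 0
  have "(\<Sum>r=-int L..int L. watson_coeff r / (1 + q powi r) * inv_qpoch q (int 0 - r) * inv_qpoch q (int 0 + r))
     = (\<Sum>r\<in>{0}. watson_coeff r / (1 + q powi r) * inv_qpoch q (int 0 - r) * inv_qpoch q (int 0 + r))"
    by (intro sum.mono_neutral_right) (auto simp: inv_qpoch_def)
  then show ?case by (simp add: inv_qpoch_def qneg_def watson_coeff_def)
next
  case (Suc N)
  define n where "n = int (Suc N)"
  define R where "R r = inv_qpoch q (n - r) * inv_qpoch q (n + r)" for r
  \<comment> \<open>The factor \<open>1 + q^(-r)\<close> is read as adding the term at
    \<open>-r\<close>, so the defect sums to twice \<open>q^n\<close> times the vanishing
    sum.\<close>
  have step: "(1 + q powi n) ^ 2 * (watson_coeff r / (1 + q powi r) * inv_qpoch q (n - r) * inv_qpoch q (n + r))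
     - watson_coeff r / (1 + q powi r) * inv_qpoch q (n - 1 - r) * inv_qpoch q (n - 1 + r)
     = q powi n * (watson_coeff r * R r + watson_coeff (- r) * R (- r))" for r
  proof -
    have a: "inv_qpoch q (n - 1 - r) = (1 - q powi (n - r)) * inv_qpoch q (n - r)"
      using inv_qpoch_rec[of "n - r"] by (simp add: algebra_simps)
    have b: "inv_qpoch q (n - 1 + r) = (1 - q powi (n + r)) * inv_qpoch q (n + r)"
      using inv_qpoch_rec[of "n + r"] by (simp add: algebra_simps)
    define A where "A = q powi n"
    define B where "B = q powi r"
    define w where "w = watson_coeff r"
    have Bn: "B \<noteq> 0" "1 + B \<noteq> 0" using q0 one_plus_powi_nz[of r] by (auto simp: B_def)
    have p: "q powi (n - r) = A / B" "q powi (n + r) = A * B"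
      using q0 by (simp_all add: A_def B_def power_int_diff power_int_add)
    have m: "watson_coeff (- r) = w / B" by (simp add: watson_coeff_uminus power_int_minus w_def B_def field_simps)
    have R: "R (- r) = R r" by (simp add: R_def)
    have k: "((1 + A)\<^sup>2 - (1 - A / B) * (1 - A * B)) = A * (1 + 1 / B) * (1 + B)"
      using Bn by (simp add: field_simps power2_eq_square)
    have gen: "P * (W * a * b) - W * (X * a) * (Y * b) = (P - X * Y) * W * (a * b)" for P W X Y a b :: 'a
      by (simp add: algebra_simps)
    have "(1 + A) ^ 2 * (w / (1 + B) * inv_qpoch q (n - r) * inv_qpoch q (n + r))
       - w / (1 + B) * ((1 - A / B) * inv_qpoch q (n - r)) * ((1 - A * B) * inv_qpoch q (n + r))
       = ((1 + A)\<^sup>2 - (1 - A / B) * (1 - A * B)) * (w / (1 + B)) * R r"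
      unfolding R_def by (rule gen)
    also have "\<dots> = A * (1 + 1 / B) * w * R r"
      unfolding k using Bn by simp
    also have "\<dots> = A * (w * R r + w / B * R r)" by (simp add: algebra_simps)
    finally show ?thesis unfolding a b p m R A_def[symmetric] B_def[symmetric] w_def[symmetric] .
  qed
  have "(1 + q powi n) ^ 2 * (\<Sum>r=-int L..int L. watson_coeff r / (1 + q powi r) * inv_qpoch q (n - r) * inv_qpoch q (n + r))
    = (\<Sum>r=-int L..int L. watson_coeff r / (1 + q powi r) * inv_qpoch q (n - 1 - r) * inv_qpoch q (n - 1 + r))
     + (\<Sum>r=-int L..int L. q powi n * (watson_coeff r * R r + watson_coeff (- r) * R (- r)))"
    unfolding sum_distrib_left sum.distrib[symmetric] step[symmetric] by simp
  also have "(\<Sum>r=-int L..int L. q powi n * (watson_coeff r * R r + watson_coeff (- r) * R (- r))) = 0"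
    unfolding sum_distrib_left[symmetric] sum.distrib sum_int_uminus[of "\<lambda>r. watson_coeff r * R r"]
    using watson_coeff_sum_zero[of N L] Suc.prems by (simp add: R_def n_def mult.assoc)
  also have "(\<Sum>r=-int L..int L. watson_coeff r / (1 + q powi r) * inv_qpoch q (n - 1 - r) * inv_qpoch q (n - 1 + r))
     = 1 / (2 * (qneg q N) ^ 2)"
    using Suc by (simp add: n_def)
  finally have *: "(1 + q powi n) ^ 2 * (\<Sum>r=-int L..int L. watson_coeff r / (1 + q powi r) * inv_qpoch q (n - r) * inv_qpoch q (n + r))
     = 1 / (2 * (qneg q N) ^ 2)" by simp
  have solve: "a * x = y \<Longrightarrow> a \<noteq> 0 \<Longrightarrow> x = y / a" for a x y :: 'a by (simp add: field_simps)
  from * have "(\<Sum>r=-int L..int L. watson_coeff r / (1 + q powi r) * inv_qpoch q (n - r) * inv_qpoch q (n + r))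
     = 1 / (2 * (qneg q N) ^ 2) / (1 + q powi n) ^ 2"
    by (rule solve) (simp add: one_plus_powi_nz)
  also have "q powi n = q ^ Suc N" unfolding n_def by (rule power_int_of_nat)
  finally show ?case unfolding qneg_Suc n_def by (simp add: power_mult_distrib mult_ac)
qed

text \<open>The mechanism of Bailey's lemma: insert the partial fractions of
  \<open>1 / (-q;q)_n^2\<close>, exchange the sums, and evaluate the sum over \<open>n\<close> by
  the Durfee identity with offset \<open>2 * abs r\<close>. The latter contributes
  \<open>q^(r^2)\<close>, raising the exponent \<open>r*(r+1)/2\<close> to Watson's
  \<open>r*(3*r+1)/2\<close>.\<close>

lemma watson_finite:
  "(\<Sum>n\<le>N. q ^ (n ^ 2) * inv_qpoch q (int N - int n) / (qneg q n) ^ 2)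
   = (\<Sum>r=-int N..int N. 2 * watson_coeff r * q powi (r ^ 2) / (1 + q powi r)
         * inv_qpoch q (int N - r) * inv_qpoch q (int N + r))"
proof -
  have durfee: "(\<Sum>n\<le>N. q ^ (n ^ 2) * inv_qpoch q (int N - int n) * (inv_qpoch q (int n - r) * inv_qpoch q (int n + r)))
      = q powi (r ^ 2) * inv_qpoch q (int N - r) * inv_qpoch q (int N + r)"
    if "\<bar>r\<bar> \<le> int N" for r
  proof -
    define s where "s = nat \<bar>r\<bar>"
    define K where "K = N - s"
    have "s \<le> N" using that unfolding s_def by linarith
    then have N: "N = s + K" by (simp add: K_def)
    have eq: "inv_qpoch q (int n - r) * inv_qpoch q (int n + r) = inv_qpoch q (int n - int s) * inv_qpoch q (int n + int s)"
      for n by (cases "r \<ge> 0") (auto simp: s_def)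
    have "(\<Sum>n\<le>N. q ^ (n ^ 2) * inv_qpoch q (int N - int n) * (inv_qpoch q (int n - r) * inv_qpoch q (int n + r)))
       = (\<Sum>n=s..N. q ^ (n ^ 2) * inv_qpoch q (int N - int n) * (inv_qpoch q (int n - int s) * inv_qpoch q (int n + int s)))"
      unfolding eq by (intro sum.mono_neutral_right) (auto simp: inv_qpoch_def)
    also have "\<dots> = (\<Sum>j\<le>K. q ^ ((s + j) ^ 2) * inv_qpoch q (int K - int j) * (inv_qpoch q (int j) * inv_qpoch q (int (j + 2 * s))))"
      by (rule sum.reindex_bij_witness[of _ "\<lambda>j. s + j" "\<lambda>n. n - s"]) (auto simp: N algebra_simps)
    also have "\<dots> = q ^ (s ^ 2) * (\<Sum>j\<le>K. q ^ (j ^ 2 + 2 * s * j) * inv_qpoch q (int K - int j) * inv_qpoch q (int j)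
          * inv_qpoch q (int (j + 2 * s)))"
      unfolding sum_distrib_left
    proof (intro sum.cong refl)
      fix j
      have "(s + j) ^ 2 = s ^ 2 + (j ^ 2 + 2 * s * j)" by (simp add: power2_eq_square algebra_simps)
      then have "q ^ ((s + j) ^ 2) = q ^ (s ^ 2) * q ^ (j ^ 2 + 2 * s * j)" by (simp add: power_add)
      then show "q ^ ((s + j) ^ 2) * inv_qpoch q (int K - int j) * (inv_qpoch q (int j) * inv_qpoch q (int (j + 2 * s)))
        = q ^ (s ^ 2) * (q ^ (j ^ 2 + 2 * s * j) * inv_qpoch q (int K - int j) * inv_qpoch q (int j)
          * inv_qpoch q (int (j + 2 * s)))" by (simp add: mult_ac)
    qed
    also have "\<dots> = q ^ (s ^ 2) * (inv_qpoch q (int K) * inv_qpoch q (int (K + 2 * s)))"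
      unfolding durfee_finite ..
    also have "int K = int N - int s" by (simp add: N)
    also have "int (K + 2 * s) = int N + int s" by (simp add: N)
    also have "inv_qpoch q (int N - int s) * inv_qpoch q (int N + int s) = inv_qpoch q (int N - r) * inv_qpoch q (int N + r)"
      by (rule eq[symmetric])
    also have "q ^ (s ^ 2) = q powi (r ^ 2)"
    proof -
      have "r ^ 2 = int (s ^ 2)" by (simp add: s_def)
      then show ?thesis by (simp only: power_int_of_nat)
    qed
    finally show ?thesis by (simp add: mult.assoc)
  qed
  have "q ^ (n ^ 2) * inv_qpoch q (int N - int n) / (qneg q n) ^ 2
     = (\<Sum>r=-int N..int N. 2 * watson_coeff r / (1 + q powi r) * (q ^ (n ^ 2) * inv_qpoch q (int N - int n)
        * (inv_qpoch q (int n - r) * inv_qpoch q (int n + r))))" if "n \<le> N" for n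
  proof -
    \<comment> \<open>The partial fractions ask for a window strictly larger than \<open>n\<close>,
      hence \<open>N + 1\<close>; its two extra terms vanish.\<close>
    have "1 / (2 * (qneg q n) ^ 2)
      = (\<Sum>r=-int (Suc N)..int (Suc N). watson_coeff r / (1 + q powi r) * inv_qpoch q (int n - r) * inv_qpoch q (int n + r))"
      using watson_partial_fraction[of n "Suc N"] that by simp
    also have "\<dots> = (\<Sum>r=-int N..int N. watson_coeff r / (1 + q powi r) * inv_qpoch q (int n - r) * inv_qpoch q (int n + r))"
      using that by (intro sum.mono_neutral_right) (auto simp: inv_qpoch_def)
    finally have *: "1 / (2 * (qneg q n) ^ 2) =
      (\<Sum>r=-int N..int N. watson_coeff r / (1 + q powi r) * inv_qpoch q (int n - r) * inv_qpoch q (int n + r))" .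
    have half: "1 / (2 * d) = S \<Longrightarrow> c / d = 2 * c * S" for c d S :: 'a by (auto simp: field_simps)
    from * have "q ^ (n ^ 2) * inv_qpoch q (int N - int n) / (qneg q n) ^ 2
      = 2 * (q ^ (n ^ 2) * inv_qpoch q (int N - int n)) *
      (\<Sum>r=-int N..int N. watson_coeff r / (1 + q powi r) * inv_qpoch q (int n - r) * inv_qpoch q (int n + r))"
      by (rule half)
    then show ?thesis unfolding sum_distrib_left by (simp add: mult_ac)
  qed
  then have "(\<Sum>n\<le>N. q ^ (n ^ 2) * inv_qpoch q (int N - int n) / (qneg q n) ^ 2)
    = (\<Sum>n\<le>N. \<Sum>r=-int N..int N. 2 * watson_coeff r / (1 + q powi r) * (q ^ (n ^ 2) * inv_qpoch q (int N - int n)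
        * (inv_qpoch q (int n - r) * inv_qpoch q (int n + r))))"
    by (intro sum.cong) auto
  also have "\<dots> = (\<Sum>r=-int N..int N. 2 * watson_coeff r / (1 + q powi r) * (\<Sum>n\<le>N. q ^ (n ^ 2) * inv_qpoch q (int N - int n)
        * (inv_qpoch q (int n - r) * inv_qpoch q (int n + r))))"
    by (subst sum.swap) (simp only: sum_distrib_left)
  also have "\<dots> = (\<Sum>r=-int N..int N. 2 * watson_coeff r * q powi (r ^ 2) / (1 + q powi r)
         * inv_qpoch q (int N - r) * inv_qpoch q (int N + r))"
  proof (intro sum.cong refl)
    fix r assume "r \<in> {-int N..int N}"
    then have "\<bar>r\<bar> \<le> int N" by auto
    then show "2 * watson_coeff r / (1 + q powi r) * (\<Sum>n\<le>N. q ^ (n ^ 2) * inv_qpoch q (int N - int n)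
        * (inv_qpoch q (int n - r) * inv_qpoch q (int n + r)))
      = 2 * watson_coeff r * q powi (r ^ 2) / (1 + q powi r) * inv_qpoch q (int N - r) * inv_qpoch q (int N + r)"
      by (simp only: durfee) simp
  qed
  finally show ?thesis .
qed

end

section \<open>Letting the order tend to infinity\<close>

text \<open>Tannery's theorem for a range that grows with the parameter: extension by zero beyond
  \<open>N\<close> gives a fixed range, so domination is asked only where
  \<open>k \<le> N\<close>.\<close>

lemma tannery_atMost:
  fixes a :: "nat \<Rightarrow> nat \<Rightarrow> complex"
  assumes lim: "\<And>k. (\<lambda>N. a N k) \<longlonglongrightarrow> b k"
    and bound: "\<And>N k. k \<le> N \<Longrightarrow> norm (a N k) \<le> M k" and M: "summable M"
  shows "summable b" "(\<lambda>N. \<Sum>k\<le>N. a N k) \<longlonglongrightarrow> suminf b"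
proof -
  define c where "c k N = (if k \<le> N then a N k else 0)" for k N
  have M0: "0 \<le> M k" for k using order_trans[OF norm_ge_zero bound[of k k]] by simp
  have 1: "(\<lambda>N. c k N) \<longlonglongrightarrow> b k" for k
    by (rule Lim_transform_eventually[OF lim[of k]])
       (auto simp: c_def intro: eventually_mono[OF eventually_ge_at_top[of k]])
  have 2: "\<forall>\<^sub>F (k, N) in sequentially \<times>\<^sub>F sequentially. norm (c k N) \<le> M k"
    by (rule always_eventually) (auto simp: c_def bound M0)
  have T: "summable (\<lambda>k. norm (b k))" "(\<lambda>N. \<Sum>k. c k N) \<longlonglongrightarrow> suminf b"
    using tannerys_theorem[OF 1 2 M] by auto
  show "summable b" by (rule summable_norm_cancel[OF T(1)])
  have "(\<Sum>k. c k N) = (\<Sum>k\<le>N. a N k)" for N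
  proof -
    have "(\<Sum>k. c k N) = (\<Sum>k\<in>{..N}. c k N)" by (rule suminf_finite) (auto simp: c_def)
    then show ?thesis by (simp add: c_def)
  qed
  then show "(\<lambda>N. \<Sum>k\<le>N. a N k) \<longlonglongrightarrow> suminf b" using T(2) by simp
qed

context
  fixes q :: complex
  assumes q1: "norm q < 1" and q0: "q \<noteq> 0"
begin

lemma one_plus_pow_lower: "1 - norm q \<le> norm (1 + q ^ n)"
proof (cases n)
  case (Suc m)
  have "norm q ^ n \<le> norm q" using q1 power_decreasing[of 1 n "norm q"] by (simp add: Suc)
  moreover have "1 - norm (q ^ n) \<le> norm (1 + q ^ n)"
    using norm_diff_ineq[of 1 "q ^ n"] by simp
  ultimately show ?thesis by (simp add: norm_power)
qed (use q1 in \<open>simp add: order_trans[of _ 1]\<close>)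

lemma qneg_LIMSEQ: "qneg q \<longlonglongrightarrow> qpoch_inf (- q) q"
  and qpoch_inf_neg_nz: "qpoch_inf (- q) q \<noteq> 0"
proof -
  define f where "f j = 1 - (- q) * q ^ j" for j
  have f: "f j = 1 + q ^ Suc j" for j by (simp add: f_def)
  have "summable (\<lambda>j. norm (f j - 1))"
    unfolding f using q1 by (simp add: norm_mult norm_power summable_mult summable_geometric)
  then have c: "convergent_prod f"
    by (intro abs_convergent_prod_imp_convergent_prod) (simp add: abs_convergent_prod_conv_summable)
  have "(\<Prod>j\<le>n. f j) = qneg q (Suc n)" for n
    unfolding qneg_def f by (rule prod.reindex_bij_witness[of _ "\<lambda>i. i - 1" Suc]) auto
  then have "(\<lambda>n. qneg q (Suc n)) \<longlonglongrightarrow> prodinf f"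
    using convergent_prod_LIMSEQ[OF c] by simp
  moreover have fq: "prodinf f = qpoch_inf (- q) q" unfolding qpoch_inf_def by (rule arg_cong[of _ _ prodinf]) (simp add: fun_eq_iff f_def)
  ultimately show "qneg q \<longlonglongrightarrow> qpoch_inf (- q) q" by (metis LIMSEQ_imp_Suc)
  have "f j \<noteq> 0" for j unfolding f by (rule one_plus_pow_nz[OF q1 q0]) simp
  then have "prodinf f \<noteq> 0" by (rule prodinf_nonzero[OF c])
  then show "qpoch_inf (- q) q \<noteq> 0" by (simp add: fq)
qed

text \<open>\<open>P\<close> is \<open>1 / (q;q)_inf\<close>. Only its being nonzero is recorded,
  because it cancels from the identities obtained in the limit.\<close>

lemma inv_qpoch_LIMSEQ:
  obtains P where "P \<noteq> 0" "(\<lambda>n. inv_qpoch q (int n)) \<longlonglongrightarrow> P"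
proof -
  define f where "f j = 1 - q ^ Suc j" for j
  have "summable (\<lambda>j. norm (f j - 1))"
    unfolding f_def using q1 by (simp add: norm_mult norm_power summable_mult summable_geometric)
  then have c: "convergent_prod f"
    by (intro abs_convergent_prod_imp_convergent_prod) (simp add: abs_convergent_prod_conv_summable)
  have "f j \<noteq> 0" for j unfolding f_def by (rule one_minus_pow_nz[OF q1 q0]) simp
  then have nz: "prodinf f \<noteq> 0" by (rule prodinf_nonzero[OF c])
  have e: "inverse (\<Prod>j\<le>n. f j) = inv_qpoch q (int (Suc n))" for n
  proof -
    have "(\<Prod>j\<le>n. f j) = (\<Prod>i=1..Suc n. 1 - q ^ i)"
      unfolding f_def by (rule prod.reindex_bij_witness[of _ "\<lambda>i. i - 1" Suc]) auto
    then show ?thesis by (simp add: inv_qpoch_def nat_add_distrib)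
  qed
  have "(\<lambda>n. inv_qpoch q (int (Suc n))) \<longlonglongrightarrow> inverse (prodinf f)"
    unfolding e[symmetric] by (intro tendsto_inverse convergent_prod_LIMSEQ[OF c] nz)
  then have "(\<lambda>n. inv_qpoch q (int n)) \<longlonglongrightarrow> inverse (prodinf f)"
    using LIMSEQ_imp_Suc[of "\<lambda>n. inv_qpoch q (int n)"] by simp
  then show ?thesis using nz that by (metis nonzero_imp_inverse_nonzero)
qed

lemma inv_qpoch_bounded:
  obtains C where "C > 0" "\<And>k. norm (inv_qpoch q k) \<le> C"
proof -
  obtain P where "(\<lambda>n. inv_qpoch q (int n)) \<longlonglongrightarrow> P" using inv_qpoch_LIMSEQ by blast
  then have "Bseq (\<lambda>n. inv_qpoch q (int n))" by (intro convergent_imp_Bseq convergentI)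
  then obtain C where C: "C > 0" "\<And>n. norm (inv_qpoch q (int n)) \<le> C" by (auto elim: BseqE)
  have "norm (inv_qpoch q k) \<le> C" for k
    using C(1) C(2)[of "nat k"] by (cases "k < 0") (auto simp: inv_qpoch_def)
  with C(1) show ?thesis using that by blast
qed

lemma inv_qpoch_shift_LIMSEQ:
  assumes "(\<lambda>n. inv_qpoch q (int n)) \<longlonglongrightarrow> P"
  shows "(\<lambda>N. inv_qpoch q (int N + r)) \<longlonglongrightarrow> P"
proof -
  have "filterlim (\<lambda>N. nat (int N + r)) at_top sequentially"
    unfolding filterlim_at_top
  proof
    fix Z :: nat
    show "\<forall>\<^sub>F N in sequentially. Z \<le> nat (int N + r)"
      using eventually_ge_at_top[of "Z + nat \<bar>r\<bar>"] by eventually_elim linarith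
  qed
  then have "(\<lambda>N. inv_qpoch q (int (nat (int N + r)))) \<longlonglongrightarrow> P"
    by (rule filterlim_compose[OF assms])
  moreover have "\<forall>\<^sub>F N in sequentially. inv_qpoch q (int (nat (int N + r))) = inv_qpoch q (int N + r)"
    using eventually_ge_at_top[of "nat \<bar>r\<bar>"] by eventually_elim (auto intro!: arg_cong[of _ _ "inv_qpoch q"])
  ultimately show ?thesis by (rule Lim_transform_eventually)
qed

text \<open>Evenness folds the bilateral sum into a one-sided one with weights 1 and 2, to which the
  growing-range form of Tannery's theorem applies. Both reciprocals tend to \<open>P\<close>, which
  gives the factor \<open>P^2\<close>.\<close>

lemma bilateral_tannery:
  fixes g :: "int \<Rightarrow> complex"
  assumes P: "(\<lambda>n. inv_qpoch q (int n)) \<longlonglongrightarrow> P"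
    and even: "\<And>r. g (- r) = g r" and sg: "summable (\<lambda>n. norm (g (int n)))"
  obtains S where "(\<lambda>N. \<Sum>r=-int N..int N. g r) \<longlonglongrightarrow> S"
    "(\<lambda>N. \<Sum>r=-int N..int N. g r * inv_qpoch q (int N - r) * inv_qpoch q (int N + r)) \<longlonglongrightarrow> S * P\<^sup>2"
proof -
  obtain C where C: "C > 0" "\<And>k. norm (inv_qpoch q k) \<le> C" using inv_qpoch_bounded by blast
  define w :: "nat \<Rightarrow> complex" where "w r = (if r = 0 then 1 else 2)" for r
  define M where "M r = 2 * norm (g (int r)) * (C * C)" for r
  have M: "summable M" unfolding M_def by (intro summable_mult summable_mult2 sg)
  have nw: "norm (w r) \<le> 2" for r by (simp add: w_def)
  have sb: "summable (\<lambda>r. w r * g (int r))"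
    by (rule summable_comparison_test'[of "\<lambda>r. 2 * norm (g (int r))" 0])
       (use nw sg in \<open>auto intro!: summable_mult mult_right_mono simp: norm_mult\<close>)
  have 1: "(\<lambda>N. \<Sum>r\<le>N. w r * (g (int r) * inv_qpoch q (int N - int r) * inv_qpoch q (int N + int r)))
      \<longlonglongrightarrow> (\<Sum>r. w r * g (int r) * (P * P))"
  proof (rule tannery_atMost(2)[OF _ _ M])
    fix k
    have "(\<lambda>N. w k * (g (int k) * inv_qpoch q (int N + - int k) * inv_qpoch q (int N + int k)))
      \<longlonglongrightarrow> w k * (g (int k) * P * P)"
      by (intro tendsto_intros inv_qpoch_shift_LIMSEQ P)
    then show "(\<lambda>N. w k * (g (int k) * inv_qpoch q (int N - int k) * inv_qpoch q (int N + int k)))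
      \<longlonglongrightarrow> w k * g (int k) * (P * P)" by (simp add: mult.assoc)
  next
    fix N k
    have "norm (w k) * norm (g (int k)) * (norm (inv_qpoch q (int N - int k)) * norm (inv_qpoch q (int N + int k)))
        \<le> 2 * norm (g (int k)) * (C * C)"
      using C nw by (intro mult_mono mult_nonneg_nonneg) auto
    then show "norm (w k * (g (int k) * inv_qpoch q (int N - int k) * inv_qpoch q (int N + int k))) \<le> M k"
      by (simp add: norm_mult M_def mult_ac)
  qed
  have 2: "(\<lambda>N. \<Sum>r=-int N..int N. g r * inv_qpoch q (int N - r) * inv_qpoch q (int N + r))
      \<longlonglongrightarrow> (\<Sum>r. w r * g (int r)) * P\<^sup>2"
  proof -
    have "(\<Sum>r=-int N..int N. g r * inv_qpoch q (int N - r) * inv_qpoch q (int N + r))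
       = (\<Sum>r\<le>N. w r * (g (int r) * inv_qpoch q (int N - int r) * inv_qpoch q (int N + int r)))" for N
      unfolding w_def by (rule sum_int_even) (simp add: even mult_ac)
    then show ?thesis using 1 suminf_mult2[OF sb, of "P * P"] by (simp add: power2_eq_square)
  qed
  have "(\<lambda>N. \<Sum>r\<le>N. w r * g (int r)) \<longlonglongrightarrow> (\<Sum>r. w r * g (int r))"
    by (rule summable_LIMSEQ'[OF sb])
  then have "(\<lambda>N. \<Sum>r=-int N..int N. g r) \<longlonglongrightarrow> (\<Sum>r. w r * g (int r))"
    unfolding sum_int_even[of g, OF even] w_def .
  with 2 show ?thesis using that by blast
qed

lemma summable_pow_ge:
  assumes "\<And>n. n \<le> e n"
  shows "summable (\<lambda>n. c * norm q ^ e n)"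
proof (rule summable_mult, rule summable_comparison_test'[of "\<lambda>n. norm q ^ n" 0])
  show "summable (\<lambda>n. norm q ^ n)" using q1 by (simp add: summable_geometric)
  show "norm (norm q ^ e n) \<le> norm q ^ n" for n
    using power_decreasing[OF assms, of "norm q" n] q1 by simp
qed

text \<open>The limit of the finite Gauss identity is
  \<open>\<theta> * P^2 = P / (-q;q)_inf\<close>; one \<open>P\<close> is divided out. In this form
  it also shows that \<open>\<theta>\<close> does not vanish.\<close>

lemma theta_LIMSEQ:
  obtains \<theta> P where "P \<noteq> 0" "(\<lambda>n. inv_qpoch q (int n)) \<longlonglongrightarrow> P"
    "(\<lambda>N. \<Sum>r=-int N..int N. (-1) powi r * q powi (r ^ 2)) \<longlonglongrightarrow> \<theta>"
    "\<theta> * P * qpoch_inf (- q) q = 1"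
proof -
  obtain P where P: "P \<noteq> 0" "(\<lambda>n. inv_qpoch q (int n)) \<longlonglongrightarrow> P" using inv_qpoch_LIMSEQ by blast
  define g where "g r = (-1) powi r * q powi (r ^ 2)" for r :: int
  have "summable (\<lambda>n. 1 * norm q ^ (n ^ 2))"
    by (rule summable_pow_ge) (simp add: power2_eq_square)
  moreover have "norm (g (int n)) = 1 * norm q ^ (n ^ 2)" for n
  proof -
    have "q powi (int n ^ 2) = q ^ (n ^ 2)" by (metis of_nat_power power_int_of_nat)
    then show ?thesis by (simp add: g_def norm_mult norm_power)
  qed
  ultimately have "summable (\<lambda>n. norm (g (int n)))" by simp
  moreover have "g (- r) = g r" for r by (simp add: g_def power_int_minus_one_minus)
  ultimately obtain \<theta> where t: "(\<lambda>N. \<Sum>r=-int N..int N. g r) \<longlonglongrightarrow> \<theta>"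
    "(\<lambda>N. \<Sum>r=-int N..int N. g r * inv_qpoch q (int N - r) * inv_qpoch q (int N + r)) \<longlonglongrightarrow> \<theta> * P\<^sup>2"
    using bilateral_tannery[OF P(2)] by blast
  have "(\<lambda>N. inv_qpoch q (int N) / qneg q N) \<longlonglongrightarrow> P / qpoch_inf (- q) q"
    by (intro tendsto_divide P qneg_LIMSEQ qpoch_inf_neg_nz)
  moreover have "(\<Sum>r=-int N..int N. g r * inv_qpoch q (int N - r) * inv_qpoch q (int N + r))
     = inv_qpoch q (int N) / qneg q N" for N
    unfolding g_def by (rule gauss_finite[OF q1 q0]) simp
  ultimately have "\<theta> * P\<^sup>2 = P / qpoch_inf (- q) q" using LIMSEQ_unique t(2) by auto
  then have "\<theta> * P * qpoch_inf (- q) q = 1"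
    using P(1) qpoch_inf_neg_nz by (simp add: field_simps power2_eq_square)
  with P t(1) that show ?thesis unfolding g_def by blast
qed

text \<open>\<open>(q^2;q^2)_m = (q;q)_m * (-q;q)_m\<close> and, for \<open>m > 0\<close>,
  \<open>(-1;q)_m = 2 * (-q;q)_(m-1)\<close>; of the two products only the factor
  \<open>1 + q^m\<close> survives.\<close>

lemma odd_even_gf_term:
  "qpoch (- 1) q m / qpoch (q ^ 2) (q ^ 2) m = 2 * inv_qpoch q (int m) / (1 + q ^ m)"
proof (induction m)
  case (Suc m)
  have a: "qpoch (- 1) q (Suc m) = qpoch (- 1) q m * (1 + q ^ m)"
    by (simp add: qpoch_def prod.nat_ivl_Suc')
  have "q\<^sup>2 * (q\<^sup>2) ^ m = (q ^ Suc m)\<^sup>2" by (simp add: power_mult_distrib flip: power_mult) (simp add: mult.commute)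
  then have b: "qpoch (q ^ 2) (q ^ 2) (Suc m) = qpoch (q ^ 2) (q ^ 2) m * ((1 - q ^ Suc m) * (1 + q ^ Suc m))"
    by (simp add: qpoch_def prod.nat_ivl_Suc' power2_eq_square algebra_simps)
  have c: "inv_qpoch q (int m) = (1 - q ^ Suc m) * inv_qpoch q (int (Suc m))"
    by (rule inv_qpoch_Suc[OF q1 q0, symmetric])
  have nz: "1 - q ^ Suc m \<noteq> 0" "1 + q ^ m \<noteq> 0"
    using one_minus_pow_nz[OF q1 q0, of "Suc m"] one_plus_pow_nz'[OF q1 q0, of m] by auto
  have "x * u / (y * (v * w)) = x / y * u / (v * w)" for x y u v w :: complex by simp
  then have "qpoch (- 1) q (Suc m) / qpoch (q ^ 2) (q ^ 2) (Suc m)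
     = 2 * inv_qpoch q (int m) / (1 + q ^ m) * (1 + q ^ m) / ((1 - q ^ Suc m) * (1 + q ^ Suc m))"
    unfolding a b Suc[symmetric] .
  also have "\<dots> = 2 * inv_qpoch q (int (Suc m)) / (1 + q ^ Suc m)"
    unfolding c using nz by simp
  finally show ?case .
qed (simp add: qpoch_def inv_qpoch_def)

lemma mock_theta_f_altdef: "mock_theta_f q = (\<Sum>n. q ^ (n ^ 2) / (qneg q n) ^ 2)"
proof -
  have "qpoch (- q) q n = qneg q n" for n
    unfolding qpoch_def qneg_def by (intro prod.cong) (auto simp flip: power_Suc)
  then show ?thesis by (simp add: mock_theta_f_def)
qed

lemma qneg_inverse_bounded:
  obtains D where "D > 0" "\<And>n. norm (inverse (qneg q n)) \<le> D"
proof -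
  have "(\<lambda>n. inverse (qneg q n)) \<longlonglongrightarrow> inverse (qpoch_inf (- q) q)"
    by (intro tendsto_inverse qneg_LIMSEQ qpoch_inf_neg_nz)
  then have "Bseq (\<lambda>n. inverse (qneg q n))" by (intro convergent_imp_Bseq convergentI)
  then show ?thesis using that by (auto elim: BseqE)
qed

lemma mock_theta_f_LIMSEQ:
  assumes P: "(\<lambda>n. inv_qpoch q (int n)) \<longlonglongrightarrow> P"
  shows "(\<lambda>N. \<Sum>n\<le>N. q ^ (n ^ 2) * inv_qpoch q (int N - int n) / (qneg q n) ^ 2) \<longlonglongrightarrow> mock_theta_f q * P"
proof -
  obtain C where C: "C > 0" "\<And>k. norm (inv_qpoch q k) \<le> C" using inv_qpoch_bounded by blast
  obtain D where D: "D > 0" "\<And>n. norm (inverse (qneg q n)) \<le> D" using qneg_inverse_bounded by blast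
  have n2: "n \<le> n ^ 2" for n :: nat by (simp add: power2_eq_square)
  have D2: "norm (inverse ((qneg q n)\<^sup>2)) \<le> D\<^sup>2" for n
    using power_mono[OF D(2), of n 2] by (simp add: norm_power power_inverse norm_inverse)
  have S: "summable (\<lambda>n. q ^ (n ^ 2) / (qneg q n) ^ 2)"
  proof (rule summable_comparison_test'[OF summable_pow_ge[OF n2, of "D\<^sup>2"], of 0])
    fix n
    have "norm q ^ (n ^ 2) * norm (inverse ((qneg q n)\<^sup>2)) \<le> norm q ^ (n ^ 2) * D\<^sup>2"
      by (intro mult_left_mono D2) simp
    then show "norm (q ^ (n ^ 2) / (qneg q n) ^ 2) \<le> D\<^sup>2 * norm q ^ (n ^ 2)"
      by (simp add: norm_mult norm_power divide_inverse mult.commute)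
  qed
  have "(\<lambda>N. \<Sum>n\<le>N. q ^ (n ^ 2) * inv_qpoch q (int N - int n) / (qneg q n) ^ 2)
     \<longlonglongrightarrow> (\<Sum>n. q ^ (n ^ 2) / (qneg q n) ^ 2 * P)"
  proof (rule tannery_atMost(2))
    fix k
    have "(\<lambda>N. q ^ (k ^ 2) * inv_qpoch q (int N + - int k) / (qneg q k) ^ 2) \<longlonglongrightarrow> q ^ (k ^ 2) * P / (qneg q k) ^ 2"
      by (intro tendsto_intros inv_qpoch_shift_LIMSEQ P) (simp add: qneg_nz[OF q1 q0])
    then show "(\<lambda>N. q ^ (k ^ 2) * inv_qpoch q (int N - int k) / (qneg q k) ^ 2) \<longlonglongrightarrow> q ^ (k ^ 2) / (qneg q k) ^ 2 * P"
      by simp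
  next
    fix N k
    have "norm q ^ (k ^ 2) * (norm (inv_qpoch q (int N - int k)) * norm (inverse ((qneg q k)\<^sup>2)))
       \<le> norm q ^ (k ^ 2) * (C * D\<^sup>2)"
      using C by (intro mult_left_mono mult_mono D2) auto
    then show "norm (q ^ (k ^ 2) * inv_qpoch q (int N - int k) / (qneg q k) ^ 2) \<le> (C * D\<^sup>2) * norm q ^ (k ^ 2)"
      by (simp add: norm_mult norm_power divide_inverse mult_ac)
  next
    show "summable (\<lambda>n. (C * D\<^sup>2) * norm q ^ (n ^ 2))" by (rule summable_pow_ge[OF n2])
  qed
  then show ?thesis unfolding mock_theta_f_altdef suminf_mult2[OF S] .
qed

lemma tri_ge: "n \<le> n * (n + 1) div 2" for n :: nat
  by (induction n) (simp_all add: tri_Suc[simplified])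

lemma odd_even_gf_sums:
  "(\<lambda>m. 2 * q ^ (m * (m + 1) div 2) * inv_qpoch q (int m) / (1 + q ^ m)) sums odd_even_gf q"
  and odd_even_gf_LIMSEQ:
  "(\<lambda>n. inv_qpoch q (int n)) \<longlonglongrightarrow> P \<Longrightarrow>
   (\<lambda>N. \<Sum>m\<le>N. 2 * q ^ (m * (m + 1) div 2) * inv_qpoch q (int m) * inv_qpoch q (int N - int m) / (1 + q ^ m))
      \<longlonglongrightarrow> odd_even_gf q * P"
proof -
  define b where "b m = 2 * q ^ (m * (m + 1) div 2) * inv_qpoch q (int m) / (1 + q ^ m)" for m
  obtain C where C: "C > 0" "\<And>k. norm (inv_qpoch q k) \<le> C" using inv_qpoch_bounded by blast
  have nb: "norm (b m) \<le> (2 * C / (1 - norm q)) * norm q ^ (m * (m + 1) div 2)" for m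
  proof -
    have "norm (inv_qpoch q (int m)) / norm (1 + q ^ m) \<le> C / (1 - norm q)"
      using C q1 by (intro frac_le one_plus_pow_lower) auto
    from mult_left_mono[OF this, of "2 * norm q ^ (m * (m + 1) div 2)"] show ?thesis
      by (simp add: b_def norm_mult norm_divide norm_power mult_ac)
  qed
  have S: "summable b"
    by (rule summable_comparison_test'[OF summable_pow_ge[OF tri_ge], of 0]) (rule nb)
  have trm: "qpoch (- 1) q m * q ^ (m * (m + 1) div 2) / qpoch (q ^ 2) (q ^ 2) m = b m" for m
  proof -
    have "x * z / y = z * (x / y)" for x y z :: complex by simp
    from this[of "qpoch (- 1) q m" "q ^ (m * (m + 1) div 2)" "qpoch (q ^ 2) (q ^ 2) m"] show ?thesis
      unfolding odd_even_gf_term b_def by simp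
  qed
  have gf: "odd_even_gf q = suminf b" unfolding odd_even_gf_def trm ..
  then show "(\<lambda>m. 2 * q ^ (m * (m + 1) div 2) * inv_qpoch q (int m) / (1 + q ^ m)) sums odd_even_gf q"
    unfolding b_def[symmetric] using S by (simp add: summable_sums)
  assume P: "(\<lambda>n. inv_qpoch q (int n)) \<longlonglongrightarrow> P"
  have "(\<lambda>N. \<Sum>m\<le>N. b m * inv_qpoch q (int N - int m)) \<longlonglongrightarrow> (\<Sum>m. b m * P)"
  proof (rule tannery_atMost(2))
    fix k
    have "(\<lambda>N. b k * inv_qpoch q (int N + - int k)) \<longlonglongrightarrow> b k * P"
      by (intro tendsto_intros inv_qpoch_shift_LIMSEQ P)
    then show "(\<lambda>N. b k * inv_qpoch q (int N - int k)) \<longlonglongrightarrow> b k * P" by simp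
  next
    fix N k
    have "norm (b k) * norm (inv_qpoch q (int N - int k)) \<le> (2 * C / (1 - norm q)) * norm q ^ (k * (k + 1) div 2) * C"
      using C q1 by (intro mult_mono nb) auto
    then show "norm (b k * inv_qpoch q (int N - int k)) \<le> (C * (2 * C / (1 - norm q))) * norm q ^ (k * (k + 1) div 2)"
      by (simp add: norm_mult mult_ac)
  next
    show "summable (\<lambda>k. (C * (2 * C / (1 - norm q))) * norm q ^ (k * (k + 1) div 2))"
      by (rule summable_pow_ge[OF tri_ge])
  qed
  also have "(\<Sum>m. b m * P) = odd_even_gf q * P" unfolding gf suminf_mult2[OF S] ..
  finally show "(\<lambda>N. \<Sum>m\<le>N. 2 * q ^ (m * (m + 1) div 2) * inv_qpoch q (int m) * inv_qpoch q (int N - int m) / (1 + q ^ m))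
      \<longlonglongrightarrow> odd_even_gf q * P" by (simp add: b_def)
qed

lemma odd_even_gf_eq: "odd_even_gf q = qpoch_inf (- q) q * mock_theta_f q"
proof -
  obtain P where P: "P \<noteq> 0" "(\<lambda>n. inv_qpoch q (int n)) \<longlonglongrightarrow> P" using inv_qpoch_LIMSEQ by blast
  have "(\<lambda>N. qneg q N * (\<Sum>n\<le>N. q ^ (n ^ 2) * inv_qpoch q (int N - int n) / (qneg q n) ^ 2))
     \<longlonglongrightarrow> qpoch_inf (- q) q * (mock_theta_f q * P)"
    by (intro tendsto_mult qneg_LIMSEQ mock_theta_f_LIMSEQ P)
  then have "odd_even_gf q * P = qpoch_inf (- q) q * (mock_theta_f q * P)"
    using odd_even_gf_LIMSEQ[OF P(2)] unfolding overpartition_mock_finite[OF q1 q0]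
    by (rule LIMSEQ_unique[rotated])
  then show ?thesis using P(1) by simp
qed

text \<open>Watson gives \<open>f = S * P\<close> and Gauss gives
  \<open>\<theta> * P * (-q;q)_inf = 1\<close>, so all infinite products cancel in
  \<open>(-q;q)_inf * f * \<theta>\<close>. Both series are stated as limits over symmetric windows,
  the form in which the residue calculus delivers them.\<close>

lemma odd_even_gf_quotient:
  obtains \<theta> where "\<theta> \<noteq> 0"
    "(\<lambda>N. \<Sum>r=-int N..int N. (-1) powi r * q powi (r ^ 2)) \<longlonglongrightarrow> \<theta>"
    "(\<lambda>N. \<Sum>r=-int N..int N. 2 * watson_coeff q r * q powi (r ^ 2) / (1 + q powi r)) \<longlonglongrightarrow> odd_even_gf q * \<theta>"
proof -
  obtain \<theta> P where P: "P \<noteq> 0" "(\<lambda>n. inv_qpoch q (int n)) \<longlonglongrightarrow> P"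
    and t: "(\<lambda>N. \<Sum>r=-int N..int N. (-1) powi r * q powi (r ^ 2)) \<longlonglongrightarrow> \<theta>"
    "\<theta> * P * qpoch_inf (- q) q = 1" using theta_LIMSEQ by blast
  define g where "g r = 2 * watson_coeff q r * q powi (r ^ 2) / (1 + q powi r)" for r
  \<comment> \<open>Reflection multiplies numerator and denominator by the same
    \<open>q^(-r)\<close>.\<close>
  have even: "g (- r) = g r" for r
  proof -
    have "1 + q powi (- r) = q powi (- r) * (1 + q powi r)"
      using q0 by (simp add: ring_distribs power_int_minus)
    then show ?thesis unfolding g_def watson_coeff_uminus[OF q1 q0] using q0 by simp
  qed
  have ng: "norm (g (int n)) \<le> (2 / (1 - norm q)) * norm q ^ (n * (n + 1) div 2 + n ^ 2)" for n
  proof -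
    have a: "q powi (int n * (int n + 1) div 2) = q ^ (n * (n + 1) div 2)"
    proof -
      have "int n * (int n + 1) div 2 = int (n * (n + 1) div 2)" by (simp add: zdiv_int algebra_simps)
      then show ?thesis by (simp only: power_int_of_nat)
    qed
    have b: "q powi (int n ^ 2) = q ^ (n ^ 2)" by (metis of_nat_power power_int_of_nat)
    have "norm (g (int n)) = 2 * norm q ^ (n * (n + 1) div 2 + n ^ 2) / norm (1 + q ^ n)"
      unfolding g_def watson_coeff_def[OF q1 q0] a b
      by (simp add: norm_mult norm_divide norm_power power_add)
    also have "\<dots> \<le> 2 * norm q ^ (n * (n + 1) div 2 + n ^ 2) / (1 - norm q)"
      using q1 one_plus_pow_nz'[OF q1 q0, of n]
      by (intro divide_left_mono one_plus_pow_lower mult_pos_pos) auto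
    finally show ?thesis by simp
  qed
  have "summable (\<lambda>n. norm (g (int n)))"
    by (rule summable_comparison_test'[OF summable_pow_ge[of "\<lambda>n. n * (n + 1) div 2 + n ^ 2" "2 / (1 - norm q)"], of 0])
       (use ng tri_ge in \<open>auto intro: trans_le_add1\<close>)
  then obtain S where S: "(\<lambda>N. \<Sum>r=-int N..int N. g r) \<longlonglongrightarrow> S"
    "(\<lambda>N. \<Sum>r=-int N..int N. g r * inv_qpoch q (int N - r) * inv_qpoch q (int N + r)) \<longlonglongrightarrow> S * P\<^sup>2"
    using bilateral_tannery[of P g, OF P(2) even] by blast
  have "S * P\<^sup>2 = mock_theta_f q * P"
    using S(2) mock_theta_f_LIMSEQ[OF P(2)] unfolding g_def watson_finite[OF q1 q0]
    by (rule LIMSEQ_unique)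
  then have "S * P = mock_theta_f q" using P(1) by (simp add: power2_eq_square)
  then have "odd_even_gf q = qpoch_inf (- q) q * (S * P)" unfolding odd_even_gf_eq by simp
  then have "odd_even_gf q * \<theta> = S * (\<theta> * P * qpoch_inf (- q) q)" by simp
  then have "odd_even_gf q * \<theta> = S" using t(2) by simp
  moreover have "\<theta> \<noteq> 0" using t(2) by auto
  ultimately show ?thesis using that t(1) S(1) unfolding g_def by simp
qed

end

section \<open>Alternating sums as contour integrals\<close>

lemma contour_integral_linepath_same_Im:
  assumes "a < b"
  shows "contour_integral (linepath (Complex a c) (Complex b c)) f = integral {a..b} (\<lambda>x. f (Complex x c))"
proof -
  have "contour_integral (linepath (Complex a c) (Complex b c)) f
      = (Complex b c - Complex a c) * integral {0..1} (\<lambda>x. f (linepath (Complex a c) (Complex b c) x))"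
    by (simp add: contour_integral_integral)
  also have "Complex b c - Complex a c = of_real (b - a)"
    by (simp add: complex_eq_iff)
  also have "integral {0..1} (\<lambda>x. f (linepath (Complex a c) (Complex b c) x)) =
             integral {0..1} (\<lambda>x. f (Complex (linepath a b x) c))"
    by (simp add: linepath_def Complex_eq scaleR_conv_of_real algebra_simps)
  also have "\<dots> = integral {0..(b - a) / (b - a)} (\<lambda>x. f (Complex (a + (b - a) * x) c))"
    using \<open>a < b\<close> by (simp add: algebra_simps linepath_def)
  also have "{0..(b - a) / (b - a)} = (\<lambda>x. x / (b - a)) ` {0..b - a}"
    using \<open>a < b\<close> by simp
  also have "integral \<dots> (\<lambda>x. f (Complex (a + (b - a) * x) c)) =
             integral {a-a..b-a} (\<lambda>x. f (Complex (x + a) c)) / of_real (b - a)"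
    using \<open>a < b\<close> by (subst integral_stretch_real) (auto simp: scaleR_conv_of_real add_ac)
  also have "\<dots> = integral {a..b} (\<lambda>x. f (Complex x c)) / of_real (b - a)"
    by (subst integral_shift_real_ivl) (rule refl)
  finally show ?thesis
    using \<open>a < b\<close> by simp
qed

text \<open>Half-way between two zeros the modulus of the sine is \<open>cosh (pi * t)\<close>, so
  vertical sides placed there avoid the poles uniformly in \<open>N\<close>.\<close>

lemma norm_sin_half_integer_ge: "1 \<le> norm (sin (of_real pi * Complex (real N + 1/2) t))"
proof -
  define e where "e = exp (2 * (pi * t))"
  have e: "e > 0" by (simp add: e_def)
  have "2 \<le> e + inverse e"
  proof -
    have "0 \<le> (e - 1)^2 / e" using e by simp
    also have "\<dots> = e + inverse e - 2" using e by (simp add: field_simps power2_eq_square)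
    finally show ?thesis by simp
  qed
  moreover have "cos (2 * (pi * (real N + 1/2))) = -1"
  proof -
    have "2 * (pi * (real N + 1/2)) = pi + 2 * pi * of_int (int N)" by (simp add: algebra_simps)
    then show ?thesis by (simp only: cos_add cos_int_2pin sin_int_2pin) simp
  qed
  ultimately have "1 \<le> norm (sin (of_real pi * Complex (real N + 1/2) t)) ^ 2"
    unfolding norm_sin_squared by (simp add: e_def[symmetric])
  then show ?thesis by (metis norm_ge_zero one_power2 power2_le_imp_le)
qed

lemma integral_symmetric_LIMSEQ:
  fixes f :: "real \<Rightarrow> 'a::euclidean_space"
  assumes f: "integrable lborel f" and R: "filterlim R at_top sequentially"
  shows "(\<lambda>N::nat. integral {- R N..R N} f) \<longlonglongrightarrow> (LINT x|lborel. f x)"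
proof -
  have e: "integral {- R N..R N} f = (LINT x|lborel. indicator {- R N..R N} x *\<^sub>R f x)" for N
  proof -
    have "set_integrable lborel {- R N..R N} f"
      using f unfolding set_integrable_def by (intro integrable_mult_indicator) auto
    from set_borel_integral_eq_integral(2)[OF this] show ?thesis
      by (simp add: set_lebesgue_integral_def)
  qed
  show ?thesis unfolding e
  proof (rule integral_dominated_convergence)
    show "f \<in> borel_measurable lborel" using f by auto
    show "(\<lambda>x. indicator {- R N..R N} x *\<^sub>R f x) \<in> borel_measurable lborel" for N
      using f by (intro borel_measurable_scaleR) auto
    show "integrable lborel (\<lambda>x. norm (f x))" using f by simp
    show "AE x in lborel. norm (indicator {- R N..R N} x *\<^sub>R f x) \<le> norm (f x)" for N
      by (auto simp: indicator_def)
    show "AE x in lborel. (\<lambda>N. indicator {- R N..R N} x *\<^sub>R f x) \<longlonglongrightarrow> f x"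
    proof (rule AE_I2, rule tendsto_eventually)
      fix x :: real
      have "\<forall>\<^sub>F N in sequentially. \<bar>x\<bar> \<le> R N" using R by (simp add: filterlim_at_top)
      then show "\<forall>\<^sub>F N in sequentially. indicator {- R N..R N} x *\<^sub>R f x = f x"
        by eventually_elim (auto simp: indicator_def)
    qed
  qed
qed

text \<open>\<open>F s / sin (pi * s)\<close> has residue \<open>(-1)^n * F n / pi\<close> at the
  integer \<open>n\<close>. Evenness of \<open>F\<close> makes this function odd, so both horizontal
  sides of the rectangle contribute equally and one line integral below the axis remains;
  \<open>\<epsilon>\<close> controls the vertical sides.\<close>

lemma alternating_sum_contour:
  fixes F :: "complex \<Rightarrow> complex"
  assumes c: "0 < c" "c < c'" and holo: "F holomorphic_on {s. \<bar>Im s\<bar> < c'}"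
    and even: "\<And>s. F (- s) = F s" and nz: "\<And>n::int. F (of_int n) \<noteq> 0"
    and int: "integrable lborel (\<lambda>x. F (Complex x (-c)) / sin (of_real pi * Complex x (-c)))"
    and decay: "\<epsilon> \<longlonglongrightarrow> 0" "\<And>N t. \<bar>t\<bar> \<le> c \<Longrightarrow> norm (F (Complex (real N + 1/2) t)) \<le> \<epsilon> N"
  shows "(\<lambda>N. \<Sum>n=-int N..int N. (-1) powi n * F (of_int n))
     \<longlonglongrightarrow> - \<i> * (LINT x|lborel. F (Complex x (-c)) / sin (of_real pi * Complex x (-c)))"
proof -
  define g where "g s = F s / sin (of_real pi * s)" for s
  define R where "R N = real N + 1/2" for N
  define r where "r N = contour_integral (linepath (Complex (R N) (-c)) (Complex (R N) c)) g" for N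
  define l where "l N = contour_integral (linepath (Complex (- R N) c) (Complex (- R N) (-c))) g" for N
  define b where "b N = integral {- R N..R N} (\<lambda>x. g (Complex x (-c)))" for N
  have sin0: "sin (of_real pi * s) = 0 \<longleftrightarrow> s \<in> \<int>" for s :: complex
  proof -
    have "sin (of_real pi * s) = 0 \<longleftrightarrow> (\<exists>n::int. of_real pi * s = of_real pi * of_int n)"
      unfolding sin_eq_0 by (simp add: mult.commute)
    then show ?thesis by (auto simp: Ints_def)
  qed
  have odd: "g (- s) = - g s" for s by (simp add: g_def even)
  have Rnn: "\<bar>x\<bar> = R N \<Longrightarrow> Complex x t \<notin> \<int>" for x N t
  proof
    assume *: "\<bar>x\<bar> = R N" "Complex x t \<in> \<int>"
    then obtain k where "Complex x t = of_int k" by (auto elim: Ints_cases)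
    then have "x = of_int k" by (simp add: complex_eq_iff)
    with * have "of_int \<bar>k\<bar> = real N + 1/2" by (simp add: R_def)
    then have "of_int (2 * \<bar>k\<bar>) = (of_int (2 * int N + 1) :: real)" by simp
    then have "2 * \<bar>k\<bar> = 2 * int N + 1" by (simp only: of_int_eq_iff)
    then show False by presburger
  qed
  have cnn: "\<bar>t\<bar> = c \<Longrightarrow> Complex x t \<notin> \<int>" for x t
    using c(1) by (auto elim!: Ints_cases simp: complex_eq_iff)
  have cont: "continuous_on A g" if "A \<subseteq> {s. \<bar>Im s\<bar> < c'}" "A \<inter> \<int> = {}" for A
    unfolding g_def using that
    by (intro continuous_intros continuous_on_subset[OF holomorphic_on_imp_continuous_on[OF holo]]) (auto simp: sin0)
  have sum_eq: "2 * \<i> * (\<Sum>n=-int N..int N. (-1) powi n * F (of_int n)) = 2 * b N + r N + l N" for N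
  proof -
    \<comment> \<open>An open box containing the rectangle but no integers other than those in
      \<open>-N..N\<close>.\<close>
    define S where "S = box (Complex (- (real N + 1)) (- c')) (Complex (real N + 1) c')"
    define pts where "pts = (of_int ` {-int N..int N} :: complex set)"
    define p1 p2 p3 p4 where "p1 = Complex (- R N) (-c)" "p2 = Complex (R N) (-c)" "p3 = Complex (R N) c" "p4 = Complex (- R N) c"
    have Rpos: "R N > 0" "R N < real N + 1" "real N < R N" by (simp_all add: R_def)
    have S: "open S" "connected S" unfolding S_def by (auto intro: convex_connected)
    have ints: "s \<in> pts" if sS: "s \<in> S" and sI: "s \<in> \<int>" for s
    proof -
      obtain k where k: "s = of_int k" using sI by (auto elim: Ints_cases)
      then have "\<bar>of_int k\<bar> < real N + 1" using sS by (auto simp: S_def in_box_complex_iff)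
      then have "\<bar>k\<bar> < int N + 1" by linarith
      then have "k \<in> {-int N..int N}" by auto
      then show ?thesis unfolding pts_def k by (rule imageI)
    qed
    have Ssub: "S \<subseteq> {s. \<bar>Im s\<bar> < c'}" by (auto simp: S_def in_box_complex_iff)
    have hol: "g holomorphic_on S - pts"
      unfolding g_def by (intro holomorphic_intros holomorphic_on_subset[OF holo]) (use Ssub ints in \<open>auto simp: sin0\<close>)
    have seg: "closed_segment p1 p2 = {s. Im s = -c \<and> Re s \<in> {- R N..R N}}"
      "closed_segment p2 p3 = {s. Re s = R N \<and> Im s \<in> {-c..c}}"
      "closed_segment p3 p4 = {s. Im s = c \<and> Re s \<in> {- R N..R N}}"
      "closed_segment p4 p1 = {s. Re s = - R N \<and> Im s \<in> {-c..c}}"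
      unfolding p1_p2_p3_p4_def using c Rpos
      by (auto simp: closed_segment_same_Re closed_segment_same_Im closed_segment_eq_real_ivl)
    have sub: "closed_segment p1 p2 \<union> closed_segment p2 p3 \<union> closed_segment p3 p4 \<union> closed_segment p4 p1 \<subseteq> S - \<int>"
      unfolding seg using c Rpos Rnn[of "R N" N] Rnn[of "- R N" N] cnn[of c] cnn[of "-c"]
      by (auto simp: S_def in_box_complex_iff) (metis abs_minus_cancel abs_of_pos cnn Rnn complex.collapse)+
    have ci: "g contour_integrable_on linepath p1 p2" "g contour_integrable_on linepath p2 p3"
      "g contour_integrable_on linepath p3 p4" "g contour_integrable_on linepath p4 p1"
      using sub Ssub by (auto intro!: contour_integrable_continuous_linepath cont)
    have rp: "rectpath p1 p3 = linepath p1 p2 +++ linepath p2 p3 +++ linepath p3 p4 +++ linepath p4 p1"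
      by (simp add: rectpath_def p1_p2_p3_p4_def Let_def)
    have "contour_integral (rectpath p1 p3) g = contour_integral (linepath p1 p2) g + contour_integral (linepath p2 p3) g
        + contour_integral (linepath p3 p4) g + contour_integral (linepath p4 p1) g"
      unfolding rp using ci by (simp add: contour_integrable_joinI add.assoc)
    also have "contour_integral (linepath p1 p2) g = b N"
      unfolding p1_p2_p3_p4_def b_def using Rpos by (intro contour_integral_linepath_same_Im) simp
    \<comment> \<open>Reversing the upper side and substituting \<open>- x\<close> turns it into the
      lower side; the sign of the reversal is cancelled by the oddness of \<open>g\<close>.\<close>
    also have "contour_integral (linepath p3 p4) g = b N"
    proof -
      have "contour_integral (linepath p3 p4) g = - contour_integral (linepath p4 p3) g"
      proof (rule contour_integral_reverse_linepath)
        show "continuous_on (closed_segment p3 p4) g" by (rule cont) (use sub Ssub in auto)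
      qed
      also have "contour_integral (linepath p4 p3) g = integral {- R N..R N} (\<lambda>x. g (Complex x c))"
        unfolding p1_p2_p3_p4_def using Rpos by (intro contour_integral_linepath_same_Im) simp
      also have "\<dots> = integral {- R N..- (- R N)} (\<lambda>x. g (Complex (- x) c))"
        using Henstock_Kurzweil_Integration.integral_reflect_real[of "R N" "- R N" "\<lambda>x. g (Complex x c)"] by simp
      also have "(\<lambda>x. g (Complex (- x) c)) = (\<lambda>x. - g (Complex x (- c)))"
      proof
        fix x
        have "Complex (- x) c = - Complex x (- c)" by (simp add: complex_eq_iff)
        then show "g (Complex (- x) c) = - g (Complex x (- c))" by (simp only: odd)
      qed
      finally show ?thesis by (simp add: b_def)
    qed
    finally have ci_eq: "contour_integral (rectpath p1 p3) g = 2 * b N + r N + l N"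
      by (simp add: r_def l_def p1_p2_p3_p4_def)
    have "contour_integral (rectpath p1 p3) g = 2 * pi * \<i> * (\<Sum>p\<in>pts. winding_number (rectpath p1 p3) p * residue g p)"
    proof (rule Residue_theorem[OF S _ hol])
      show "path_image (rectpath p1 p3) \<subseteq> S - pts"
        unfolding rp using sub by (auto simp: path_image_join pts_def)
      show "\<forall>z. z \<notin> S \<longrightarrow> winding_number (rectpath p1 p3) z = 0"
      proof (intro allI impI winding_number_rectpath_outside)
        fix z assume "z \<notin> S"
        then show "z \<notin> cbox p1 p3" using c Rpos
          by (auto simp: S_def in_box_complex_iff in_cbox_complex_iff p1_p2_p3_p4_def)
      qed (use c Rpos in \<open>auto simp: p1_p2_p3_p4_def\<close>)
    qed (auto simp: pts_def)
    also have "(\<Sum>p\<in>pts. winding_number (rectpath p1 p3) p * residue g p)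
       = (\<Sum>n=-int N..int N. (-1) powi n * F (of_int n) / of_real pi)"
      unfolding pts_def
    proof (subst sum.reindex, simp add: inj_on_def, intro sum.cong refl)
      fix n assume n: "n \<in> {-int N..int N}"
      then have nR: "\<bar>real_of_int n\<bar> < R N" using Rpos by auto
      have w: "winding_number (rectpath p1 p3) (of_int n) = 1"
        using nR c by (intro winding_number_rectpath) (auto simp: in_box_complex_iff p1_p2_p3_p4_def)
      have cs: "cos (of_real pi * of_int n) = ((-1) powi n :: complex)"
      proof -
        have "cos (of_real pi * of_int n :: complex) = of_real (cos (pi * of_int n))"
          by (subst cos_of_real[symmetric]) simp
        also have "\<dots> = (-1) powi n" by (simp only: cos_npi_int) (simp add: power_int_minus_left)
        finally show ?thesis .
      qed
      have "residue (\<lambda>w. F w / sin (of_real pi * w)) (of_int n) = F (of_int n) / (of_real pi * cos (of_real pi * of_int n))"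
      proof (rule residue_simple_pole_deriv[OF holomorphic_on_subset[OF holo Ssub] _ S])
        show "(\<lambda>w. sin (of_real pi * w)) holomorphic_on S" by (intro holomorphic_intros)
        show "of_int n \<in> S" using nR Rpos c by (auto simp: S_def in_box_complex_iff)
        show "((\<lambda>w. sin (of_real pi * w)) has_field_derivative of_real pi * cos (of_real pi * of_int n)) (at (of_int n))"
          by (auto intro!: derivative_eq_intros)
        show "of_real pi * cos (of_real pi * of_int n :: complex) \<noteq> 0" by (simp add: cs)
      qed (use nz sin0 in auto)
      then show "((\<lambda>p. winding_number (rectpath p1 p3) p * residue g p) \<circ> of_int) n = (-1) powi n * F (of_int n) / of_real pi"
        by (simp add: w g_def[abs_def] cs power_int_minus_left)
    qed
    finally show ?thesis unfolding ci_eq sum_divide_distrib[symmetric] by (simp add: field_simps)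
  qed
  have side: "norm (r N) \<le> \<epsilon> N * (2 * c)" "norm (l N) \<le> \<epsilon> N * (2 * c)" for N
  proof -
    have bd: "norm (g (Complex (R N) t)) \<le> \<epsilon> N" if "\<bar>t\<bar> \<le> c" for t
    proof -
      have "norm (g (Complex (R N) t)) \<le> \<epsilon> N / 1"
        unfolding g_def norm_divide R_def
        by (intro frac_le decay that norm_sin_half_integer_ge order_trans[OF norm_ge_zero decay(2)[OF that]]) auto
      then show ?thesis by simp
    qed
    have bd': "norm (g (Complex (- R N) t)) \<le> \<epsilon> N" if "\<bar>t\<bar> \<le> c" for t
    proof -
      have "Complex (- R N) t = - Complex (R N) (- t)" by (simp add: complex_eq_iff)
      then show ?thesis using bd[of "-t"] that by (simp only: odd norm_minus_cancel abs_minus_cancel)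
    qed
    have \<epsilon>0: "0 \<le> \<epsilon> N" using order_trans[OF norm_ge_zero bd[of 0]] c by simp
    have Rp: "R N > 0" by (simp add: R_def)
    have sg: "s \<in> closed_segment (Complex x (-c)) (Complex x c) \<Longrightarrow> s = Complex x (Im s) \<and> \<bar>Im s\<bar> \<le> c" for s x
      using c by (auto simp: closed_segment_same_Re closed_segment_eq_real_ivl complex_eq_iff)
    have ctb: "g contour_integrable_on linepath (Complex x (-c)) (Complex x c)" if "\<bar>x\<bar> = R N" for x
    proof (intro contour_integrable_continuous_linepath cont)
      show "closed_segment (Complex x (- c)) (Complex x c) \<subseteq> {s. \<bar>Im s\<bar> < c'}" using sg c by fastforce
      show "closed_segment (Complex x (- c)) (Complex x c) \<inter> \<int> = {}" using sg Rnn[OF that] by (metis disjoint_iff)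
    qed
    have n2c: "norm (Complex x c - Complex x (-c)) = 2 * c" for x
    proof -
      have "Complex x c - Complex x (-c) = of_real (2 * c) * \<i>" by (simp add: complex_eq_iff)
      then show ?thesis using c by (simp only: norm_mult norm_of_real) simp
    qed
    have "norm (r N) \<le> \<epsilon> N * norm (Complex (R N) c - Complex (R N) (-c))"
      unfolding r_def
    proof (rule contour_integral_bound_linepath[OF ctb \<epsilon>0])
      fix s assume "s \<in> closed_segment (Complex (R N) (-c)) (Complex (R N) c)"
      then show "norm (g s) \<le> \<epsilon> N" using sg bd by metis
    qed (use Rp in auto)
    then show "norm (r N) \<le> \<epsilon> N * (2 * c)" by (simp only: n2c)
    have "norm (l N) = norm (contour_integral (linepath (Complex (- R N) (-c)) (Complex (- R N) c)) g)"
      unfolding l_def using contour_integral_reversepath[of "linepath (Complex (- R N) (-c)) (Complex (- R N) c)" g] by simp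
    also have "\<dots> \<le> \<epsilon> N * norm (Complex (- R N) c - Complex (- R N) (-c))"
    proof (rule contour_integral_bound_linepath[OF ctb \<epsilon>0])
      fix s assume "s \<in> closed_segment (Complex (- R N) (-c)) (Complex (- R N) c)"
      then show "norm (g s) \<le> \<epsilon> N" using sg bd' by metis
    qed (use Rp in auto)
    finally show "norm (l N) \<le> \<epsilon> N * (2 * c)" by (simp only: n2c)
  qed
  have \<epsilon>': "(\<lambda>N. \<epsilon> N * (2 * c)) \<longlonglongrightarrow> 0" using tendsto_mult_right[OF decay(1), of "2 * c"] by simp
  have rl: "r \<longlonglongrightarrow> 0" "l \<longlonglongrightarrow> 0"
    by (rule Lim_null_comparison[OF always_eventually \<epsilon>'], use side in blast)+
  have b: "b \<longlonglongrightarrow> (LINT x|lborel. g (Complex x (-c)))"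
    unfolding b_def
  proof (rule integral_symmetric_LIMSEQ)
    show "integrable lborel (\<lambda>x. g (Complex x (-c)))" using int by (simp add: g_def)
    show "filterlim R at_top sequentially" unfolding R_def by real_asymp
  qed
  have "(\<lambda>N. (2 * b N + r N + l N) / (2 * \<i>)) \<longlonglongrightarrow> (2 * (LINT x|lborel. g (Complex x (-c))) + 0 + 0) / (2 * \<i>)"
    by (intro tendsto_intros b rl) simp
  moreover have "(2 * b N + r N + l N) / (2 * \<i>) = (\<Sum>n=-int N..int N. (-1) powi n * F (of_int n))" for N
    unfolding sum_eq[symmetric] by simp
  moreover have "(2 * (LINT x|lborel. g (Complex x (-c))) + 0 + 0) / (2 * \<i>) = - \<i> * (LINT x|lborel. g (Complex x (-c)))"
    by (simp add: field_simps)
  ultimately show ?thesis by (simp add: g_def)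
qed

section \<open>Gaussian integrals\<close>

text \<open>Read off from the normal density of variance \<open>1 / (2 * w)\<close>. The case
  \<open>k = 0\<close> serves the exponentially small corrections, \<open>k = 1\<close> the
  second-order Taylor remainder.\<close>

lemma gaussian_moment:
  assumes w: "w > (0::real)"
  shows "has_bochner_integral lborel (\<lambda>x. exp (- (w * x\<^sup>2)) * x ^ (2 * k))
     (sqrt (pi / w) * (fact (2 * k) / ((4 * w) ^ k * fact k)))"
proof -
  define \<sigma> where "\<sigma> = sqrt (1 / (2 * w))"
  have \<sigma>: "\<sigma> > 0" "\<sigma>\<^sup>2 = 1 / (2 * w)" using w by (simp_all add: \<sigma>_def)
  have "has_bochner_integral lborel (\<lambda>x. sqrt (pi / w) * (normal_density 0 \<sigma> x * (x - 0) ^ (2 * k)))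
     (sqrt (pi / w) * (fact (2 * k) / ((2 / \<sigma>\<^sup>2) ^ k * fact k)))"
    by (intro has_bochner_integral_mult_right normal_moment_even \<sigma>)
  moreover have "sqrt (pi / w) * (normal_density 0 \<sigma> x * (x - 0) ^ (2 * k)) = exp (- (w * x\<^sup>2)) * x ^ (2 * k)" for x
    using w by (simp add: normal_density_def \<sigma> real_sqrt_divide field_simps)
  moreover have "2 / \<sigma>\<^sup>2 = 4 * w" using w by (simp add: \<sigma>)
  ultimately show ?thesis by (simp only:)
qed

lemma norm_exp_gaussian: "norm (exp (- (w * of_real x ^ 2) :: complex)) = exp (- (Re w * x\<^sup>2))"
proof -
  have "Re (- (w * of_real x ^ 2)) = - (Re w * x\<^sup>2)"
    by (simp flip: of_real_power)
  then show ?thesis by (simp only: norm_exp_eq_Re)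
qed

lemma continuous_borel_measurable_lborel:
  fixes f :: "real \<Rightarrow> complex"
  assumes "continuous_on UNIV f"
  shows "f \<in> borel_measurable lborel"
  using borel_measurable_continuous_onI[OF assms] by simp

lemma complex_gaussian_integrable:
  assumes w: "Re w > 0"
  shows "integrable lborel (\<lambda>x. exp (- (w * of_real x ^ 2)) :: complex)"
proof (rule Bochner_Integration.integrable_bound)
  show "integrable lborel (\<lambda>x. exp (- (Re w * x\<^sup>2)))"
    using gaussian_moment[OF w, of 0] by (auto simp: has_bochner_integral_iff)
  show "(\<lambda>x. exp (- (w * of_real x ^ 2)) :: complex) \<in> borel_measurable lborel"
    by (intro continuous_borel_measurable_lborel continuous_intros)
qed (simp add: norm_exp_gaussian)

text \<open>Up to the factor \<open>csqrt w\<close>, this integral and the real Gaussian one are increments of one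
  primitive of \<open>exp (- u\<^sup>2)\<close>; the endpoints \<open>N * csqrt w\<close> and \<open>N * Re (csqrt w)\<close> are joined by a
  segment on which \<open>exp (- u\<^sup>2)\<close> is small.\<close>

lemma complex_gaussian_integral:
  assumes w: "Re w > 0"
  shows "(LINT x|lborel. exp (- (w * of_real x ^ 2))) = of_real (sqrt pi) / csqrt w"
proof -
  define r where "r = csqrt w"
  have r2: "r\<^sup>2 = w" by (simp add: r_def)
  have Rew: "Re w = (Re r)\<^sup>2 - (Im r)\<^sup>2" unfolding r2[symmetric] by (simp add: power2_eq_square)
  have r: "Re r > 0"
  proof (rule ccontr)
    assume "\<not> Re r > 0"
    then have "Re r = 0" using csqrt_principal[of w] unfolding r_def by auto
    then show False using Rew w by (simp add: not_less)
  qed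
  then have r0: "r \<noteq> 0" by auto
  define f where "f u = exp (- (u ^ 2))" for u :: complex
  obtain G where G: "\<And>u. (G has_field_derivative f u) (at u)"
  proof -
    have "f holomorphic_on UNIV" unfolding f_def[abs_def] by (intro holomorphic_intros)
    then show ?thesis using holomorphic_convex_primitive'[of UNIV f] that by auto
  qed
  have ftc: "integral {- R..R} (\<lambda>x. exp (- (a\<^sup>2 * of_real x ^ 2))) = (G (of_real R * a) - G (of_real (- R) * a)) / a"
    if a: "a \<noteq> 0" and R: "R > 0" for a :: complex and R :: real
  proof -
    have "((\<lambda>x. exp (- (a\<^sup>2 * of_real x ^ 2))) has_integral (G (of_real R * a) / a - G (of_real (- R) * a) / a)) {- R..R}"
    proof (rule fundamental_theorem_of_calculus)
      fix x assume "x \<in> {- R..R}"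
      have "((\<lambda>u. G (u * a) / a) has_field_derivative f (of_real x * a) * a / a) (at (of_real x))"
        by (intro DERIV_cdivide DERIV_chain'[where f = "\<lambda>u. u * a", OF _ G]) (auto intro!: derivative_eq_intros)
      then have "((\<lambda>u. G (u * a) / a) has_field_derivative exp (- (a\<^sup>2 * of_real x ^ 2))) (at (of_real x))"
        using a by (simp add: f_def power_mult_distrib mult.commute)
      then have "((\<lambda>x. G (of_real x * a) / a) has_vector_derivative exp (- (a\<^sup>2 * of_real x ^ 2))) (at x)"
        by (rule has_vector_derivative_real_field)
      then show "((\<lambda>x. G (of_real x * a) / a) has_vector_derivative exp (- (a\<^sup>2 * of_real x ^ 2))) (at x within {- R..R})"
        by (rule has_vector_derivative_at_within)
    qed (use R in simp)
    then show ?thesis by (simp add: integral_unique diff_divide_distrib)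
  qed
  define I where "I = (LINT x|lborel. exp (- (w * of_real x ^ 2)))"
  define R where "R N = real (Suc N)" for N
  have Rlim: "filterlim R at_top sequentially" unfolding R_def by real_asymp
  have 1: "(\<lambda>N. (G (of_real (R N) * r) - G (of_real (- R N) * r)) / r) \<longlonglongrightarrow> I"
    using integral_symmetric_LIMSEQ[OF complex_gaussian_integrable[OF w] Rlim]
    unfolding I_def r2[symmetric] by (subst (asm) ftc[OF r0]) (simp_all add: R_def)
  have 2: "(\<lambda>N. (G (of_real (R N * Re r)) - G (of_real (- (R N * Re r))))) \<longlonglongrightarrow> of_real (sqrt pi)"
  proof -
    have "filterlim (\<lambda>N. R N * Re r) at_top sequentially"
      using r Rlim by (intro filterlim_at_top_mult_tendsto_pos[OF tendsto_const _ Rlim]) auto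
    from integral_symmetric_LIMSEQ[OF complex_gaussian_integrable[of 1] this]
    have "(\<lambda>N. integral {- (R N * Re r)..R N * Re r} (\<lambda>x. exp (- (1\<^sup>2 * complex_of_real x ^ 2))))
       \<longlonglongrightarrow> (LINT x|lborel. exp (- (1 * of_real x ^ 2)))" by simp
    moreover have "(LINT x|lborel. exp (- (1 * of_real x ^ 2)) :: complex) = of_real (sqrt pi)"
    proof -
      have "(LINT x|lborel. exp (- (1 * of_real x ^ 2)) :: complex) = (LINT x|lborel. complex_of_real (exp (- (1 * x\<^sup>2))))"
        by (simp add: exp_of_real[symmetric])
      also have "\<dots> = of_real (LINT x|lborel. exp (- (1 * x\<^sup>2)))" by (rule integral_complex_of_real)
      also have "(LINT x|lborel. exp (- (1 * x\<^sup>2)) :: real) = sqrt pi"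
        using gaussian_moment[of 1 0] by (simp add: has_bochner_integral_iff)
      finally show ?thesis .
    qed
    ultimately show ?thesis using r by (subst (asm) ftc) (simp_all add: R_def)
  qed
  \<comment> \<open>On the segment the real part of \<open>u\<close> stays \<open>t * Re r\<close>
    while the imaginary part shrinks in modulus, so
    \<open>Re (u^2) \<ge> Re w * t^2\<close>.\<close>
  have seg: "norm (G (of_real t * r) - G (of_real (t * Re r))) \<le> exp (- (Re w * t\<^sup>2)) * (\<bar>t\<bar> * \<bar>Im r\<bar>)" for t
  proof -
    have "norm (G (of_real t * r) - G (of_real (t * Re r))) \<le> exp (- (Re w * t\<^sup>2)) * norm (of_real t * r - of_real (t * Re r))"
    proof (rule field_differentiable_bound[of "closed_segment (of_real t * r) (of_real (t * Re r))" G f])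
      show "(G has_field_derivative f u) (at u within A)" for u A by (rule has_field_derivative_at_within[OF G])
      fix u assume "u \<in> closed_segment (of_real t * r) (of_real (t * Re r))"
      then obtain s where s: "0 \<le> s" "s \<le> 1" "u = (1 - s) *\<^sub>R (of_real t * r) + s *\<^sub>R of_real (t * Re r)"
        by (auto simp: closed_segment_def)
      have "Re u = t * Re r" "Im u = (1 - s) * (t * Im r)" unfolding s(3) by (simp_all add: algebra_simps)
      moreover have "Re (u ^ 2) = (Re u)\<^sup>2 - (Im u)\<^sup>2" by (simp add: power2_eq_square)
      ultimately have "Re (u ^ 2) = t\<^sup>2 * (Re r)\<^sup>2 - (1 - s)\<^sup>2 * (t\<^sup>2 * (Im r)\<^sup>2)"
        by (simp only: power_mult_distrib)
      also have "\<dots> \<ge> t\<^sup>2 * (Re r)\<^sup>2 - 1 * (t\<^sup>2 * (Im r)\<^sup>2)"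
        using s by (intro diff_left_mono mult_right_mono power_le_one) auto
      finally have "Re w * t\<^sup>2 \<le> Re (u ^ 2)" by (simp add: Rew algebra_simps)
      then show "norm (f u) \<le> exp (- (Re w * t\<^sup>2))" by (simp add: f_def)
    qed auto
    also have "of_real t * r - of_real (t * Re r) = of_real (t * Im r) * \<i>"
      by (simp add: complex_eq_iff)
    finally show ?thesis by (simp add: norm_mult abs_mult)
  qed
  have "(\<lambda>N. exp (- (Re w * (R N)\<^sup>2)) * (R N * \<bar>Im r\<bar>)) \<longlonglongrightarrow> 0"
    unfolding R_def using w by real_asymp
  then have lim0: "(\<lambda>N. exp (- (Re w * (R N)\<^sup>2)) * (R N * \<bar>Im r\<bar>)) \<longlonglongrightarrow> 0" .
  have 3: "(\<lambda>N. G (of_real (R N) * r) - G (of_real (R N * Re r))) \<longlonglongrightarrow> 0"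
  proof (rule Lim_null_comparison[OF always_eventually lim0], rule allI)
    show "norm (G (of_real (R N) * r) - G (of_real (R N * Re r))) \<le> exp (- (Re w * (R N)\<^sup>2)) * (R N * \<bar>Im r\<bar>)" for N
      using seg[of "R N"] by (simp add: R_def)
  qed
  have 4: "(\<lambda>N. G (of_real (- R N) * r) - G (of_real (- (R N * Re r)))) \<longlonglongrightarrow> 0"
  proof (rule Lim_null_comparison[OF always_eventually lim0], rule allI)
    fix N
    have "R N > 0" by (simp add: R_def)
    then have "\<bar>- R N\<bar> = R N" "(- R N)\<^sup>2 = (R N)\<^sup>2" "- R N * Re r = - (R N * Re r)" by simp_all
    then show "norm (G (of_real (- R N) * r) - G (of_real (- (R N * Re r)))) \<le> exp (- (Re w * (R N)\<^sup>2)) * (R N * \<bar>Im r\<bar>)"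
      using seg[of "- R N"] by (simp only:)
  qed
  have "(\<lambda>N. ((G (of_real (R N) * r) - G (of_real (R N * Re r))) - (G (of_real (- R N) * r) - G (of_real (- (R N * Re r))))
      + (G (of_real (R N * Re r)) - G (of_real (- (R N * Re r))))) / r) \<longlonglongrightarrow> ((0 - 0) + of_real (sqrt pi)) / r"
    by (intro tendsto_intros 2 3 4 r0)
  then have "(\<lambda>N. (G (of_real (R N) * r) - G (of_real (- R N) * r)) / r) \<longlonglongrightarrow> of_real (sqrt pi) / r" by simp
  with 1 have "I = of_real (sqrt pi) / r" by (rule LIMSEQ_unique)
  then show ?thesis by (simp add: I_def r_def)
qed

text \<open>Below the real axis
  \<open>1 / sin (pi*s) = 2*i * exp (-i*pi*s) / (1 - exp (-2*pi*i*s))\<close>. The point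
  \<open>s0\<close> is the saddle of \<open>exp (-a*z*s^2 - i*pi*s)\<close>; completing the square
  there extracts the value \<open>exp (- pi^2 / (4*a*z))\<close> and leaves a centred Gaussian on
  the horizontal line through \<open>s0\<close>.\<close>

lemma gaussian_alternating_sum:
  fixes z :: complex and a B :: real and h :: "complex \<Rightarrow> complex"
  defines "c \<equiv> pi * Re z / (2 * a * (norm z)\<^sup>2)" and "s0 \<equiv> - \<i> * of_real pi / (2 * of_real a * z)"
  assumes z: "Re z > 0" and a: "a > 0"
    and holo: "h holomorphic_on {s. \<bar>Im s\<bar> < 2 * c}"
    and even: "\<And>s. h (- s) = h s" and nz: "\<And>n::int. h (of_int n) \<noteq> 0"
    and bound: "\<And>s. \<bar>Im s\<bar> \<le> c \<Longrightarrow> norm (h s) \<le> B"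
  shows "(\<lambda>N. \<Sum>n=-int N..int N. (-1) powi n * (exp (- (of_real a * z * of_int n ^ 2)) * h (of_int n)))
     \<longlonglongrightarrow> 2 * exp (- (of_real pi ^ 2 / (4 * of_real a * z))) *
       (LINT x|lborel. exp (- (of_real a * z * of_real x ^ 2)) * h (s0 + of_real x)
          / (1 - exp (- (2 * of_real pi * \<i> * (s0 + of_real x)))))"
    and "integrable lborel (\<lambda>x. exp (- (of_real a * z * of_real x ^ 2)) * h (s0 + of_real x)
          / (1 - exp (- (2 * of_real pi * \<i> * (s0 + of_real x)))))"
    and "Im s0 = - c" and "c > 0"
proof -
  have nz': "norm z > 0" "z \<noteq> 0" using z by auto
  show c: "c > 0" using z a nz' by (simp add: c_def)
  show s0: "Im s0 = - c"
  proof -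
    have "s0 = - \<i> * of_real (pi / (2 * a)) * inverse z" by (simp add: s0_def field_simps)
    then have "Im s0 = - (pi / (2 * a)) * Re (inverse z)" by simp
    also have "Re (inverse z) = Re z / (norm z)\<^sup>2" by (simp add: cmod_power2)
    finally show ?thesis by (simp add: c_def)
  qed
  define k where "k x = exp (- (of_real a * z * of_real x ^ 2)) * h (s0 + of_real x)
          / (1 - exp (- (2 * of_real pi * \<i> * (s0 + of_real x))))" for x :: real
  define F where "F s = exp (- (of_real a * z * s ^ 2)) * h s" for s
  define K where "K = 2 * \<i> * exp (- (of_real pi ^ 2 / (4 * of_real a * z)))"
  define E where "E = exp (- (2 * pi * c))"
  have E: "E < 1" using c by (simp add: E_def)
  have nE: "norm (exp (- (2 * of_real pi * \<i> * (s0 + of_real x)))) = E" for x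
    by (simp add: E_def s0)
  have den: "norm (1 - exp (- (2 * of_real pi * \<i> * (s0 + of_real x)))) \<ge> 1 - E" for x
    using norm_triangle_ineq2[of 1 "exp (- (2 * of_real pi * \<i> * (s0 + of_real x)))"] nE[of x] by simp
  have den0: "1 - exp (- (2 * of_real pi * \<i> * (s0 + of_real x))) \<noteq> 0" for x
    using den[of x] E by auto
  have hb: "norm (h (s0 + of_real x)) \<le> B" for x using bound[of "s0 + of_real x"] s0 c by simp
  have B0: "B \<ge> 0" using order_trans[OF norm_ge_zero hb] by blast
  have az: "Re (of_real a * z) > 0" using a z by simp
  show k_int: "integrable lborel k" unfolding k_def
  proof (rule Bochner_Integration.integrable_bound)
    show "integrable lborel (\<lambda>x. (B / (1 - E)) * norm (exp (- (of_real a * z * of_real x ^ 2))))"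
      using complex_gaussian_integrable[OF az] by (intro integrable_mult_right integrable_norm) auto
    have "continuous_on UNIV (\<lambda>x. h (s0 + of_real x))"
      by (rule continuous_on_compose2[OF holomorphic_on_imp_continuous_on[OF holo]])
         (use s0 c in \<open>auto intro!: continuous_intros\<close>)
    then show "(\<lambda>x. exp (- (of_real a * z * of_real x ^ 2)) * h (s0 + of_real x)
          / (1 - exp (- (2 * of_real pi * \<i> * (s0 + of_real x))))) \<in> borel_measurable lborel"
      using den0 by (intro continuous_borel_measurable_lborel continuous_intros) auto
    show "AE x in lborel. norm (exp (- (of_real a * z * of_real x ^ 2)) * h (s0 + of_real x)
          / (1 - exp (- (2 * of_real pi * \<i> * (s0 + of_real x)))))
        \<le> norm ((B / (1 - E)) * norm (exp (- (of_real a * z * of_real x ^ 2))))"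
    proof (rule AE_I2)
      fix x :: real
      have "norm (h (s0 + of_real x)) / norm (1 - exp (- (2 * of_real pi * \<i> * (s0 + of_real x)))) \<le> B / (1 - E)"
        using E B0 by (intro frac_le hb den) auto
      from mult_right_mono[OF this norm_ge_zero[of "exp (- (of_real a * z * of_real x ^ 2))"]]
      show "norm (exp (- (of_real a * z * of_real x ^ 2)) * h (s0 + of_real x)
          / (1 - exp (- (2 * of_real pi * \<i> * (s0 + of_real x)))))
        \<le> norm ((B / (1 - E)) * norm (exp (- (of_real a * z * of_real x ^ 2))))"
        using E B0 by (simp add: norm_mult norm_divide abs_mult mult_ac)
    qed
  qed
  have line: "F (Complex x (-c)) / sin (of_real pi * Complex x (-c)) = K * k (x - Re s0)" for x
  proof -
    define \<rho> where "\<rho> = complex_of_real (x - Re s0)"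
    have s: "Complex x (-c) = s0 + \<rho>" by (simp add: complex_eq_iff \<rho>_def s0)
    have e1: "- (of_real a * z * (s0 + \<rho>) ^ 2) = - (of_real a * z * \<rho> ^ 2) + (\<i> * of_real pi * (s0 + \<rho>))
        - of_real pi ^ 2 / (4 * of_real a * z)"
    proof -
      have p: "2 * of_real a * z * s0 = - \<i> * of_real pi" using a nz' by (simp add: s0_def)
      have "of_real a * z * (s0 + \<rho>) ^ 2 = of_real a * z * \<rho> ^ 2 + (2 * of_real a * z * s0) * (\<rho> + s0 / 2)"
        by (simp add: power2_eq_square algebra_simps)
      also have "\<dots> = of_real a * z * \<rho> ^ 2 - \<i> * of_real pi * (s0 + \<rho>) + \<i> * of_real pi * s0 / 2"
        unfolding p by (simp add: algebra_simps)
      also have "\<i> * of_real pi * s0 / 2 = of_real pi ^ 2 / (4 * of_real a * z)"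
      proof -
        have "\<i> * X * (\<i> * X) = - (X * X)" for X by (simp add: algebra_simps)
        then show ?thesis unfolding s0_def by (simp add: power2_eq_square mult.assoc)
      qed
      finally show ?thesis by simp
    qed
    define X where "X = exp (\<i> * of_real pi * (s0 + \<rho>))"
    have X0: "X \<noteq> 0" by (simp add: X_def)
    have Xi: "exp (- (2 * of_real pi * \<i> * (s0 + \<rho>))) = inverse X ^ 2"
      by (simp add: X_def exp_minus[symmetric] exp_of_nat_mult[symmetric] algebra_simps)
    have d0: "1 - inverse X ^ 2 \<noteq> 0" using den0[of "x - Re s0"] unfolding Xi[symmetric] \<rho>_def .
    have sn: "sin (of_real pi * (s0 + \<rho>)) = X * (1 - inverse X ^ 2) / (2 * \<i>)"
      using X0 by (simp add: sin_exp_eq X_def exp_minus mult_ac power2_eq_square right_diff_distrib)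
    have "exp (- (of_real a * z * (s0 + \<rho>) ^ 2)) = exp (- (of_real a * z * \<rho> ^ 2)) * X * exp (- (of_real pi ^ 2 / (4 * of_real a * z)))"
      by (simp only: e1 X_def exp_diff exp_add exp_minus divide_inverse)
    moreover have "e * X * k * h' / (X * D / (2 * \<i>)) = 2 * \<i> * k * (e * h' / D)" for e k h' D
      using X0 by (cases "D = 0") (simp_all add: field_simps)
    ultimately show ?thesis
      unfolding s F_def k_def K_def sn \<rho>_def[symmetric] Xi by (simp only:)
  qed
  have unit: "- \<i> * (2 * \<i> * e * L) = 2 * e * L" for e L :: complex by (simp add: algebra_simps)
  \<comment> \<open>Majorant of \<open>F\<close> on the vertical sides: at \<open>x + i*t\<close>
    the exponent has real part \<open>- a * Re z * (x^2 - t^2) + 2 * a * Im z * x * t\<close>, and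
    for \<open>abs t \<le> c\<close> the quadratic term in \<open>x = N + 1/2\<close>
    dominates.\<close>
  define \<epsilon> where "\<epsilon> N = exp (- (a * Re z * (real N + 1/2)\<^sup>2) + 2 * a * \<bar>Im z\<bar> * c * (real N + 1/2) + a * Re z * c\<^sup>2) * B" for N
  have "(\<lambda>N. \<Sum>n=-int N..int N. (-1) powi n * F (of_int n))
     \<longlonglongrightarrow> - \<i> * (LINT x|lborel. F (Complex x (-c)) / sin (of_real pi * Complex x (-c)))"
  proof (rule alternating_sum_contour[of c "2 * c" F \<epsilon>])
    show "F holomorphic_on {s. \<bar>Im s\<bar> < 2 * c}" unfolding F_def by (intro holomorphic_intros holo)
    show "F (- s) = F s" for s by (simp add: F_def even)
    show "F (of_int n) \<noteq> 0" for n by (simp add: F_def nz)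
    have "integrable lborel (\<lambda>x. K * k (- Re s0 + 1 * x))"
      by (intro integrable_mult_right lborel_integrable_real_affine k_int) simp
    then show "integrable lborel (\<lambda>x. F (Complex x (-c)) / sin (of_real pi * Complex x (-c)))"
      unfolding line by simp
    define u v where "u = a * Re z" and "v = 2 * a * \<bar>Im z\<bar> * c"
    have "u > 0" using a z by (simp add: u_def)
    then have "(\<lambda>N. exp (- (u * (real N + 1/2)\<^sup>2) + v * (real N + 1/2) + a * Re z * c\<^sup>2) * B) \<longlonglongrightarrow> 0"
      by real_asymp
    then show "\<epsilon> \<longlonglongrightarrow> 0" unfolding \<epsilon>_def u_def v_def .
    fix N and t :: real assume t: "\<bar>t\<bar> \<le> c"
    define x where "x = real N + 1/2"
    have x: "x \<ge> 0" by (simp add: x_def)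
    have tt: "t\<^sup>2 \<le> c\<^sup>2" using t abs_le_square_iff[of t c] by simp
    have "Im z * t \<le> \<bar>Im z\<bar> * c" 
    proof -
      have "Im z * t \<le> \<bar>Im z\<bar> * \<bar>t\<bar>" by (metis abs_ge_self abs_mult)
      also have "\<dots> \<le> \<bar>Im z\<bar> * c" using t by (intro mult_left_mono) auto
      finally show ?thesis .
    qed
    from mult_left_mono[OF this, of "2 * a * x"]
    have "2 * a * x * (Im z * t) \<le> 2 * a * x * (\<bar>Im z\<bar> * c)" using a x by simp
    moreover have "a * Re z * t\<^sup>2 \<le> a * Re z * c\<^sup>2" using a z tt by (intro mult_left_mono) auto
    moreover have "Re (- (of_real a * z * Complex x t ^ 2)) = - (a * Re z * x\<^sup>2) + 2 * a * x * (Im z * t) + a * Re z * t\<^sup>2"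
      by (simp add: power2_eq_square algebra_simps)
    ultimately have "Re (- (of_real a * z * Complex x t ^ 2)) \<le> - (a * Re z * x\<^sup>2) + 2 * a * \<bar>Im z\<bar> * c * x + a * Re z * c\<^sup>2"
      by (simp add: mult_ac)
    then show "norm (F (Complex (real N + 1/2) t)) \<le> \<epsilon> N"
      unfolding F_def \<epsilon>_def norm_mult norm_exp_eq_Re x_def[symmetric] using t
      by (intro mult_mono bound) auto
  qed (use c in auto)
  also have "(LINT x|lborel. F (Complex x (-c)) / sin (of_real pi * Complex x (-c))) = K * (LINT x|lborel. k x)"
    unfolding line using lborel_integral_real_affine[of 1 k "- Re s0"] by simp
  also have "- \<i> * (K * (LINT x|lborel. k x)) = 2 * exp (- (of_real pi ^ 2 / (4 * of_real a * z))) * (LINT x|lborel. k x)"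
    unfolding K_def by (rule unit)
  finally show "(\<lambda>N. \<Sum>n=-int N..int N. (-1) powi n * (exp (- (of_real a * z * of_int n ^ 2)) * h (of_int n)))
     \<longlonglongrightarrow> 2 * exp (- (of_real pi ^ 2 / (4 * of_real a * z))) *
       (LINT x|lborel. exp (- (of_real a * z * of_real x ^ 2)) * h (s0 + of_real x)
          / (1 - exp (- (2 * of_real pi * \<i> * (s0 + of_real x)))))"
    unfolding F_def k_def .
qed

section \<open>Bounds for \<open>1 / cosh\<close> in a widened sector\<close>

lemma norm_cosh_squared:
  "norm (cosh v) ^ 2 = cos (Im v) ^ 2 + ((exp (Re v) - inverse (exp (Re v))) / 2) ^ 2"
  unfolding cosh_conv_cos norm_cos_squared by (simp add: power_divide)

text \<open>One of the squares \<open>cos (Im v) ^ 2\<close> and \<open>sinh (Re v) ^ 2\<close> is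
  always large: if \<open>M * abs (Re v) \<le> pi/6\<close>, the angle is at most
  \<open>pi/3\<close> and the cosine at least 1/2; otherwise
  \<open>abs (sinh (Re v)) \<ge> abs (Re v) > pi / (6*M)\<close>.\<close>

lemma norm_cosh_ge:
  assumes M: "M > 0" and v: "\<bar>Im v\<bar> \<le> pi / 6 + M * \<bar>Re v\<bar>"
  shows "min (1 / 2) (pi / (6 * M)) \<le> norm (cosh v)"
proof -
  have "(min (1 / 2) (pi / (6 * M)))\<^sup>2 \<le> norm (cosh v) ^ 2"
  proof (cases "\<bar>Re v\<bar> \<le> pi / (6 * M)")
    case True
    then have "M * \<bar>Re v\<bar> \<le> pi / 6" using M by (simp add: field_simps)
    with v have "\<bar>Im v\<bar> \<le> pi / 3" by simp
    then have "cos (pi / 3) \<le> cos \<bar>Im v\<bar>" by (intro cos_monotone_0_pi_le) auto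
    then have "1 / 2 \<le> cos (Im v)" by (simp add: cos_60)
    moreover have "min (1 / 2) (pi / (6 * M)) \<le> 1 / 2" "0 \<le> min (1 / 2) (pi / (6 * M))"
      using M by auto
    ultimately have "(min (1 / 2) (pi / (6 * M)))\<^sup>2 \<le> cos (Im v) ^ 2"
      by (intro power_mono) auto
    then show ?thesis unfolding norm_cosh_squared by (smt (verit) zero_le_power2)
  next
    case False
    then have "min (1 / 2) (pi / (6 * M)) \<le> \<bar>Re v\<bar>" by auto
    also have "\<dots> \<le> \<bar>(exp (Re v) - inverse (exp (Re v))) / 2\<bar>" by (rule real_le_abs_sinh)
    finally have "(min (1 / 2) (pi / (6 * M)))\<^sup>2 \<le> \<bar>(exp (Re v) - inverse (exp (Re v))) / 2\<bar>\<^sup>2"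
      using M by (intro power_mono) auto
    then show ?thesis unfolding norm_cosh_squared power2_abs by (rule add_increasing[OF zero_le_power2])
  qed
  then show ?thesis by (rule power2_le_imp_le) simp
qed

text \<open>The zeros of \<open>cosh\<close> are the odd multiples of \<open>i*pi/2\<close>, and the
  region meets the imaginary axis only strictly between \<open>-i*pi/2\<close> and
  \<open>i*pi/2\<close>.\<close>

lemma cosh_nonzero:
  assumes v: "\<bar>Im v\<bar> < pi / 2 + M * \<bar>Re v\<bar>"
  shows "cosh v \<noteq> 0"
proof
  assume "cosh v = 0"
  then have "cos (Im v) ^ 2 + ((exp (Re v) - inverse (exp (Re v))) / 2) ^ 2 = 0"
    using norm_cosh_squared[of v] by simp
  then have *: "cos (Im v) = 0" "(exp (Re v) - inverse (exp (Re v))) / 2 = 0"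
    by (simp_all only: sum_power2_eq_zero_iff)
  then have "Re v = 0" using real_le_abs_sinh[of "Re v"] by simp
  then have "cos \<bar>Im v\<bar> > 0" using v by (intro cos_gt_zero_pi) auto
  then show False using * by simp
qed

text \<open>Base point and increment are confined so that the whole segment between
  \<open>\<beta>\<close> and \<open>\<beta> + u\<close> lies where
  \<open>norm (cosh v) \<ge> m\<close>. The second derivative of \<open>1 / cosh\<close> is
  \<open>1 / cosh - 2 / cosh^3\<close>, whence the constant.\<close>

lemma taylor_inverse_cosh:
  assumes M: "M > 0" and m: "m = min (1 / 2) (pi / (6 * M))"
    and \<beta>: "\<bar>Im \<beta>\<bar> \<le> pi / 6" "Re \<beta> = 0" and u: "\<bar>Im u\<bar> \<le> M * \<bar>Re u\<bar>"
  shows "norm (1 / cosh (\<beta> + u) - 1 / cosh \<beta> + sinh \<beta> / cosh \<beta> ^ 2 * u) \<le> (1 / m + 2 / m ^ 3) * norm u ^ 2"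
proof -
  define f :: "nat \<Rightarrow> complex \<Rightarrow> complex" where
    "f i v = (if i = 0 then 1 / cosh v else if i = 1 then - sinh v / cosh v ^ 2 else 1 / cosh v - 2 / cosh v ^ 3)" for i v
  have m0: "m > 0" using M by (simp add: m)
  have lower: "m \<le> norm (cosh v)" if seg: "v \<in> closed_segment \<beta> (\<beta> + u)" for v
  proof -
    obtain t where t: "0 \<le> t" "t \<le> 1" "v = (1 - t) *\<^sub>R \<beta> + t *\<^sub>R (\<beta> + u)"
      using seg by (auto simp: closed_segment_def)
    have v: "Re v = t * Re u" "Im v = Im \<beta> + t * Im u" unfolding t(3) by (simp_all add: \<beta> algebra_simps)
    have "\<bar>Im v\<bar> \<le> \<bar>Im \<beta>\<bar> + t * \<bar>Im u\<bar>"
      unfolding v using t(1) abs_triangle_ineq[of "Im \<beta>" "t * Im u"] by (simp add: abs_mult)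
    also have "\<dots> \<le> pi / 6 + t * (M * \<bar>Re u\<bar>)"
      using \<beta> u t(1) by (intro add_mono mult_left_mono)
    also have "\<dots> = pi / 6 + M * \<bar>Re v\<bar>" unfolding v using t(1) by (simp add: abs_mult)
    finally show ?thesis unfolding m by (rule norm_cosh_ge[OF M])
  qed
  have nz: "cosh v \<noteq> 0" if "v \<in> closed_segment \<beta> (\<beta> + u)" for v
    using lower[OF that] m0 by auto
  have "norm (f 0 (\<beta> + u) - (\<Sum>i\<le>1. f i \<beta> * ((\<beta> + u) - \<beta>) ^ i / (fact i)))
     \<le> (1 / m + 2 / m ^ 3) * norm ((\<beta> + u) - \<beta>) ^ (Suc 1) / fact 1"
  proof (rule complex_Taylor[of "closed_segment \<beta> (\<beta> + u)"])
    fix i :: nat and v assume v: "v \<in> closed_segment \<beta> (\<beta> + u)" and i: "i \<le> 1"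
    have "i = 0 \<or> i = 1" using i by auto
    then show "(f i has_field_derivative f (Suc i) v) (at v within closed_segment \<beta> (\<beta> + u))"
    proof
      assume "i = 0"
      then show ?thesis unfolding f_def[abs_def] using nz[OF v]
        by (auto intro!: derivative_eq_intros simp: power2_eq_square)
    next
      assume i: "i = 1"
      have "((\<lambda>v. - sinh v / cosh v ^ 2) has_field_derivative
          (- cosh v * cosh v ^ 2 - (- sinh v) * (2 * cosh v * sinh v)) / (cosh v ^ 2 * cosh v ^ 2))
          (at v within closed_segment \<beta> (\<beta> + u))"
        using nz[OF v] by (auto intro!: derivative_eq_intros simp: field_simps)
      also have "(- cosh v * cosh v ^ 2 - (- sinh v) * (2 * cosh v * sinh v)) / (cosh v ^ 2 * cosh v ^ 2)
         = (- cosh v * cosh v ^ 2 + 2 * cosh v * sinh v ^ 2) / (cosh v ^ 2 * cosh v ^ 2)"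
        by (simp add: power2_eq_square)
      also have "sinh v ^ 2 = cosh v ^ 2 - 1" by (simp add: cosh_square_eq)
      also have "(- cosh v * cosh v ^ 2 + 2 * cosh v * (cosh v ^ 2 - 1)) / (cosh v ^ 2 * cosh v ^ 2)
         = 1 / cosh v - 2 / cosh v ^ 3"
        using nz[OF v] by (simp add: field_simps power2_eq_square power3_eq_cube)
      finally show ?thesis unfolding f_def[abs_def] i by simp
    qed
  next
    fix v assume v: "v \<in> closed_segment \<beta> (\<beta> + u)"
    have "norm (1 / cosh v - 2 / cosh v ^ 3) \<le> norm (1 / cosh v) + norm (2 / cosh v ^ 3)"
      by (rule norm_triangle_ineq4)
    also have "\<dots> = 1 / norm (cosh v) + 2 / norm (cosh v) ^ 3" by (simp add: norm_divide norm_power)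
    also have "\<dots> \<le> 1 / m + 2 / m ^ 3"
      using lower[OF v] m0 by (intro add_mono divide_left_mono power_mono mult_pos_pos zero_less_power) auto
    finally show "norm (f (Suc 1) v) \<le> 1 / m + 2 / m ^ 3" by (simp add: f_def)
  qed auto
  then show ?thesis by (simp add: f_def power2_eq_square algebra_simps)
qed

section \<open>Gaussian integrals with error terms\<close>

lemma norm_integral_le_gaussian:
  fixes f :: "real \<Rightarrow> complex"
  assumes w: "w > 0" and f: "integrable lborel f" and b: "\<And>x. norm (f x) \<le> C * (exp (- (w * x\<^sup>2)) * x ^ (2 * k))"
  shows "norm (LINT x|lborel. f x) \<le> C * (sqrt (pi / w) * (fact (2 * k) / ((4 * w) ^ k * fact k)))"
proof -
  note g = gaussian_moment[OF w, of k, unfolded has_bochner_integral_iff]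
  have "norm (LINT x|lborel. f x) \<le> (LINT x|lborel. norm (f x))" by (rule integral_norm_bound)
  also have "\<dots> \<le> (LINT x|lborel. C * (exp (- (w * x\<^sup>2)) * x ^ (2 * k)))"
    using f g b by (intro integral_mono integrable_mult_right integrable_norm) auto
  also have "\<dots> = C * (sqrt (pi / w) * (fact (2 * k) / ((4 * w) ^ k * fact k)))"
    using g by simp
  finally show ?thesis .
qed

lemma complex_gaussian_bounded_integrable:
  fixes f :: "real \<Rightarrow> complex"
  assumes w: "Re w > 0" and f: "continuous_on UNIV f" and b: "\<And>x. norm (f x) \<le> C"
  shows "integrable lborel (\<lambda>x. exp (- (w * of_real x ^ 2)) * f x)"
proof (rule Bochner_Integration.integrable_bound)
  show "integrable lborel (\<lambda>x. C * exp (- (Re w * x\<^sup>2)))"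
    using gaussian_moment[OF w, of 0] by (intro integrable_mult_right) (auto simp: has_bochner_integral_iff)
  show "(\<lambda>x. exp (- (w * of_real x ^ 2)) * f x) \<in> borel_measurable lborel"
    by (intro continuous_borel_measurable_lborel continuous_intros f)
  have "0 \<le> C" using order_trans[OF norm_ge_zero b] .
  then show "AE x in lborel. norm (exp (- (w * of_real x ^ 2)) * f x) \<le> norm (C * exp (- (Re w * x\<^sup>2)))"
    using b by (auto simp: norm_mult norm_exp_gaussian mult.commute[of C] abs_mult intro!: mult_left_mono)
qed

text \<open>The integrand is odd. This removes the linear Taylor term at the saddle point, which
  would otherwise limit the relative error to order \<open>sqrt z\<close>.\<close>

lemma complex_gaussian_first_moment:
  assumes w: "Re w > 0"
  shows "integrable lborel (\<lambda>x. exp (- (w * of_real x ^ 2)) * of_real x :: complex)"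
    and "(LINT x|lborel. exp (- (w * of_real x ^ 2)) * of_real x) = (0 :: complex)"
proof -
  have g: "integrable lborel (\<lambda>x. exp (- (Re w * x\<^sup>2)))" "integrable lborel (\<lambda>x. exp (- (Re w * x\<^sup>2)) * x\<^sup>2)"
    using gaussian_moment[OF w, of 0] gaussian_moment[OF w, of 1] by (auto simp: has_bochner_integral_iff)
  show "integrable lborel (\<lambda>x. exp (- (w * of_real x ^ 2)) * of_real x :: complex)"
  proof (rule Bochner_Integration.integrable_bound)
    show "integrable lborel (\<lambda>x. exp (- (Re w * x\<^sup>2)) + exp (- (Re w * x\<^sup>2)) * x\<^sup>2)"
      by (intro Bochner_Integration.integrable_add g)
    show "(\<lambda>x. exp (- (w * of_real x ^ 2)) * of_real x :: complex) \<in> borel_measurable lborel"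
      by (intro continuous_borel_measurable_lborel continuous_intros)
    have "\<bar>x\<bar> \<le> 1 + x\<^sup>2" for x :: real
    proof -
      have "0 \<le> (\<bar>x\<bar> - 1)\<^sup>2 + \<bar>x\<bar>" by simp
      then show ?thesis by (simp add: power2_eq_square algebra_simps)
    qed
    from mult_left_mono[OF this, of "exp (- (Re w * x\<^sup>2))" for x]
    show "AE x in lborel. norm (exp (- (w * of_real x ^ 2)) * of_real x :: complex)
        \<le> norm (exp (- (Re w * x\<^sup>2)) + exp (- (Re w * x\<^sup>2)) * x\<^sup>2)"
      by (auto simp: norm_mult norm_exp_gaussian algebra_simps)
  qed
  have "(LINT x|lborel. exp (- (w * of_real x ^ 2)) * of_real x :: complex)
     = - (LINT x|lborel. exp (- (w * of_real x ^ 2)) * of_real x)"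
    using lborel_integral_real_affine[of "-1" "\<lambda>x. exp (- (w * of_real x ^ 2)) * of_real x :: complex" 0] by simp
  then show "(LINT x|lborel. exp (- (w * of_real x ^ 2)) * of_real x) = (0 :: complex)"
    by (simp add: eq_neg_iff_add_eq_0)
qed

text \<open>Drops the factor \<open>1 / (1 - exp (-2*pi*i*s))\<close>: on the line its exponential
  has the constant modulus \<open>exp (-2*pi*c)\<close>, and as this is at most 1/2 the integrand
  changes by at most twice that fraction.\<close>

lemma gaussian_alternating_sum_approx:
  fixes z :: complex and a B :: real and h :: "complex \<Rightarrow> complex"
  defines "c \<equiv> pi * Re z / (2 * a * (norm z)\<^sup>2)" and "s0 \<equiv> - \<i> * of_real pi / (2 * of_real a * z)"
  assumes z: "Re z > 0" and a: "a > 0"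
    and holo: "h holomorphic_on {s. \<bar>Im s\<bar> < 2 * c}"
    and even: "\<And>s. h (- s) = h s" and nz: "\<And>n::int. h (of_int n) \<noteq> 0"
    and bound: "\<And>s. \<bar>Im s\<bar> \<le> c \<Longrightarrow> norm (h s) \<le> B" and small: "exp (- (2 * pi * c)) \<le> 1 / 2"
  obtains J where
    "(\<lambda>N. \<Sum>n=-int N..int N. (-1) powi n * (exp (- (of_real a * z * of_int n ^ 2)) * h (of_int n)))
       \<longlonglongrightarrow> 2 * exp (- (of_real pi ^ 2 / (4 * of_real a * z))) * J"
    "norm (J - (LINT x|lborel. exp (- (of_real a * z * of_real x ^ 2)) * h (s0 + of_real x)))
       \<le> 2 * exp (- (2 * pi * c)) * B * sqrt (pi / (a * Re z))"
    "integrable lborel (\<lambda>x. exp (- (of_real a * z * of_real x ^ 2)) * h (s0 + of_real x))"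
proof -
  note * = gaussian_alternating_sum[of z a h B, folded c_def s0_def, OF z a holo even nz bound]
  have s0: "Im s0 = - c" "c > 0" by (rule *; assumption)+
  define E where "E = exp (- (2 * pi * c))"
  define e where "e x = exp (- (2 * of_real pi * \<i> * (s0 + of_real x)))" for x :: real
  define k where "k x = exp (- (of_real a * z * of_real x ^ 2)) * h (s0 + of_real x)" for x :: real
  have ne: "norm (e x) = E" for x by (simp add: E_def e_def s0)
  have E: "E \<le> 1 / 2" "0 \<le> E" using small by (simp_all add: E_def)
  have den: "1 / 2 \<le> norm (1 - e x)" for x
    using norm_triangle_ineq2[of 1 "e x"] ne[of x] E by simp
  have hb: "norm (h (s0 + of_real x)) \<le> B" for x using bound[of "s0 + of_real x"] s0 by simp
  have B0: "B \<ge> 0" using order_trans[OF norm_ge_zero hb] by blast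
  have az: "Re (of_real a * z) > 0" using a z by simp
  have hc: "continuous_on UNIV (\<lambda>x. h (s0 + of_real x))"
    by (rule continuous_on_compose2[OF holomorphic_on_imp_continuous_on[OF holo]])
       (use s0 in \<open>auto intro!: continuous_intros\<close>)
  have ik: "integrable lborel k" unfolding k_def
    by (rule complex_gaussian_bounded_integrable[OF az hc hb])
  have ik': "integrable lborel (\<lambda>x. k x / (1 - e x))" unfolding k_def e_def by (rule *; assumption)
  define J where "J = (LINT x|lborel. k x / (1 - e x))"
  have J: "(\<lambda>N. \<Sum>n=-int N..int N. (-1) powi n * (exp (- (of_real a * z * of_int n ^ 2)) * h (of_int n)))
       \<longlonglongrightarrow> 2 * exp (- (of_real pi ^ 2 / (4 * of_real a * z))) * J"
    unfolding J_def k_def e_def by (rule *; assumption)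
  have "J - (LINT x|lborel. k x) = (LINT x|lborel. k x / (1 - e x) - k x)"
    unfolding J_def by (intro Bochner_Integration.integral_diff[symmetric] ik ik')
  also have "norm \<dots> \<le> (2 * E * B) * (sqrt (pi / (a * Re z)) * (fact (2 * 0) / ((4 * (a * Re z)) ^ 0 * fact 0)))"
  proof (rule norm_integral_le_gaussian)
    fix x :: real
    have d: "1 - e x \<noteq> 0" using den[of x] by auto
    have "k x / (1 - e x) - k x = k x * (e x / (1 - e x))" using d by (simp add: field_simps)
    also have "norm \<dots> = exp (- (a * Re z * x\<^sup>2)) * (norm (h (s0 + of_real x)) * (E / norm (1 - e x)))"
      by (simp add: k_def norm_mult norm_divide norm_exp_gaussian ne)
    also have "\<dots> \<le> exp (- (a * Re z * x\<^sup>2)) * (B * (E / (1 / 2)))"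
      using den[of x] E B0 hb by (intro mult_left_mono mult_mono divide_left_mono) (auto intro!: mult_pos_pos)
    finally show "norm (k x / (1 - e x) - k x) \<le> (2 * E * B) * (exp (- (a * Re z * x\<^sup>2)) * x ^ (2 * 0))"
      by (simp add: mult_ac)
  qed (use a z ik ik' in auto)
  finally have "norm (J - (LINT x|lborel. k x)) \<le> 2 * E * B * sqrt (pi / (a * Re z))" by simp
  with J ik show ?thesis using that unfolding k_def E_def by blast
qed

section \<open>Behaviour near the cusp 0\<close>

lemma csqrt_scale:
  assumes "r > 0"
  shows "csqrt (of_real r * w) = of_real (sqrt r) * csqrt w"
proof (cases "w = 0")
  case False
  show ?thesis
  proof (rule csqrt_unique)
    show "(of_real (sqrt r) * csqrt w)\<^sup>2 = of_real r * w"
      using assms by (simp add: power_mult_distrib flip: of_real_power)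
    show "0 < Re (of_real (sqrt r) * csqrt w) \<or> Re (of_real (sqrt r) * csqrt w) = 0 \<and> 0 \<le> Im (of_real (sqrt r) * csqrt w)"
      using csqrt_principal[of w] assms by auto
  qed
qed simp

lemma theta_term_exp: "exp (- z) powi (r ^ 2) = exp (- (z * of_int r ^ 2))" for z :: complex
  by (simp add: exp_power_int mult.commute)

text \<open>\<open>1 + q^r = 2 * q^(r/2) * cosh (r*z/2)\<close>, and the half power cancels the
  linear part of the exponent \<open>r*(3*r+1)/2\<close>. The terms thereby take the form of a
  Gaussian times an even function.\<close>

lemma watson_term_exp:
  fixes z :: complex
  assumes "norm (exp (- z)) < 1"
  shows "2 * watson_coeff (exp (- z)) r * exp (- z) powi (r ^ 2) / (1 + exp (- z) powi r)
    = (-1) powi r * (exp (- (of_real (3/2) * z * of_int r ^ 2)) * (1 / cosh (z * of_int r / 2)))"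
proof -
  define t :: complex where "t = z * of_int r / 2"
  have ev: "2 * (of_int (r * (r + 1) div 2) :: complex) = of_int r * (of_int r + 1)"
  proof -
    have "even (r * (r + 1))" by auto
    then have "2 * (r * (r + 1) div 2) = r * (r + 1)" by simp
    then have "(of_int (2 * (r * (r + 1) div 2)) :: complex) = of_int (r * (r + 1))" by (simp only:)
    then show ?thesis by (simp only: of_int_mult of_int_add of_int_numeral of_int_1)
  qed
  have e1: "exp (- z) powi (r * (r + 1) div 2) = exp (- (z * of_int r ^ 2 / 2)) * exp (- t)"
  proof -
    have "of_int (r * (r + 1) div 2) * (- z) = - (z * of_int r ^ 2 / 2) + - t"
      using ev by (simp add: t_def power2_eq_square field_simps)
    then show ?thesis unfolding exp_power_int by (simp only: exp_add)
  qed
  have e2: "1 + exp (- z) powi r = exp (- t) * (2 * cosh t)"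
  proof -
    have "of_int r * (- z) = - t + - t" by (simp add: t_def)
    then have "exp (- z) powi r = exp (- t) * exp (- t)" unfolding exp_power_int by (simp only: exp_add)
    moreover have "2 * cosh t = exp t + exp (- t)" by (simp add: cosh_def scaleR_conv_of_real)
    moreover have "exp (- t) * exp t = 1" by (simp flip: exp_add)
    ultimately show ?thesis by (simp add: distrib_left)
  qed
  have e3: "exp (- (z * of_int r ^ 2 / 2)) * exp (- (z * of_int r ^ 2)) = exp (- (of_real (3/2) * z * of_int r ^ 2))"
    unfolding exp_add[symmetric] by (simp add: field_simps)
  have e0: "exp (- t) \<noteq> 0" by simp
  have "2 * watson_coeff (exp (- z)) r * exp (- z) powi (r ^ 2) / (1 + exp (- z) powi r)
     = 2 * ((-1) powi r * (exp (- (z * of_int r ^ 2 / 2)) * exp (- t))) * exp (- (z * of_int r ^ 2)) / (exp (- t) * (2 * cosh t))"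
    unfolding watson_coeff_def[OF assms exp_not_eq_zero] e1 e2 theta_term_exp ..
  also have "\<dots> = (-1) powi r * ((exp (- (z * of_int r ^ 2 / 2)) * exp (- (z * of_int r ^ 2))) * (1 / cosh t))"
  proof -
    have "2 * (s * (A * x)) * D / (x * (2 * c)) = s * ((A * D) * (1 / c))" if "x \<noteq> 0" for s A x D c :: complex
      using that by simp
    from this[OF e0] show ?thesis .
  qed
  finally show ?thesis unfolding e3 t_def .
qed

text \<open>Numerator and denominator are compared with the same Gaussian integral
  \<open>G = sqrt pi / csqrt z\<close>, of order \<open>1 / s\<close> for
  \<open>s = sqrt (Re z)\<close>. Each misses its main term by \<open>O(s)\<close>, so the quotient
  has relative error \<open>O(s^2) = O(Re z)\<close>.\<close>

lemma odd_even_gf_near_cusp: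
  fixes M :: real
  assumes M: "M > 0"
  obtains C \<delta> where "\<delta> > 0"
    "\<And>z. 0 < Re z \<Longrightarrow> Re z < \<delta> \<Longrightarrow> \<bar>Im z\<bar> \<le> M * Re z \<Longrightarrow>
       norm (odd_even_gf (exp (- z)) - of_real (2 * sqrt 2 / 3) * exp (of_real pi ^ 2 / (12 * z)))
         \<le> C * Re z * norm (exp (of_real pi ^ 2 / (12 * z)))"
proof -
  \<comment> \<open>In the sector \<open>norm z ^ 2 \<le> L * (Re z)^2\<close>. \<open>m\<close>
    bounds \<open>cosh\<close> from below, \<open>D\<close> is the Taylor constant,
    \<open>A1\<close> and \<open>A2\<close> are the error constants of numerator and denominator,
    and \<open>g / s\<close> bounds \<open>norm G\<close> from below. The two entries of
    \<open>\<delta>\<close> give \<open>L * Re z \<le> 1/2\<close> and keep the denominator's error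
    below half of \<open>norm G\<close>.\<close>
  define L where "L = 1 + M\<^sup>2"
  define m where "m = min (1 / 2) (pi / (6 * M))"
  define D where "D = 1 / m + 2 / m ^ 3"
  define \<kappa> where "\<kappa> = 2 * sqrt 2 / 3"
  define A2 where "A2 = 2 * L * sqrt pi"
  define A1 where "A1 = A2 / m + D * L * sqrt pi"
  define g where "g = sqrt pi / sqrt L"
  define \<delta> where "\<delta> = min (1 / (2 * L)) (g / (2 * A2))"
  have L: "L \<ge> 1" by (simp add: L_def)
  have m0: "m > 0" using M by (simp add: m_def)
  have D0: "D > 0" using m0 by (simp add: D_def add_pos_pos)
  have A2: "A2 > 0" using L by (simp add: A2_def)
  have g0: "g > 0" using L by (simp add: g_def)
  have \<delta>: "\<delta> > 0" using L A2 g0 by (simp add: \<delta>_def)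
  have \<kappa>: "\<kappa> > 0" "(2 / sqrt 3) / sqrt (3 / 2) = \<kappa>"
  proof -
    show "\<kappa> > 0" by (simp add: \<kappa>_def)
    have "sqrt 3 * sqrt (3 / 2) = 3 / sqrt 2" by (simp add: real_sqrt_divide)
    then have "(2 / sqrt 3) / sqrt (3 / 2) = 2 / (3 / sqrt 2)" by simp
    then show "(2 / sqrt 3) / sqrt (3 / 2) = \<kappa>" by (simp add: \<kappa>_def)
  qed
  show ?thesis
  proof (rule that[OF \<delta>])
    fix z assume z: "0 < Re z" "Re z < \<delta>" "\<bar>Im z\<bar> \<le> M * Re z"
    define \<rho> s where "\<rho> = Re z" and "s = sqrt \<rho>"
    have \<rho>: "\<rho> > 0" using z by (simp add: \<rho>_def)
    have s: "s > 0" "s\<^sup>2 = \<rho>" using \<rho> by (simp_all add: s_def)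
    have nz: "norm z > 0" "z \<noteq> 0" using z by auto
    have norm2: "(norm z)\<^sup>2 \<le> L * \<rho>\<^sup>2"
    proof -
      have "(Im z)\<^sup>2 \<le> (M * Re z)\<^sup>2" using z(3) power_mono[OF z(3), of 2] by simp
      then show ?thesis by (simp add: cmod_power2 L_def \<rho>_def power_mult_distrib algebra_simps)
    qed
    have norm1: "norm z \<le> L * \<rho>"
    proof (rule power2_le_imp_le)
      have "L * \<rho>\<^sup>2 \<le> L * L * \<rho>\<^sup>2" using L by (intro mult_right_mono) auto
      then show "(norm z)\<^sup>2 \<le> (L * \<rho>)\<^sup>2" using norm2 by (simp add: power2_eq_square mult_ac)
    qed (use L \<rho> in auto)
    \<comment> \<open>The quantity is exponentially small, but \<open>exp (- X) \<le> 1 / X\<close>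
      with \<open>X \<ge> 1 / (L * \<rho>)\<close> suffices; the latter uses
      \<open>a \<le> 3/2 < pi^2\<close>.\<close>
    have tiny: "exp (- (2 * pi * (pi * Re z / (2 * a * (norm z)\<^sup>2)))) \<le> L * \<rho>" if a: "1 \<le> a" "a \<le> 3/2" for a
    proof -
      define X where "X = 2 * pi * (pi * Re z / (2 * a * (norm z)\<^sup>2))"
      have X: "X = pi\<^sup>2 * \<rho> / (a * (norm z)\<^sup>2)" by (simp add: X_def \<rho>_def power2_eq_square)
      have X0: "X > 0" unfolding X using a \<rho> nz by simp
      have "pi\<^sup>2 > 2\<^sup>2" using pi_gt3 by (intro power_strict_mono) auto
      then have "a * (norm z)\<^sup>2 \<le> pi\<^sup>2 * (L * \<rho>\<^sup>2)" using a norm2 by (intro mult_mono) auto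
      then have "1 \<le> L * \<rho> * X" unfolding X using a nz
        by (simp add: power2_eq_square pos_le_divide_eq mult_ac)
      then have "1 / X \<le> L * \<rho>" using X0 by (simp add: pos_divide_le_eq)
      moreover have "exp (- X) \<le> 1 / X"
      proof -
        have "X \<le> exp X" using exp_ge_add_one_self[of X] by linarith
        then show ?thesis using X0 by (simp add: exp_minus inverse_eq_divide frac_le)
      qed
      ultimately show ?thesis unfolding X_def by linarith
    qed
    have small: "L * \<rho> \<le> 1 / 2" using z(2) L \<rho> by (simp add: \<delta>_def \<rho>_def field_simps)
    have sq: "sqrt (pi / (a * \<rho>)) \<le> sqrt pi / s" if "1 \<le> a" for a
    proof -
      have "sqrt (pi / (a * \<rho>)) \<le> sqrt (pi / (1 * \<rho>))"
        using that \<rho> by (intro real_sqrt_le_mono divide_left_mono mult_right_mono mult_pos_pos) auto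
      then show ?thesis by (simp add: s_def real_sqrt_divide)
    qed
    have q1: "norm (exp (- z)) < 1" using z by simp
    define G where "G = of_real (sqrt pi) / csqrt z"
    have Gn: "norm G \<ge> g / s"
    proof -
      have "norm G = sqrt pi / sqrt (norm z)" by (simp add: G_def norm_divide)
      also have "\<dots> \<ge> sqrt pi / sqrt (L * \<rho>)" using nz norm1 L \<rho> by (intro divide_left_mono mult_pos_pos) auto
      finally show ?thesis by (simp add: g_def s_def real_sqrt_mult)
    qed

    have tiny1: "exp (- (2 * pi * (pi * Re z / (2 * 1 * (norm z)\<^sup>2)))) \<le> L * \<rho>" by (rule tiny) auto
    obtain J1 where J1: "(\<lambda>N. \<Sum>n=-int N..int N. (-1) powi n * (exp (- (of_real 1 * z * of_int n ^ 2)) * 1))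
       \<longlonglongrightarrow> 2 * exp (- (of_real pi ^ 2 / (4 * of_real 1 * z))) * J1"
      "norm (J1 - (LINT x|lborel. exp (- (of_real 1 * z * of_real x ^ 2)) * 1))
       \<le> 2 * exp (- (2 * pi * (pi * Re z / (2 * 1 * (norm z)\<^sup>2)))) * 1 * sqrt (pi / (1 * Re z))"
    proof -
      have sm: "exp (- (2 * pi * (pi * Re z / (2 * 1 * (norm z)\<^sup>2)))) \<le> 1 / 2" using tiny1 small by linarith
      show ?thesis
        by (rule gaussian_alternating_sum_approx[of z 1 "\<lambda>_. 1" 1,
              OF z(1) zero_less_one holomorphic_on_const refl one_neq_zero _ sm]) (simp, rule that)
    qed
    have B1: "norm (J1 - G) \<le> A2 * s"
    proof -
      have "norm (J1 - G) \<le> 2 * exp (- (2 * pi * (pi * Re z / (2 * 1 * (norm z)\<^sup>2)))) * 1 * sqrt (pi / (1 * Re z))"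
        using J1(2) complex_gaussian_integral[OF z(1)] by (simp add: G_def)
      also have "\<dots> \<le> 2 * (L * \<rho>) * 1 * (sqrt pi / s)"
        unfolding \<rho>_def[symmetric] using sq[of 1] tiny1 \<rho> L by (intro mult_mono) (auto simp: \<rho>_def)
      also have "\<dots> = A2 * s" using s by (simp add: A2_def power2_eq_square flip: s(2))
      finally show ?thesis .
    qed

    define h where "h x = 1 / cosh (z * x / 2)" for x
    define c where "c = pi * Re z / (2 * (3/2) * (norm z)\<^sup>2)"
    define s0 where "s0 = - \<i> * of_real pi / (2 * of_real (3/2) * z)"
    have tiny2: "exp (- (2 * pi * c)) \<le> L * \<rho>" unfolding c_def by (rule tiny) auto
    \<comment> \<open>\<open>Im v * Re z - Re v * Im z = Im (v * cnj z)\<close> measures how far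
      \<open>v\<close> is from the line through 0 and \<open>z\<close>. The cases are
      \<open>t = 0\<close> for real \<open>x\<close>, \<open>t = 1\<close> up to the line of
      integration, and \<open>t = 2\<close> for holomorphy, where \<open>2 * (pi/6) < pi/2\<close>
      keeps clear of the zeros of \<open>cosh\<close>.\<close>
    have strip: "\<bar>Im v\<bar> \<le> t * (pi / 6) + M * \<bar>Re v\<bar>"
      if v: "v = z * x / 2" and x: "\<bar>Im x\<bar> \<le> t * c" for v x t
    proof -
      have id: "Im v * Re z - Re v * Im z = (norm z)\<^sup>2 * Im x / 2"
      proof -
        have *: "Re v = (Re z * Re x - Im z * Im x) / 2" "Im v = (Re z * Im x + Im z * Re x) / 2" by (simp_all add: v)
        show ?thesis unfolding * cmod_power2 by (simp add: power2_eq_square field_simps)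
      qed
      have "\<bar>(norm z)\<^sup>2 * Im x / 2\<bar> \<le> (norm z)\<^sup>2 * (t * c) / 2"
        unfolding abs_mult abs_divide using x by (simp add: mult_left_mono)
      also have "\<dots> = t * (pi / 6) * \<rho>" using nz by (simp add: c_def \<rho>_def)
      finally have "\<bar>Im v * Re z - Re v * Im z\<bar> \<le> t * (pi / 6) * \<rho>" unfolding id .
      moreover have "\<bar>Re v * Im z\<bar> \<le> \<bar>Re v\<bar> * (M * \<rho>)"
        unfolding abs_mult \<rho>_def using z(3) by (intro mult_left_mono) auto
      ultimately have "\<bar>Im v * Re z\<bar> \<le> t * (pi / 6) * \<rho> + \<bar>Re v\<bar> * (M * \<rho>)" by linarith
      then have "\<bar>Im v\<bar> * \<rho> \<le> (t * (pi / 6) + M * \<bar>Re v\<bar>) * \<rho>"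
        using \<rho> by (simp add: abs_mult \<rho>_def algebra_simps)
      then show ?thesis using \<rho> by simp
    qed
    have c0: "c > 0" using z(1) nz by (simp add: c_def)
    have hol: "h holomorphic_on {x. \<bar>Im x\<bar> < 2 * c}"
      unfolding h_def
    proof (rule holomorphic_on_divide[OF holomorphic_on_const])
      show "(\<lambda>x. cosh (z * x / 2)) holomorphic_on {x. \<bar>Im x\<bar> < 2 * c}"
        unfolding cosh_conv_cos by (intro holomorphic_intros) simp
      fix x assume "x \<in> {x. \<bar>Im x\<bar> < 2 * c}"
      then have "\<bar>Im (z * x / 2)\<bar> \<le> 2 * (pi / 6) + M * \<bar>Re (z * x / 2)\<bar>" by (intro strip[OF refl]) simp
      also have "\<dots> < pi / 2 + M * \<bar>Re (z * x / 2)\<bar>" by simp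
      finally show "cosh (z * x / 2) \<noteq> 0" by (rule cosh_nonzero)
    qed
    have hB: "norm (h x) \<le> 1 / m" if "\<bar>Im x\<bar> \<le> c" for x
    proof -
      have "m \<le> norm (cosh (z * x / 2))"
        unfolding m_def using strip[of _ x 1, OF refl] that by (intro norm_cosh_ge M) simp
      then show ?thesis using m0 by (simp add: h_def norm_divide frac_le)
    qed
    have hnz: "h (of_int n) \<noteq> 0" for n
      using hB[of "of_int n"] strip[of _ "of_int n" 1, OF refl] c0 m0 norm_cosh_ge[OF M, of "z * of_int n / 2"]
      unfolding h_def m_def[symmetric] by auto
    have heven: "h (- x) = h x" for x by (simp add: h_def)
    obtain J2 where J2: "(\<lambda>N. \<Sum>n=-int N..int N. (-1) powi n * (exp (- (of_real (3/2) * z * of_int n ^ 2)) * h (of_int n)))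
       \<longlonglongrightarrow> 2 * exp (- (of_real pi ^ 2 / (4 * of_real (3/2) * z))) * J2"
      "norm (J2 - (LINT x|lborel. exp (- (of_real (3/2) * z * of_real x ^ 2)) * h (s0 + of_real x)))
       \<le> 2 * exp (- (2 * pi * c)) * (1 / m) * sqrt (pi / (3/2 * Re z))"
      and int2: "integrable lborel (\<lambda>x. exp (- (of_real (3/2) * z * of_real x ^ 2)) * h (s0 + of_real x))"
    proof -
      have sm: "exp (- (2 * pi * c)) \<le> 1 / 2" using tiny2 small by linarith
      show ?thesis
        by (rule gaussian_alternating_sum_approx[of z "3/2" h "1 / m", folded c_def s0_def,
              OF z(1) _ hol heven hnz hB sm]) (simp, assumption, rule that)
    qed

    \<comment> \<open>The saddle point corresponds to \<open>z * s0 / 2 = - i*pi/6\<close>,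
      independent of \<open>z\<close>, where \<open>cosh\<close> takes the value
      \<open>cos (pi/6)\<close>.\<close>
    define \<beta> where "\<beta> = - (\<i> * of_real (pi / 6))"
    have \<beta>: "\<bar>Im \<beta>\<bar> \<le> pi / 6" "Re \<beta> = 0" by (simp_all add: \<beta>_def)
    have cb: "1 / cosh \<beta> = of_real (2 / sqrt 3)"
    proof -
      have "cosh \<beta> = cos (of_real (pi / 6))" by (simp add: \<beta>_def cosh_conv_cos)
      also have "\<dots> = of_real (cos (pi / 6))" by (rule cos_of_real)
      also have "\<dots> = of_real (sqrt 3 / 2)" by (simp add: cos_30)
      finally have *: "cosh \<beta> = of_real (sqrt 3 / 2)" .
      show ?thesis unfolding * by simp
    qed
    define w where "w = of_real (3/2) * z"
    have w: "Re w = 3/2 * \<rho>" "Re w > 0" using \<rho> by (simp_all add: w_def \<rho>_def)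
    define d where "d = sinh \<beta> / cosh \<beta> ^ 2 * (z / 2)"
    \<comment> \<open>The integrand without its constant and linear Taylor terms. The remainder is
      of size \<open>norm z ^ 2 * x^2\<close>, and integrating \<open>x^2\<close> against the
      Gaussian costs a factor \<open>1 / Re z\<close>, so one power of \<open>Re z\<close> is
      gained.\<close>
    define r where "r x = exp (- (w * of_real x ^ 2)) * h (s0 + of_real x) - of_real (2 / sqrt 3) * exp (- (w * of_real x ^ 2))
       + d * (exp (- (w * of_real x ^ 2)) * of_real x)" for x :: real
    note ints = int2[folded w_def] complex_gaussian_integrable[OF w(2)] complex_gaussian_first_moment(1)[OF w(2)]
    have rint: "integrable lborel r" unfolding r_def
      by (intro Bochner_Integration.integrable_add Bochner_Integration.integrable_diff integrable_mult_right ints)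
    have "(LINT x|lborel. r x) = (LINT x|lborel. exp (- (w * of_real x ^ 2)) * h (s0 + of_real x))
       - of_real (2 / sqrt 3) * (LINT x|lborel. exp (- (w * of_real x ^ 2)))
       + d * (LINT x|lborel. exp (- (w * of_real x ^ 2)) * of_real x)"
      unfolding r_def by (simp add: ints)
    also have "(LINT x|lborel. exp (- (w * of_real x ^ 2))) = G / of_real (sqrt (3 / 2))"
      unfolding complex_gaussian_integral[OF w(2)] unfolding w_def G_def by (subst csqrt_scale) auto
    also have "(LINT x|lborel. exp (- (w * of_real x ^ 2)) * of_real x) = (0 :: complex)"
      by (rule complex_gaussian_first_moment[OF w(2)])
    also have "of_real (2 / sqrt 3) * (G / of_real (sqrt (3 / 2))) = of_real \<kappa> * G"
      unfolding \<kappa>(2)[symmetric] by simp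
    finally have req: "(LINT x|lborel. r x) = (LINT x|lborel. exp (- (w * of_real x ^ 2)) * h (s0 + of_real x)) - of_real \<kappa> * G"
      by simp
    have "norm (LINT x|lborel. r x) \<le> (D * ((norm z)\<^sup>2 / 4)) * (sqrt (pi / (3/2 * \<rho>)) * (fact (2 * 1) / ((4 * (3/2 * \<rho>)) ^ 1 * fact 1)))"
    proof (rule norm_integral_le_gaussian[OF _ rint])
      fix x :: real
      define u where "u = z * of_real x / 2"
      have hu: "h (s0 + of_real x) = 1 / cosh (\<beta> + u)"
      proof -
        have "z * s0 / 2 = \<beta>" using nz by (simp add: s0_def \<beta>_def)
        then have "z * (s0 + of_real x) / 2 = \<beta> + u" by (simp add: u_def distrib_left add_divide_distrib)
        then show ?thesis by (simp only: h_def)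
      qed
      have uM: "\<bar>Im u\<bar> \<le> M * \<bar>Re u\<bar>" using strip[of u "of_real x" 0] by (simp add: u_def)
      have "r x = exp (- (w * of_real x ^ 2)) * (1 / cosh (\<beta> + u) - 1 / cosh \<beta> + sinh \<beta> / cosh \<beta> ^ 2 * u)"
        unfolding r_def hu cb d_def u_def by (simp add: algebra_simps)
      then have "norm (r x) = exp (- (3/2 * \<rho> * x\<^sup>2)) * norm (1 / cosh (\<beta> + u) - 1 / cosh \<beta> + sinh \<beta> / cosh \<beta> ^ 2 * u)"
        by (simp only: norm_mult norm_exp_gaussian w)
      also have "\<dots> \<le> exp (- (3/2 * \<rho> * x\<^sup>2)) * (D * norm u ^ 2)"
        unfolding D_def using taylor_inverse_cosh[OF M m_def \<beta> uM] by (intro mult_left_mono) auto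
      also have "norm u ^ 2 = (norm z)\<^sup>2 / 4 * x\<^sup>2"
        by (simp add: u_def norm_mult norm_divide power_mult_distrib power_divide)
      finally show "norm (r x) \<le> (D * ((norm z)\<^sup>2 / 4)) * (exp (- (3/2 * \<rho> * x\<^sup>2)) * x ^ (2 * 1))"
        by (simp add: mult_ac)
    qed (use \<rho> in simp)
    also have "\<dots> = D * (norm z)\<^sup>2 / (12 * \<rho>) * sqrt (pi / (3/2 * \<rho>))"
      using \<rho> by (simp add: field_simps)
    also have "\<dots> \<le> D * (L * \<rho>\<^sup>2) / (12 * \<rho>) * (sqrt pi / s)"
      using D0 norm2 sq[of "3/2"] \<rho> L by (intro mult_mono divide_right_mono mult_left_mono) auto
    also have "\<dots> = (D * L * sqrt pi) * s / 12"
      using s by (simp add: power2_eq_square flip: s(2))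
    also have "\<dots> \<le> (D * L * sqrt pi) * s" using D0 L s by simp
    finally have r_bound: "norm (LINT x|lborel. r x) \<le> (D * L * sqrt pi) * s" .
    have B2: "norm (J2 - of_real \<kappa> * G) \<le> A1 * s"
    proof -
      have "norm (J2 - (LINT x|lborel. exp (- (w * of_real x ^ 2)) * h (s0 + of_real x)))
         \<le> 2 * exp (- (2 * pi * c)) * (1 / m) * sqrt (pi / (3/2 * Re z))"
        using J2(2) unfolding w_def .
      also have "\<dots> \<le> 2 * (L * \<rho>) * (1 / m) * (sqrt pi / s)"
        unfolding \<rho>_def[symmetric] using sq[of "3/2"] tiny2 \<rho> L m0 by (intro mult_mono) auto
      also have "\<dots> = A2 / m * s" using s by (simp add: A2_def power2_eq_square flip: s(2))
      finally have "norm (J2 - (LINT x|lborel. exp (- (w * of_real x ^ 2)) * h (s0 + of_real x))) \<le> A2 / m * s" .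
      then have "norm ((J2 - (LINT x|lborel. exp (- (w * of_real x ^ 2)) * h (s0 + of_real x))) + (LINT x|lborel. r x))
         \<le> A2 / m * s + (D * L * sqrt pi) * s"
        using r_bound by (rule norm_triangle_mono)
      then show ?thesis unfolding req by (simp add: A1_def algebra_simps)
    qed

    \<comment> \<open>The divisor must stay away from 0; the second entry of \<open>\<delta>\<close>
      is chosen for this.\<close>
    have J1n: "norm J1 \<ge> g / (2 * s)"
    proof -
      have "\<rho> \<le> g / (2 * A2)" using z(2) by (simp add: \<delta>_def \<rho>_def)
      then have "A2 * s \<le> g / (2 * s)" using s A2 by (simp add: field_simps power2_eq_square flip: s(2))
      then have "norm (J1 - G) \<le> g / (2 * s)" using B1 by linarith
      moreover have "norm G \<le> norm J1 + norm (J1 - G)" using norm_triangle_ineq2[of G J1] by (simp add: norm_minus_commute)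
      ultimately show ?thesis using Gn by (simp add: field_simps)
    qed
    moreover have "g / (2 * s) > 0" using g0 s by simp
    ultimately have J10: "J1 \<noteq> 0" by force

    define e1 e2 where "e1 = exp (- (of_real pi ^ 2 / (4 * of_real 1 * z)))" and "e2 = exp (- (of_real pi ^ 2 / (4 * of_real (3/2) * z)))"
    define e where "e = exp (of_real pi ^ 2 / (12 * z))"
    have ee: "e2 = e * e1"
    proof -
      have "- (of_real pi ^ 2 / (4 * of_real (3/2) * z)) = of_real pi ^ 2 / (12 * z) + - (of_real pi ^ 2 / (4 * of_real 1 * z))"
        using nz by (simp add: field_simps)
      then show ?thesis unfolding e2_def e_def e1_def by (simp only: exp_add)
    qed
    obtain \<theta> where \<theta>: "\<theta> \<noteq> 0"
      "(\<lambda>N. \<Sum>r=-int N..int N. (-1) powi r * exp (- z) powi (r ^ 2)) \<longlonglongrightarrow> \<theta>"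
      "(\<lambda>N. \<Sum>r=-int N..int N. 2 * watson_coeff (exp (- z)) r * exp (- z) powi (r ^ 2) / (1 + exp (- z) powi r))
        \<longlonglongrightarrow> odd_even_gf (exp (- z)) * \<theta>"
      using odd_even_gf_quotient[OF q1 exp_not_eq_zero] by blast
    have t1: "\<theta> = 2 * e1 * J1"
      using J1(1) by (intro LIMSEQ_unique[OF \<theta>(2)]) (simp add: theta_term_exp e1_def)
    have t2: "odd_even_gf (exp (- z)) * \<theta> = 2 * e2 * J2"
      using J2(1) \<theta>(3) unfolding watson_term_exp[OF q1] h_def e2_def by (rule LIMSEQ_unique[rotated])
    have "odd_even_gf (exp (- z)) = e * (J2 / J1)"
    proof -
      have "odd_even_gf (exp (- z)) * (2 * e1 * J1) = 2 * (e * e1) * J2" using t2 unfolding t1 ee .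
      moreover have "e1 \<noteq> 0" by (simp add: e1_def)
      ultimately show ?thesis using J10 by (simp add: field_simps)
    qed
    \<comment> \<open>Inserting \<open>\<kappa> * G\<close> expresses the error through the two
      differences already bounded.\<close>
    then have "odd_even_gf (exp (- z)) - of_real \<kappa> * e = e * (((J2 - of_real \<kappa> * G) - of_real \<kappa> * (J1 - G)) / J1)"
      using J10 by (simp add: field_simps)
    then have "norm (odd_even_gf (exp (- z)) - of_real \<kappa> * e)
       = norm e * (norm ((J2 - of_real \<kappa> * G) - of_real \<kappa> * (J1 - G)) / norm J1)"
      by (simp only: norm_mult norm_divide)
    also have "\<dots> \<le> norm e * ((A1 * s + \<kappa> * (A2 * s)) / (g / (2 * s)))"
    proof (intro mult_left_mono frac_le J1n)
      have "norm ((J2 - of_real \<kappa> * G) - of_real \<kappa> * (J1 - G)) \<le> norm (J2 - of_real \<kappa> * G) + norm (of_real \<kappa> * (J1 - G))"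
        by (rule norm_triangle_ineq4)
      also have "\<dots> \<le> A1 * s + \<kappa> * (A2 * s)"
        using B1 B2 \<kappa>(1) by (intro add_mono) (auto simp: norm_mult intro!: mult_left_mono)
      finally show "norm ((J2 - of_real \<kappa> * G) - of_real \<kappa> * (J1 - G)) \<le> A1 * s + \<kappa> * (A2 * s)" .
      show "0 \<le> A1 * s + \<kappa> * (A2 * s)"
        using \<open>norm (J2 - of_real \<kappa> * G - of_real \<kappa> * (J1 - G)) \<le> A1 * s + \<kappa> * (A2 * s)\<close> norm_ge_zero order_trans by blast
    qed (use g0 s in auto)
    also have "\<dots> = (2 * (A1 + \<kappa> * A2) / g) * Re z * norm e"
      using s g0 unfolding \<rho>_def[symmetric] s(2)[symmetric] by (simp add: field_simps power2_eq_square)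
    finally show "norm (odd_even_gf (exp (- z)) - of_real (2 * sqrt 2 / 3) * exp (of_real pi ^ 2 / (12 * z)))
         \<le> (2 * (A1 + \<kappa> * A2) / g) * Re z * norm (exp (of_real pi ^ 2 / (12 * z)))"
      unfolding e_def \<kappa>_def .
  qed
qed

section \<open>Away from the cusp 0\<close>

text \<open>By the logarithmic series \<open>ln (norm (1 - w)) - ln (1 - norm w)\<close> is the sum
  of \<open>(norm w ^ n - Re (w^n)) / n\<close>, with nonnegative terms. Keeping the term
  \<open>n = 1\<close> improves the trivial bound \<open>1 / (1 - norm w)\<close> by an exponential
  factor.\<close>

lemma inverse_norm_one_minus_le:
  fixes w :: complex
  assumes w: "norm w < 1"
  shows "1 / norm (1 - w) \<le> exp (Re w - norm w) / (1 - norm w)"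
proof -
  have nz: "1 - w \<noteq> 0" using w by auto
  have "(\<lambda>n. - (w ^ n) / of_nat n) sums Ln (1 - w)"
    using Ln_series'[of "- w"] w by simp
  from sums_Re[OF this] have 1: "(\<lambda>n. - (Re (w ^ n) / real n)) sums ln (norm (1 - w))"
    using nz by simp
  have 2: "(\<lambda>n. - (norm w ^ n / real n)) sums ln (1 - norm w)"
    using ln_series'[of "- norm w"] w by simp
  define a where "a n = norm w ^ n / real n - Re (w ^ n) / real n" for n
  have a: "a sums (ln (norm (1 - w)) - ln (1 - norm w))"
    using sums_diff[OF 1 2] unfolding a_def[abs_def] by simp
  have a0: "a n \<ge> 0" for n
    unfolding a_def using complex_Re_le_cmod[of "w ^ n"] by (simp add: norm_power divide_right_mono)
  \<comment> \<open>The series starts at \<open>n = 0\<close>, where division by zero gives the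
    value 0.\<close>
  have "a 1 \<le> suminf a"
    using sum_le_suminf[OF sums_summable[OF a], of "{1}"] a0 by simp
  then have "norm w - Re w \<le> ln (norm (1 - w)) - ln (1 - norm w)"
    using sums_unique[OF a] by (simp add: a_def)
  then have "ln (1 - norm w) - (Re w - norm w) \<le> ln (norm (1 - w))" by linarith
  then have "exp (ln (1 - norm w) - (Re w - norm w)) \<le> exp (ln (norm (1 - w)))" by (simp only: exp_le_cancel_iff)
  then have "(1 - norm w) / exp (Re w - norm w) \<le> norm (1 - w)"
    using w nz by (simp add: exp_diff)
  then show ?thesis using w nz by (simp add: field_simps)
qed

lemma inv_qpoch_of_real: "inv_qpoch (of_real r :: complex) k = of_real (inv_qpoch r k)"
  unfolding inv_qpoch_def by simp

lemma inv_qpoch_real_pos: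
  assumes "0 < r" "r < (1::real)"
  shows "inv_qpoch r (int n) > 0"
proof -
  have "(\<Prod>i=1..n. 1 - r ^ i) > 0"
    using assms by (intro prod_pos) (auto simp: power_less_one_iff)
  then show ?thesis by (simp add: inv_qpoch_def)
qed

text \<open>The previous bound for each factor. The exponents add up to the geometric sum of the
  \<open>q^j\<close>, whose cancellation is thus still available after the moduli of the factors
  have been taken.\<close>

lemma norm_inv_qpoch_le:
  fixes q :: complex
  assumes q1: "norm q < 1" and q0: "q \<noteq> 0"
  shows "norm (inv_qpoch q (int m)) \<le> inv_qpoch (norm q) (int m) * exp (Re (\<Sum>j=1..m. q ^ j) - (\<Sum>j=1..m. norm q ^ j))"
proof (induction m)
  case (Suc m)
  define r where "r = norm q"
  have r: "0 < r" "r < 1" using q1 q0 by (simp_all add: r_def)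
  have lt: "norm (q ^ Suc m) < 1" using r by (simp add: norm_power r_def[symmetric] power_less_one_iff del: power_Suc)
  have nz: "1 - q ^ Suc m \<noteq> 0" using one_minus_pow_nz[OF q1 q0, of "Suc m"] by simp
  have "inv_qpoch q (int (Suc m)) = inv_qpoch q (int m) / (1 - q ^ Suc m)"
    using inv_qpoch_Suc[OF q1 q0, of m] nz by (simp add: field_simps del: power_Suc)
  then have "norm (inv_qpoch q (int (Suc m))) = norm (inv_qpoch q (int m)) * (1 / norm (1 - q ^ Suc m))"
    by (simp only: norm_divide) simp
  also have "\<dots> \<le> (inv_qpoch r (int m) * exp (Re (\<Sum>j=1..m. q ^ j) - (\<Sum>j=1..m. r ^ j)))
      * (exp (Re (q ^ Suc m) - r ^ Suc m) / (1 - r ^ Suc m))"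
    using Suc[folded r_def] inverse_norm_one_minus_le[OF lt, unfolded norm_power, folded r_def]
      inv_qpoch_real_pos[OF r, of m]
    by (intro mult_mono) simp_all
  also have "\<dots> = (inv_qpoch r (int m) / (1 - r ^ Suc m))
      * exp ((Re (\<Sum>j=1..m. q ^ j) - (\<Sum>j=1..m. r ^ j)) + (Re (q ^ Suc m) - r ^ Suc m))"
    unfolding exp_add by simp
  also have "inv_qpoch r (int m) / (1 - r ^ Suc m) = inv_qpoch r (int (Suc m))"
    using inv_qpoch_Suc[of r m] one_minus_pow_nz[of r "Suc m"] r by (simp add: field_simps del: power_Suc)
  also have "(Re (\<Sum>j=1..m. q ^ j) - (\<Sum>j=1..m. r ^ j)) + (Re (q ^ Suc m) - r ^ Suc m)
      = Re (\<Sum>j=1..Suc m. q ^ j) - (\<Sum>j=1..Suc m. r ^ j)"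
    by simp
  finally show ?case unfolding r_def .
qed (simp add: inv_qpoch_def)

section \<open>Majorants for Euler's product with a real base\<close>

lemma one_plus_le_exp_cubic:
  assumes u: "0 \<le> (u::real)"
  shows "1 + u \<le> exp (u - u\<^sup>2 / 2 + u ^ 3 / 3)"
proof -
  define g where "g u = u - u\<^sup>2 / 2 + u ^ 3 / 3 - ln (1 + u)" for u :: real
  have "g 0 \<le> g u"
  proof (rule DERIV_nonneg_imp_nondecreasing[OF u])
    fix t :: real assume t: "0 \<le> t" "t \<le> u"
    have "(g has_real_derivative (1 - t + t\<^sup>2 - 1 / (1 + t))) (at t)"
      unfolding g_def[abs_def] using t by (auto intro!: derivative_eq_intros simp: power2_eq_square)
    moreover have "1 - t + t\<^sup>2 - 1 / (1 + t) = t ^ 3 / (1 + t)"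
      using t by (simp add: field_simps power2_eq_square power3_eq_cube)
    ultimately show "\<exists>y. (g has_real_derivative y) (at t) \<and> 0 \<le> y" using t by auto
  qed
  then have "ln (1 + u) \<le> u - u\<^sup>2 / 2 + u ^ 3 / 3" by (simp add: g_def)
  then have "exp (ln (1 + u)) \<le> exp (u - u\<^sup>2 / 2 + u ^ 3 / 3)" by (simp only: exp_le_cancel_iff)
  then show ?thesis using u by simp
qed

lemma geometric_sum_from_1:
  fixes z :: "'a::field"
  assumes "1 - z \<noteq> 0"
  shows "(\<Sum>j=1..m. z ^ j) = z * (1 - z ^ m) / (1 - z)"
proof -
  have "(1 - z) * (\<Sum>j=1..m. z ^ j) = z * (1 - z ^ m)"
  proof (induction m)
    case (Suc m)
    have "(1 - z) * (\<Sum>j=1..Suc m. z ^ j) = (1 - z) * (\<Sum>j=1..m. z ^ j) + (1 - z) * z ^ Suc m"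
      by (simp add: distrib_left)
    also have "\<dots> = z * (1 - z ^ Suc m)" unfolding Suc by (simp add: algebra_simps)
    finally show ?case .
  qed simp
  then show ?thesis using assms by (simp add: field_simps)
qed

lemma exp_geometric_bounds:
  assumes a: "a > (0::real)"
  shows "(\<Sum>i=1..N. exp (- a) ^ i) \<le> 1 / a"
    and "(\<lambda>N. \<Sum>i=1..N. exp (- a) ^ i) \<longlonglongrightarrow> exp (- a) / (1 - exp (- a))"
    and "1 / a - 1 \<le> exp (- a) / (1 - exp (- a))"
    and "exp (- a) / (1 - exp (- a)) \<le> 1 / a"
proof -
  define t where "t = exp (- a)"
  have t: "0 < t" "t < 1" using a by (simp_all add: t_def)
  have eq: "(\<Sum>i=1..N. t ^ i) = t / (1 - t) * (1 - t ^ N)" for N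
    using geometric_sum_from_1[of t N] t by simp
  have te: "t / (1 - t) = 1 / (exp a - 1)" using t a by (simp add: t_def exp_minus field_simps)
  have ea: "a \<le> exp a - 1" using exp_ge_add_one_self[of a] by linarith
  show up: "exp (- a) / (1 - exp (- a)) \<le> 1 / a"
    using te ea a unfolding t_def by (simp add: frac_le)
  show "(\<Sum>i=1..N. exp (- a) ^ i) \<le> 1 / a"
  proof -
    have "t / (1 - t) * (1 - t ^ N) \<le> t / (1 - t) * 1" using t by (intro mult_left_mono) auto
    then show ?thesis using up eq[of N] unfolding t_def by linarith
  qed
  have "(\<lambda>N. t / (1 - t) * (1 - t ^ N)) \<longlonglongrightarrow> t / (1 - t) * (1 - 0)"
    using t by (intro tendsto_intros LIMSEQ_power_zero) simp
  then show "(\<lambda>N. \<Sum>i=1..N. exp (- a) ^ i) \<longlonglongrightarrow> exp (- a) / (1 - exp (- a))"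
    unfolding eq[symmetric] by (simp add: t_def)
  have "1 - a \<le> t" using exp_ge_add_one_self[of "-a"] by (simp add: t_def)
  then have "(1 - a) * (1 - t) \<le> t * a"
    using t a by (simp add: algebra_simps)
  then have "(1 - a) / a \<le> t / (1 - t)" using t a by (simp add: field_simps)
  then show "1 / a - 1 \<le> exp (- a) / (1 - exp (- a))" using a by (simp add: t_def diff_divide_distrib)
qed

text \<open>Euler's \<open>sum r^(m*(m+1)/2) * c^m / (r;r)_m = prod (1 + c * r^i)\<close>, where the
  exponent is bounded by the first three terms of the dilogarithm series
  \<open>c - c^2/4 + c^3/9 - ...\<close>. Stopping the logarithm at odd order keeps this an upper
  bound.\<close>

lemma euler_partial_sum_le:
  fixes \<alpha> c r :: real
  assumes \<alpha>: "\<alpha> > 0" and c: "c \<ge> 0" and r: "r = exp (- \<alpha>)"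
  shows "(\<Sum>m\<le>L. r ^ (m * (m + 1) div 2) * c ^ m * inv_qpoch r (int m))
    \<le> exp ((c - c\<^sup>2 / 4 + c ^ 3 / 9) / \<alpha> + c\<^sup>2 / 2)"
proof -
  define t where "t m = r ^ (m * (m + 1) div 2) * c ^ m * inv_qpoch r (int m)" for m
  have r01: "0 < r" "r < 1" "norm r < 1" "r \<noteq> 0" using \<alpha> by (simp_all add: r)
  note pos = inv_qpoch_real_pos[OF r01(1,2)]
  have t0: "t m \<ge> 0" for m using pos[of m] r01 c by (simp add: t_def)
  obtain P :: complex where P: "P \<noteq> 0" "(\<lambda>n. inv_qpoch (of_real r) (int n)) \<longlonglongrightarrow> P"
    using inv_qpoch_LIMSEQ[of "of_real r"] r01 by auto
  define X where "X = Re P"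
  have X: "(\<lambda>n. inv_qpoch r (int n)) \<longlonglongrightarrow> X"
    using tendsto_Re[OF P(2)] by (simp add: X_def inv_qpoch_of_real)
  have "P = of_real X"
    using LIMSEQ_unique[OF P(2)] tendsto_of_real[OF X, where 'a = complex] by (simp add: inv_qpoch_of_real)
  moreover have "X \<ge> 0" using pos by (intro LIMSEQ_le_const[OF X]) (auto intro: less_imp_le)
  ultimately have X0: "X > 0" using P(1) by auto
  have Xs: "(\<lambda>N. inv_qpoch r (int N - int m)) \<longlonglongrightarrow> X" for m
    using LIMSEQ_offset[of "\<lambda>N. inv_qpoch r (int N - int m)" m X] X by simp
  \<comment> \<open>The quadratic term has a minus sign and needs a lower bound, whereas partial
    sums lie below their limit; so \<open>s2\<close> is carried along and estimated only after
    \<open>N\<close> has tended to infinity.\<close>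
  define s2 where "s2 N = (\<Sum>i=1..N. exp (- (2 * \<alpha>)) ^ i)" for N
  have prod: "(\<Prod>i=1..N. 1 + c * r ^ i) \<le> exp (c / \<alpha> + c ^ 3 / (9 * \<alpha>) - c\<^sup>2 / 2 * s2 N)" for N
  proof -
    have "(\<Prod>i=1..N. 1 + c * r ^ i) \<le> (\<Prod>i=1..N. exp (c * r ^ i - (c * r ^ i)\<^sup>2 / 2 + (c * r ^ i) ^ 3 / 3))"
      using c r01 by (intro prod_mono conjI one_plus_le_exp_cubic) auto
    also have "\<dots> = exp (\<Sum>i=1..N. c * r ^ i - (c * r ^ i)\<^sup>2 / 2 + (c * r ^ i) ^ 3 / 3)"
      by (simp add: exp_sum)
    also have "(\<Sum>i=1..N. c * r ^ i - (c * r ^ i)\<^sup>2 / 2 + (c * r ^ i) ^ 3 / 3)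
      = c * (\<Sum>i=1..N. exp (- \<alpha>) ^ i) - c\<^sup>2 / 2 * s2 N + c ^ 3 / 3 * (\<Sum>i=1..N. exp (- (3 * \<alpha>)) ^ i)"
    proof -
      have "exp (- (2 * \<alpha>)) ^ i = (r ^ i)\<^sup>2" "exp (- (3 * \<alpha>)) ^ i = (r ^ i) ^ 3" for i
        unfolding r by (simp_all flip: exp_of_nat_mult)
      then show ?thesis unfolding s2_def
        by (simp add: sum.distrib sum_subtractf sum_distrib_left power_mult_distrib r)
    qed
    also have "\<dots> \<le> c * (1 / \<alpha>) - c\<^sup>2 / 2 * s2 N + c ^ 3 / 3 * (1 / (3 * \<alpha>))"
      using \<alpha> c by (intro add_mono diff_right_mono mult_left_mono exp_geometric_bounds) auto
    finally show ?thesis by (simp add: algebra_simps)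
  qed
  have fin: "(\<Sum>m\<le>L. t m * inv_qpoch r (int N - int m))
      \<le> inv_qpoch r (int N) * exp (c / \<alpha> + c ^ 3 / (9 * \<alpha>) - c\<^sup>2 / 2 * s2 N)" if N: "L \<le> N" for N
  proof -
    have "(\<Sum>m\<le>L. t m * inv_qpoch r (int N - int m)) \<le> (\<Sum>m\<le>N. t m * inv_qpoch r (int N - int m))"
    proof (rule sum_mono2)
      fix m assume "m \<in> {..N} - {..L}"
      then have "int N - int m = int (N - m)" by auto
      then show "0 \<le> t m * inv_qpoch r (int N - int m)" 
        by (simp only:) (intro mult_nonneg_nonneg t0 less_imp_le[OF pos])
    qed (use N in auto)
    also have "\<dots> = inv_qpoch r (int N) * (\<Prod>i=1..N. 1 + c * r ^ i)"
      unfolding t_def by (rule q_binomial_finite[OF r01(3,4)])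
    also have "\<dots> \<le> inv_qpoch r (int N) * exp (c / \<alpha> + c ^ 3 / (9 * \<alpha>) - c\<^sup>2 / 2 * s2 N)"
      using pos[of N] by (intro mult_left_mono prod) auto
    finally show ?thesis .
  qed
  define S where "S = exp (- (2 * \<alpha>)) / (1 - exp (- (2 * \<alpha>)))"
  have s2: "s2 \<longlonglongrightarrow> S" unfolding s2_def S_def using \<alpha> by (intro exp_geometric_bounds) simp
  have "(\<Sum>m\<le>L. t m * X) \<le> X * exp (c / \<alpha> + c ^ 3 / (9 * \<alpha>) - c\<^sup>2 / 2 * S)"
  proof (rule LIMSEQ_le)
    show "(\<lambda>N. \<Sum>m\<le>L. t m * inv_qpoch r (int N - int m)) \<longlonglongrightarrow> (\<Sum>m\<le>L. t m * X)"
      by (intro tendsto_intros Xs)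
    show "(\<lambda>N. inv_qpoch r (int N) * exp (c / \<alpha> + c ^ 3 / (9 * \<alpha>) - c\<^sup>2 / 2 * s2 N))
      \<longlonglongrightarrow> X * exp (c / \<alpha> + c ^ 3 / (9 * \<alpha>) - c\<^sup>2 / 2 * S)"
      by (intro tendsto_intros X s2)
  qed (use fin in blast)
  then have "X * (\<Sum>m\<le>L. t m) \<le> X * exp (c / \<alpha> + c ^ 3 / (9 * \<alpha>) - c\<^sup>2 / 2 * S)"
    by (simp add: sum_distrib_left mult.commute)
  then have "(\<Sum>m\<le>L. t m) \<le> exp (c / \<alpha> + c ^ 3 / (9 * \<alpha>) - c\<^sup>2 / 2 * S)"
    using X0 by simp
  also have "\<dots> \<le> exp ((c - c\<^sup>2 / 4 + c ^ 3 / 9) / \<alpha> + c\<^sup>2 / 2)"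
  proof -
    have "1 / (2 * \<alpha>) - 1 \<le> S" unfolding S_def using \<alpha> by (intro exp_geometric_bounds) simp
    from mult_left_mono[OF this, of "c\<^sup>2 / 2"]
    have "c\<^sup>2 / 2 * (1 / (2 * \<alpha>) - 1) \<le> c\<^sup>2 / 2 * S" by simp
    moreover have "c / \<alpha> + c ^ 3 / (9 * \<alpha>) - c\<^sup>2 / 2 * (1 / (2 * \<alpha>) - 1) = (c - c\<^sup>2 / 4 + c ^ 3 / 9) / \<alpha> + c\<^sup>2 / 2"
      using \<alpha> by (simp add: field_simps)
    ultimately show ?thesis unfolding exp_le_cancel_iff by linarith
  qed
  finally show ?thesis unfolding t_def .
qed

lemma exp_neg_le_quadratic:
  assumes "0 \<le> (y::real)"
  shows "exp (- y) \<le> 1 - y + y\<^sup>2 / 2"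
proof -
  have p: "1 + y + y\<^sup>2 / 2 > 0" using assms by (simp add: add_pos_nonneg)
  have "1 / exp y \<le> 1 / (1 + y + y\<^sup>2 / 2)"
    using exp_lower_Taylor_quadratic[OF assms] p by (intro divide_left_mono mult_pos_pos) auto
  also have "\<dots> \<le> 1 - y + y\<^sup>2 / 2"
  proof -
    have "(1 - y + y\<^sup>2 / 2) * (1 + y + y\<^sup>2 / 2) = 1 + (y\<^sup>2)\<^sup>2 / 4" by (simp add: power2_eq_square algebra_simps)
    then have "1 \<le> (1 - y + y\<^sup>2 / 2) * (1 + y + y\<^sup>2 / 2)" by simp
    then show ?thesis using p by (simp add: pos_divide_le_eq)
  qed
  finally show ?thesis by (simp add: exp_minus inverse_eq_divide)
qed

text \<open>Saddle point bound: for \<open>r ^ m \<le> 3/5\<close> the weight \<open>exp (r ^ m / \<alpha>)\<close> is replaced by its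
  maximum, otherwise by \<open>2 ^ -m * exp (1 / \<alpha>)\<close>; the two exponents \<open>31/36 + 3/5\<close> and
  \<open>65/144 + 1\<close> are both below \<open>pi\<^sup>2 / 4 - 1\<close>.\<close>

lemma weighted_euler_partial_sum_le:
  fixes \<alpha> r :: real
  assumes \<alpha>: "\<alpha> > 0" and r: "r = exp (- \<alpha>)"
  shows "(\<Sum>m\<le>L. r ^ (m * (m + 1) div 2) * inv_qpoch r (int m) * exp (r ^ m / \<alpha>))
    \<le> 2 * exp (1 / 2) * exp ((pi\<^sup>2 / 4 - 1) / \<alpha>)"
proof -
  define T where "T m = r ^ (m * (m + 1) div 2) * inv_qpoch r (int m)" for m
  have r01: "0 < r" "r < 1" using \<alpha> by (simp_all add: r)
  have T0: "T m \<ge> 0" for m using inv_qpoch_real_pos[OF r01, of m] r01 by (simp add: T_def)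
  have pt: "T m * exp (r ^ m / \<alpha>) \<le> exp (3 / 5 / \<alpha>) * (T m * 1 ^ m) + exp (1 / \<alpha>) * (T m * (1 / 2) ^ m)" for m
  proof (cases "r ^ m \<le> 3 / 5")
    case True
    then have "exp (r ^ m / \<alpha>) \<le> exp (3 / 5 / \<alpha>)" using \<alpha> by (simp only: exp_le_cancel_iff divide_right_mono less_imp_le)
    from mult_left_mono[OF this T0[of m]] T0[of m] show ?thesis
      by (simp add: mult.commute add_increasing2)
  next
    case False
    define y where "y = real m * \<alpha>"
    have y0: "y \<ge> 0" using \<alpha> by (simp add: y_def)
    have ry: "r ^ m = exp (- y)" unfolding r y_def by (simp flip: exp_of_nat_mult)
    \<comment> \<open>\<open>exp (-3/5) \<le> 1 - 0.6 + 0.18 = 0.58\<close>, so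
      \<open>r^m > 3/5\<close> forces \<open>m * \<alpha> \<le> 3/5\<close>.\<close>
    have "y \<le> 3 / 5"
    proof (rule ccontr)
      assume "\<not> y \<le> 3 / 5"
      then have "exp (- y) \<le> exp (- (3 / 5))" by simp
      also have "\<dots> \<le> 1 - 3 / 5 + (3 / 5)\<^sup>2 / 2" by (rule exp_neg_le_quadratic) simp
      also have "\<dots> \<le> 3 / 5" by (simp add: power2_eq_square)
      finally show False using False ry by simp
    qed
    \<comment> \<open>\<open>ln 2 \<le> 25/36 < 7/10 \<le> 1 - y/2\<close>; hence \<open>2^m\<close>
      times the weight stays below \<open>exp (1 / \<alpha>)\<close>, the weight at
      \<open>m = 0\<close>.\<close>
    have "ln 2 * y \<le> 7 / 10 * y" using ln2_le_25_over_36 y0 by (intro mult_right_mono) auto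
    also have "\<dots> \<le> (1 - y / 2) * y" using \<open>y \<le> 3 / 5\<close> y0 by (intro mult_right_mono) auto
    also have "\<dots> \<le> 1 - r ^ m" using exp_neg_le_quadratic[OF y0] unfolding ry by (simp add: power2_eq_square algebra_simps)
    finally have "ln 2 * y / \<alpha> \<le> (1 - r ^ m) / \<alpha>" using \<alpha> by (intro divide_right_mono) auto
    then have "real m * ln 2 + r ^ m / \<alpha> \<le> 1 / \<alpha>" using \<alpha> by (simp add: y_def diff_divide_distrib mult.commute)
    then have "exp (real m * ln 2 + r ^ m / \<alpha>) \<le> exp (1 / \<alpha>)" by (simp only: exp_le_cancel_iff)
    then have "2 ^ m * exp (r ^ m / \<alpha>) \<le> exp (1 / \<alpha>)" by (simp add: exp_add exp_of_nat_mult)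
    then have "exp (r ^ m / \<alpha>) \<le> exp (1 / \<alpha>) * (1 / 2) ^ m" by (simp add: field_simps)
    from mult_left_mono[OF this T0[of m]] T0[of m] show ?thesis
      by (simp add: mult_ac add_increasing)
  qed
  have "(\<Sum>m\<le>L. T m * exp (r ^ m / \<alpha>)) \<le> exp (3 / 5 / \<alpha>) * (\<Sum>m\<le>L. T m * 1 ^ m) + exp (1 / \<alpha>) * (\<Sum>m\<le>L. T m * (1 / 2) ^ m)"
    unfolding sum_distrib_left sum.distrib[symmetric] by (intro sum_mono pt)
  also have "\<dots> \<le> exp (3 / 5 / \<alpha>) * exp ((1 - 1\<^sup>2 / 4 + 1 ^ 3 / 9) / \<alpha> + 1\<^sup>2 / 2)
      + exp (1 / \<alpha>) * exp ((1 / 2 - (1 / 2)\<^sup>2 / 4 + (1 / 2) ^ 3 / 9) / \<alpha> + (1 / 2)\<^sup>2 / 2)"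
  proof (intro add_mono mult_left_mono)
    show "(\<Sum>m\<le>L. T m * 1 ^ m) \<le> exp ((1 - 1\<^sup>2 / 4 + 1 ^ 3 / 9) / \<alpha> + 1\<^sup>2 / 2)"
      using euler_partial_sum_le[OF \<alpha> _ r, of 1 L] by (simp add: T_def mult_ac)
    show "(\<Sum>m\<le>L. T m * (1 / 2) ^ m) \<le> exp ((1 / 2 - (1 / 2)\<^sup>2 / 4 + (1 / 2) ^ 3 / 9) / \<alpha> + (1 / 2)\<^sup>2 / 2)"
      using euler_partial_sum_le[OF \<alpha> _ r, of "1 / 2" L] by (simp add: T_def mult_ac)
  qed auto
  also have "\<dots> \<le> exp ((pi\<^sup>2 / 4 - 1) / \<alpha> + 1 / 2) + exp ((pi\<^sup>2 / 4 - 1) / \<alpha> + 1 / 2)"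
  proof -
    \<comment> \<open>The margin is narrow: 1.464 against 31/36 + 3/5 = 1.4611... and 65/144 + 1 =
      1.4513... A first-order bound for the product would give 1 + 3/5 in the first case, too
      much.\<close>
    have "(3.14::real)\<^sup>2 \<le> pi\<^sup>2" using pi_approx by (intro power_mono) auto
    then have pi2: "1.464 \<le> pi\<^sup>2 / 4 - 1" by (simp add: power2_eq_square)
    have "3 / 5 / \<alpha> + ((1 - 1\<^sup>2 / 4 + 1 ^ 3 / 9) / \<alpha> + 1\<^sup>2 / 2) = (3 / 5 + 31 / 36) / \<alpha> + 1 / 2"
      using \<alpha> by (simp add: field_simps)
    also have "\<dots> \<le> (pi\<^sup>2 / 4 - 1) / \<alpha> + 1 / 2"
      using pi2 \<alpha> by (intro add_mono divide_right_mono) auto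
    finally have 1: "3 / 5 / \<alpha> + ((1 - 1\<^sup>2 / 4 + 1 ^ 3 / 9) / \<alpha> + 1\<^sup>2 / 2) \<le> (pi\<^sup>2 / 4 - 1) / \<alpha> + 1 / 2" .
    have "1 / \<alpha> + ((1 / 2 - (1 / 2)\<^sup>2 / 4 + (1 / 2) ^ 3 / 9) / \<alpha> + (1 / 2)\<^sup>2 / 2) = (1 + 65 / 144) / \<alpha> + 1 / 8"
      using \<alpha> by (simp add: field_simps power2_eq_square power3_eq_cube)
    also have "\<dots> \<le> (pi\<^sup>2 / 4 - 1) / \<alpha> + 1 / 2"
      using pi2 \<alpha> by (intro add_mono divide_right_mono) auto
    finally have 2: "1 / \<alpha> + ((1 / 2 - (1 / 2)\<^sup>2 / 4 + (1 / 2) ^ 3 / 9) / \<alpha> + (1 / 2)\<^sup>2 / 2) \<le> (pi\<^sup>2 / 4 - 1) / \<alpha> + 1 / 2" .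
    show ?thesis unfolding exp_add[symmetric] using 1 2 by (intro add_mono) (simp_all only: exp_le_cancel_iff)
  qed
  also have "\<dots> = 2 * exp (1 / 2) * exp ((pi\<^sup>2 / 4 - 1) / \<alpha>)" by (simp add: exp_add)
  finally show ?thesis unfolding T_def by (simp add: mult_ac)
qed

text \<open>With \<open>r = norm q\<close>,
  \<open>norm (1 - q) ^ 2 = (1 - r)^2 + 4 * r * sin (pi*x) ^ 2\<close>, where
  \<open>1 - r \<ge> \<alpha> * r\<close> and the sine is smallest at the edge
  \<open>abs x = M * y\<close>. The correction is of relative order \<open>\<alpha>^2\<close>, hence
  still bounded after division by \<open>\<alpha>\<close>.\<close>

lemma norm_one_minus_nome_ge:
  fixes M x y :: real
  defines "\<alpha> \<equiv> 2 * pi * y"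
  assumes M: "M > 0" and y: "y > 0" and x: "M * y < \<bar>x\<bar>" "\<bar>x\<bar> \<le> 1 / 2" and small: "\<alpha> * M \<le> 1"
  shows "exp (- \<alpha>) / norm (1 - nome (Complex x y)) \<le> (1 + (\<alpha> * M)\<^sup>2 / 12) / (\<alpha> * sqrt (1 + M\<^sup>2))"
proof -
  define q where "q = nome (Complex x y)"
  define r where "r = exp (- \<alpha>)"
  \<comment> \<open>\<open>t = pi * M * y\<close> is the angle at the edge, and
    \<open>t * d = t - t^3/6\<close> the Taylor lower bound for its sine.\<close>
  define t where "t = \<alpha> * M / 2"
  define d where "d = 1 - t\<^sup>2 / 6"
  have \<alpha>: "\<alpha> > 0" using y by (simp add: \<alpha>_def)
  have r: "0 < r" "r < 1" using \<alpha> by (simp_all add: r_def)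
  have t: "0 < t" "t \<le> 1 / 2" using \<alpha> M small by (simp_all add: t_def)
  have t2: "t\<^sup>2 \<le> 1" using t by (intro power_le_one) auto
  then have d: "5 / 6 \<le> d" "d \<le> 1" by (simp_all add: d_def)
  have qp: "q = of_real r * cis (2 * pi * x)"
  proof -
    have "2 * of_real pi * \<i> * Complex x y = of_real (- \<alpha>) + \<i> * of_real (2 * pi * x)"
      by (simp add: complex_eq_iff \<alpha>_def)
    then show ?thesis unfolding q_def nome_def r_def by (simp only: exp_add exp_of_real cis_conv_exp)
  qed
  have n2: "(norm (1 - q))\<^sup>2 = (1 - r)\<^sup>2 + 4 * r * (sin (pi * x))\<^sup>2"
  proof -
    have c: "cos (2 * (pi * x)) = 1 - 2 * (sin (pi * x))\<^sup>2" by (simp add: cos_double_sin)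
    have square_expand: "(1 - r * a)\<^sup>2 + (r * b)\<^sup>2 = 1 - 2 * r * a + r\<^sup>2 * (a\<^sup>2 + b\<^sup>2)" for a b
      by (simp add: power2_eq_square algebra_simps)
    have "(norm (1 - q))\<^sup>2 = (1 - r * cos (2 * (pi * x)))\<^sup>2 + (r * sin (2 * (pi * x)))\<^sup>2"
      unfolding cmod_power2 qp by (simp add: mult.assoc)
    also have "\<dots> = 1 - 2 * r * cos (2 * (pi * x)) + r\<^sup>2 * ((cos (2 * (pi * x)))\<^sup>2 + (sin (2 * (pi * x)))\<^sup>2)"
      by (rule square_expand)
    also have "\<dots> = 1 - 2 * r * (1 - 2 * (sin (pi * x))\<^sup>2) + r\<^sup>2" by (subst sin_cos_squared_add2) (simp add: c)
    finally show ?thesis by (simp add: power2_eq_square algebra_simps)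
  qed
  have sn: "t * d \<le> \<bar>sin (pi * x)\<bar>"
  proof -
    have "(\<Sum>m<3. sin_coeff m * t ^ m) = t"
      by (simp add: sin_coeff_def eval_nat_numeral)
    moreover have "inverse (fact 3) = (1 / 6 :: real)" by (simp add: eval_nat_numeral)
    moreover have "\<bar>t\<bar> = t" using t by simp
    ultimately have "\<bar>sin t - t\<bar> \<le> 1 / 6 * t ^ 3" using Maclaurin_sin_bound[of t 3] by (simp only:)
    then have "t - 1 / 6 * t ^ 3 \<le> sin t" by linarith
    moreover have "t * d = t - 1 / 6 * t ^ 3" by (simp add: d_def power2_eq_square power3_eq_cube algebra_simps)
    ultimately have "t * d \<le> sin t" by simp
    also have "sin t \<le> sin (pi * \<bar>x\<bar>)"
    proof (rule sin_monotone_2pi_le)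
      show "t \<le> pi * \<bar>x\<bar>" using mult_left_mono[OF less_imp_le[OF x(1)], of pi] by (simp add: t_def \<alpha>_def mult_ac)
      show "pi * \<bar>x\<bar> \<le> pi / 2" using mult_left_mono[OF x(2), of pi] by simp
      show "- (pi / 2) \<le> t" using t pi_gt_zero by linarith
    qed
    also have "sin (pi * \<bar>x\<bar>) \<le> \<bar>sin (pi * x)\<bar>" 
    proof (cases "x \<ge> 0")
      case False
      then have "sin (pi * \<bar>x\<bar>) = - sin (pi * x)" by simp
      then show ?thesis by linarith
    qed simp
    finally show ?thesis .
  qed
  have "(\<alpha> * r)\<^sup>2 \<le> (1 - r)\<^sup>2"
  proof (rule power_mono)
    have "\<alpha> \<le> exp \<alpha> - 1" using exp_ge_add_one_self[of \<alpha>] by linarith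
    then have "\<alpha> * r \<le> (exp \<alpha> - 1) * r" using r by (intro mult_right_mono) auto
    also have "\<dots> = 1 - r" by (simp add: r_def exp_minus algebra_simps)
    finally show "\<alpha> * r \<le> 1 - r" .
  qed (use \<alpha> r in auto)
  moreover have "(2 * r * (t * d))\<^sup>2 \<le> 4 * r * (sin (pi * x))\<^sup>2"
  proof -
    have "(t * d)\<^sup>2 \<le> (sin (pi * x))\<^sup>2" using power_mono[OF sn, of 2] t d by simp
    then have "4 * r\<^sup>2 * (t * d)\<^sup>2 \<le> 4 * r * (sin (pi * x))\<^sup>2"
      using r by (intro mult_mono) (auto simp: power2_eq_square)
    then show ?thesis by (simp add: power_mult_distrib)
  qed
  ultimately have "(\<alpha> * r)\<^sup>2 + (2 * r * (t * d))\<^sup>2 \<le> (norm (1 - q))\<^sup>2" unfolding n2 by linarith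
  moreover have "(\<alpha> * r * sqrt (1 + M\<^sup>2) * d)\<^sup>2 \<le> (\<alpha> * r)\<^sup>2 + (2 * r * (t * d))\<^sup>2"
  proof -
    have "d\<^sup>2 \<le> 1" using d by (intro power_le_one) auto
    then have "(\<alpha> * r)\<^sup>2 * d\<^sup>2 \<le> (\<alpha> * r)\<^sup>2 * 1" by (intro mult_left_mono) auto
    moreover have "(\<alpha> * r * sqrt (1 + M\<^sup>2) * d)\<^sup>2 = (\<alpha> * r)\<^sup>2 * d\<^sup>2 + (\<alpha> * r)\<^sup>2 * M\<^sup>2 * d\<^sup>2"
      by (simp add: power_mult_distrib algebra_simps)
    moreover have "(2 * r * (t * d))\<^sup>2 = (\<alpha> * r)\<^sup>2 * M\<^sup>2 * d\<^sup>2"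
      by (simp add: t_def power_mult_distrib mult_ac)
    ultimately show ?thesis by linarith
  qed
  ultimately have "(\<alpha> * r * sqrt (1 + M\<^sup>2) * d)\<^sup>2 \<le> (norm (1 - q))\<^sup>2" by linarith
  then have lower: "\<alpha> * r * sqrt (1 + M\<^sup>2) * d \<le> norm (1 - q)" by (rule power2_le_imp_le) simp
  have s1: "sqrt (1 + M\<^sup>2) > 0" by (simp add: add_pos_nonneg)
  have "r / norm (1 - q) \<le> r / (\<alpha> * r * sqrt (1 + M\<^sup>2) * d)"
    using lower \<alpha> r s1 d by (intro frac_le mult_pos_pos) auto
  also have "\<dots> = (1 / d) / (\<alpha> * sqrt (1 + M\<^sup>2))" using r by simp
  also have "\<dots> \<le> (1 + t\<^sup>2 / 3) / (\<alpha> * sqrt (1 + M\<^sup>2))"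
  proof (rule divide_right_mono)
    have "1 \<le> (1 + t\<^sup>2 / 3) * d"
    proof -
      have "(1 + t\<^sup>2 / 3) * d = 1 + t\<^sup>2 * (1 / 6 - t\<^sup>2 / 18)" by (simp add: d_def algebra_simps)
      moreover have "t\<^sup>2 * (1 / 6 - t\<^sup>2 / 18) \<ge> 0" using t2 by (intro mult_nonneg_nonneg) auto
      ultimately show ?thesis by linarith
    qed
    then show "1 / d \<le> 1 + t\<^sup>2 / 3" using d by (simp add: pos_divide_le_eq)
  qed (use \<alpha> s1 in auto)
  also have "1 + t\<^sup>2 / 3 = 1 + (\<alpha> * M)\<^sup>2 / 12" by (simp add: t_def power_divide)
  finally show ?thesis unfolding r_def q_def .
qed

text \<open>The bound beats the trivial one because \<open>\<Sum> j. q ^ j\<close> has modulus about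
  \<open>1 / (\<alpha> * sqrt (1 + M\<^sup>2))\<close> instead of \<open>1 / \<alpha>\<close>, which is the first term of the
  expansion of \<open>- ln (q; q)\<close>.\<close>

lemma odd_even_gf_minor_arc:
  fixes M x y :: real
  defines "\<alpha> \<equiv> 2 * pi * y"
  assumes M: "M > 0" and y: "y > 0" and x: "M * y < \<bar>x\<bar>" "\<bar>x\<bar> \<le> 1 / 2" and small: "\<alpha> * M \<le> 1" "\<alpha> \<le> 1"
  shows "norm (odd_even_gf (nome (Complex x y)))
     \<le> 8 * exp (M + 2) / \<alpha> * exp ((pi\<^sup>2 / 4 - 2 + 2 / sqrt (1 + M\<^sup>2)) / \<alpha>)"
proof -
  define q where "q = nome (Complex x y)"
  define r where "r = exp (- \<alpha>)"
  define \<kappa> where "\<kappa> = r / norm (1 - q)"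
  define S where "S = sqrt (1 + M\<^sup>2)"
  have \<alpha>: "\<alpha> > 0" using y by (simp add: \<alpha>_def)
  have r: "0 < r" "r < 1" using \<alpha> by (simp_all add: r_def)
  have qr: "norm q = r" by (simp add: q_def nome_def r_def \<alpha>_def)
  have q1: "norm q < 1" "q \<noteq> 0" using qr r by (auto simp: q_def nome_def)
  have S1: "S \<ge> 1" by (simp add: S_def)
  have \<kappa>: "\<kappa> \<le> 1 / (\<alpha> * S) + M / 12"
  proof -
    have "\<kappa> \<le> (1 + (\<alpha> * M)\<^sup>2 / 12) / (\<alpha> * S)"
      unfolding \<kappa>_def r_def q_def S_def \<alpha>_def using small(1) unfolding \<alpha>_def
      by (intro norm_one_minus_nome_ge M y x)
    also have "\<dots> = 1 / (\<alpha> * S) + (\<alpha> * M) * (M / 12) / S"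
      using \<alpha> S1 by (simp add: field_simps power2_eq_square)
    also have "(\<alpha> * M) * (M / 12) / S \<le> 1 * (M / 12) / 1"
      using small(1) M S1 \<alpha> by (intro frac_le mult_right_mono) auto
    finally show ?thesis by simp
  qed
  have r1: "1 / (1 - r) \<le> 2 / \<alpha>"
  proof -
    have "r \<le> 1 - \<alpha> + \<alpha>\<^sup>2 / 2" unfolding r_def using \<alpha> by (intro exp_neg_le_quadratic) simp
    moreover have "\<alpha>\<^sup>2 \<le> \<alpha>" using \<alpha> small(2) by (simp add: power2_eq_square)
    ultimately have "\<alpha> / 2 \<le> 1 - r" by linarith
    then have "1 / (1 - r) \<le> 1 / (\<alpha> / 2)" using \<alpha> by (intro divide_left_mono) auto
    then show ?thesis by simp
  qed
  define b where "b m = 2 * q ^ (m * (m + 1) div 2) * inv_qpoch q (int m) / (1 + q ^ m)" for m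
  \<comment> \<open>The leading 2 times \<open>1 / norm (1 + q^m) \<le> 2 / \<alpha>\<close>, and
    the part of the exponent that does not depend on \<open>m\<close>.\<close>
  define K where "K = 4 / \<alpha> * exp (2 * \<kappa> - 1 / \<alpha> + 1)"
  have nb: "norm (b m) \<le> K * (r ^ (m * (m + 1) div 2) * inv_qpoch r (int m) * exp (r ^ m / \<alpha>))" for m
  proof -
    have nz: "1 - q \<noteq> 0" using q1 by auto
    \<comment> \<open>The sum is \<open>q * (1 - q^m) / (1 - q)\<close>; bounding
      \<open>norm (1 - q^m)\<close> by 2 is the source of the 2 before
      \<open>\<kappa>\<close>.\<close>
    have "Re (\<Sum>j=1..m. q ^ j) \<le> norm (\<Sum>j=1..m. q ^ j)" by (rule complex_Re_le_cmod)
    also have "\<dots> = \<kappa> * norm (1 - q ^ m)" unfolding geometric_sum_from_1[OF nz] by (simp add: norm_mult norm_divide \<kappa>_def qr)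
    also have "\<dots> \<le> \<kappa> * 2"
    proof (rule mult_left_mono)
      have "norm (1 - q ^ m) \<le> 1 + r ^ m" using norm_triangle_ineq4[of 1 "q ^ m"] by (simp add: norm_power qr)
      also have "\<dots> \<le> 2" using r power_le_one[of r m] by simp
      finally show "norm (1 - q ^ m) \<le> 2" .
    qed (use r in \<open>simp add: \<kappa>_def\<close>)
    finally have e1: "Re (\<Sum>j=1..m. q ^ j) \<le> 2 * \<kappa>" by simp
    \<comment> \<open>The deficit \<open>r^m / \<alpha>\<close> against the full size
      \<open>1 / \<alpha>\<close> is the weight that the Euler sum has to carry.\<close>
    have e2: "(1 - r ^ m) / \<alpha> - 1 \<le> (\<Sum>j=1..m. r ^ j)"
    proof -
      have "(1 - r ^ m) * (1 / \<alpha> - 1) \<le> (1 - r ^ m) * (r / (1 - r))"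
        using exp_geometric_bounds(3)[OF \<alpha>] r power_le_one[of r m] unfolding r_def[symmetric] by (intro mult_left_mono) auto
      also have "\<dots> = (\<Sum>j=1..m. r ^ j)" using geometric_sum_from_1[of r m] r by simp
      finally have "(1 - r ^ m) * (1 / \<alpha> - 1) \<le> (\<Sum>j=1..m. r ^ j)" .
      moreover have "(1 - r ^ m) * (1 / \<alpha> - 1) = (1 - r ^ m) / \<alpha> - (1 - r ^ m)" by (simp add: right_diff_distrib)
      moreover have "0 \<le> r ^ m" using r by simp
      ultimately show ?thesis by linarith
    qed
    have "Re (\<Sum>j=1..m. q ^ j) - (\<Sum>j=1..m. r ^ j) \<le> (2 * \<kappa> - 1 / \<alpha> + 1) + r ^ m / \<alpha>"
      using e1 e2 by (simp add: diff_divide_distrib)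
    then have ex: "exp (Re (\<Sum>j=1..m. q ^ j) - (\<Sum>j=1..m. r ^ j)) \<le> exp (2 * \<kappa> - 1 / \<alpha> + 1) * exp (r ^ m / \<alpha>)"
      unfolding exp_add[symmetric] by (simp only: exp_le_cancel_iff)
    have iq: "norm (inv_qpoch q (int m)) \<le> inv_qpoch r (int m) * (exp (2 * \<kappa> - 1 / \<alpha> + 1) * exp (r ^ m / \<alpha>))"
      using norm_inv_qpoch_le[OF q1, of m, unfolded qr] mult_left_mono[OF ex, of "inv_qpoch r (int m)"]
        inv_qpoch_real_pos[OF r, of m] by linarith
    have "norm (b m) = 2 * r ^ (m * (m + 1) div 2) * norm (inv_qpoch q (int m)) * (1 / norm (1 + q ^ m))"
      by (simp add: b_def norm_mult norm_divide norm_power qr)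
    also have "\<dots> \<le> 2 * r ^ (m * (m + 1) div 2) * (inv_qpoch r (int m) * (exp (2 * \<kappa> - 1 / \<alpha> + 1) * exp (r ^ m / \<alpha>))) * (2 / \<alpha>)"
    proof (intro mult_mono mult_left_mono iq)
      have "1 / norm (1 + q ^ m) \<le> 1 / (1 - r)"
        using one_plus_pow_lower[OF q1, of m] r unfolding qr by (intro frac_le) auto
      then show "1 / norm (1 + q ^ m) \<le> 2 / \<alpha>" using r1 by linarith
    qed (use r inv_qpoch_real_pos[OF r, of m] in auto)
    finally show ?thesis by (simp add: K_def mult_ac)
  qed
  have K0: "K > 0" using \<alpha> by (simp add: K_def)
  have part: "norm (\<Sum>m<n. b m) \<le> K * (2 * exp (1 / 2) * exp ((pi\<^sup>2 / 4 - 1) / \<alpha>))" for n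
  proof -
    have "norm (\<Sum>m<n. b m) \<le> (\<Sum>m<n. norm (b m))" by (rule norm_sum)
    also have "\<dots> \<le> (\<Sum>m\<le>n. norm (b m))" by (intro sum_mono2) auto
    also have "\<dots> \<le> (\<Sum>m\<le>n. K * (r ^ (m * (m + 1) div 2) * inv_qpoch r (int m) * exp (r ^ m / \<alpha>)))"
      by (intro sum_mono nb)
    also have "\<dots> = K * (\<Sum>m\<le>n. r ^ (m * (m + 1) div 2) * inv_qpoch r (int m) * exp (r ^ m / \<alpha>))"
      by (rule sum_distrib_left[symmetric])
    also have "\<dots> \<le> K * (2 * exp (1 / 2) * exp ((pi\<^sup>2 / 4 - 1) / \<alpha>))"
      using K0 by (intro mult_left_mono weighted_euler_partial_sum_le \<alpha> r_def) auto
    finally show ?thesis .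
  qed
  have "(\<lambda>n. \<Sum>m<n. b m) \<longlonglongrightarrow> odd_even_gf q"
    using odd_even_gf_sums[OF q1] unfolding b_def[symmetric] sums_def .
  from tendsto_norm[OF this] have "norm (odd_even_gf q) \<le> K * (2 * exp (1 / 2) * exp ((pi\<^sup>2 / 4 - 1) / \<alpha>))"
    using part by (intro LIMSEQ_le_const2) auto
  also have "\<dots> = 8 / \<alpha> * exp ((2 * \<kappa> - 1 / \<alpha> + 1) + 1 / 2 + (pi\<^sup>2 / 4 - 1) / \<alpha>)"
  proof -
    have "4 / \<alpha> * exp a * (2 * exp (1 / 2) * exp b) = 8 / \<alpha> * exp (a + 1 / 2 + b)" for a b
      by (simp only: exp_add)
    then show ?thesis unfolding K_def .
  qed
  also have "\<dots> \<le> 8 / \<alpha> * exp ((M + 2) + (pi\<^sup>2 / 4 - 2 + 2 / S) / \<alpha>)"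
  proof -
    \<comment> \<open>\<open>2 * \<kappa>\<close> contributes
      \<open>2 / (\<alpha> * S) + M / 6\<close>; the constants \<open>M / 6 + 3/2\<close> are
      absorbed by \<open>M + 2\<close>.\<close>
    have "(2 * \<kappa> - 1 / \<alpha> + 1) + 1 / 2 + (pi\<^sup>2 / 4 - 1) / \<alpha> \<le> (M + 2) + (pi\<^sup>2 / 4 - 2 + 2 / S) / \<alpha>"
    proof -
      have "2 / S / \<alpha> = 2 * (1 / (\<alpha> * S))" by simp
      then have "2 * \<kappa> \<le> 2 / S / \<alpha> + M" using \<kappa> M by linarith
      moreover have "(pi\<^sup>2 / 4 - 2 + 2 / S) / \<alpha> = (pi\<^sup>2 / 4 - 1) / \<alpha> - 1 / \<alpha> + 2 / S / \<alpha>"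
        by (simp add: add_divide_distrib diff_divide_distrib)
      ultimately show ?thesis by linarith
    qed
    then show ?thesis using \<alpha> by (intro mult_left_mono) auto
  qed
  also have "\<dots> = 8 * exp (M + 2) / \<alpha> * exp ((pi\<^sup>2 / 4 - 2 + 2 / S) / \<alpha>)"
    unfolding exp_add[of "M + 2"] by simp
  finally show ?thesis unfolding q_def S_def .
qed

section \<open>The asymptotic formulae\<close>

lemma nome_altdef: "nome \<tau> = exp (- (- (2 * of_real pi * \<i> * \<tau>)))"
  by (simp add: nome_def)

lemma exp_cusp_eq:
  assumes "\<tau> \<noteq> 0"
  shows "exp (of_real pi ^ 2 / (12 * (- (2 * of_real pi * \<i> * \<tau>)))) = exp (of_real pi * \<i> / (24 * \<tau>))"
proof -
  have "of_real pi ^ 2 / (12 * (- (2 * of_real pi * \<i> * \<tau>))) = of_real pi * \<i> / (24 * \<tau>)"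
    using assms by (simp add: field_simps power2_eq_square)
  then show ?thesis by simp
qed

lemma norm_exp_cusp:
  "norm (exp (of_real pi * \<i> / (24 * \<tau>))) = exp (pi / 24 * Im (- 1 / \<tau>))"
proof -
  have "of_real pi * \<i> / (24 * \<tau>) = of_real (pi / 24) * (\<i> * (1 / \<tau>))" by simp
  then have "Re (of_real pi * \<i> / (24 * \<tau>)) = Re (of_real (pi / 24) * (\<i> * (1 / \<tau>)))" by (simp only:)
  also have "\<dots> = pi / 24 * (- Im (1 / \<tau>))" by (simp only: times_complex.sel Re_complex_of_real Im_complex_of_real imaginary_unit.sel) simp
  also have "- Im (1 / \<tau>) = Im (- 1 / \<tau>)" by (simp only: minus_divide_left[symmetric] uminus_complex.sel)
  finally show ?thesis by (simp only: norm_exp_eq_Re)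
qed

theorem theorem4p1:
  fixes M :: real
  assumes "M > 0"
  shows
    "(\<forall>x y. y > 0 \<longrightarrow>
        odd_even_gf (nome (Complex x y)) =
          qpoch_inf (- nome (Complex x y)) (nome (Complex x y)) * mock_theta_f (nome (Complex x y)))
     \<and>
     (\<exists>C. \<forall>\<^sub>F y in at_right 0. \<forall>x. \<bar>x\<bar> \<le> M * y \<longrightarrow>
        norm (odd_even_gf (nome (Complex x y))
              - of_real (2 * sqrt 2 / 3) * exp (of_real pi * \<i> / (24 * Complex x y)))
          \<le> C * (y * exp (pi / 24 * Im (- 1 / Complex x y))))
     \<and>
     (\<exists>C. \<forall>\<^sub>F y in at_right 0. \<forall>x. M * y < \<bar>x\<bar> \<and> \<bar>x\<bar> \<le> 1 / 2 \<longrightarrow>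
        norm (odd_even_gf (nome (Complex x y)))
          \<le> C * (1 / (y * sqrt 2) *
                 exp (1 / y * (pi / 8 - 1 / pi * (1 - 1 / sqrt (1 + M ^ 2))))))"
proof (intro conjI allI impI)
  fix x y :: real assume y: "y > 0"
  have "norm (nome (Complex x y)) < 1" "nome (Complex x y) \<noteq> 0" using y by (simp_all add: nome_def)
  then show "odd_even_gf (nome (Complex x y)) =
          qpoch_inf (- nome (Complex x y)) (nome (Complex x y)) * mock_theta_f (nome (Complex x y))"
    by (rule odd_even_gf_eq)
next
  obtain C \<delta> where \<delta>: "\<delta> > 0" and C: "\<And>z. 0 < Re z \<Longrightarrow> Re z < \<delta> \<Longrightarrow> \<bar>Im z\<bar> \<le> M * Re z \<Longrightarrow>
       norm (odd_even_gf (exp (- z)) - of_real (2 * sqrt 2 / 3) * exp (of_real pi ^ 2 / (12 * z)))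
         \<le> C * Re z * norm (exp (of_real pi ^ 2 / (12 * z)))"
    using odd_even_gf_near_cusp[OF assms] by blast
  have "\<forall>\<^sub>F y in at_right 0. y \<in> {0<..<\<delta> / (2 * pi)}"
    using \<delta> by (intro eventually_at_right_real) simp
  then have "\<forall>\<^sub>F y in at_right 0. \<forall>x. \<bar>x\<bar> \<le> M * y \<longrightarrow>
        norm (odd_even_gf (nome (Complex x y))
              - of_real (2 * sqrt 2 / 3) * exp (of_real pi * \<i> / (24 * Complex x y)))
          \<le> (C * (2 * pi)) * (y * exp (pi / 24 * Im (- 1 / Complex x y)))"
  proof eventually_elim
    case (elim y)
    show ?case
    proof (intro allI impI)
      fix x assume x: "\<bar>x\<bar> \<le> M * y"
      \<comment> \<open>Then \<open>nome (Complex x y) = exp (- z)\<close>, and the sector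
        \<open>abs x \<le> M * y\<close> becomes \<open>abs (Im z) \<le> M * Re z\<close>.\<close>
      define z where "z = - (2 * of_real pi * \<i> * Complex x y)"
      have z: "Re z = 2 * pi * y" "Im z = - (2 * pi * x)" by (simp_all add: z_def)
      have "\<bar>Im z\<bar> = 2 * pi * \<bar>x\<bar>" unfolding z by (simp add: abs_mult)
      also have "\<dots> \<le> 2 * pi * (M * y)" using x by (intro mult_left_mono) auto
      also have "\<dots> = M * Re z" by (simp add: z)
      finally have "\<bar>Im z\<bar> \<le> M * Re z" .
      moreover have "0 < Re z" "Re z < \<delta>" using elim by (simp_all add: z field_simps)
      ultimately have *: "norm (odd_even_gf (exp (- z)) - of_real (2 * sqrt 2 / 3) * exp (of_real pi ^ 2 / (12 * z)))
         \<le> C * Re z * norm (exp (of_real pi ^ 2 / (12 * z)))"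
        by (intro C)
      have "Complex x y \<noteq> 0" using elim by (simp add: complex_eq_iff)
      then have e: "exp (of_real pi ^ 2 / (12 * z)) = exp (of_real pi * \<i> / (24 * Complex x y))"
        unfolding z_def by (rule exp_cusp_eq)
      show "norm (odd_even_gf (nome (Complex x y))
              - of_real (2 * sqrt 2 / 3) * exp (of_real pi * \<i> / (24 * Complex x y)))
          \<le> (C * (2 * pi)) * (y * exp (pi / 24 * Im (- 1 / Complex x y)))"
        using * unfolding e norm_exp_cusp nome_altdef z_def[symmetric] z(1) by (simp only: mult.assoc)
    qed
  qed
  then show "\<exists>C. \<forall>\<^sub>F y in at_right 0. \<forall>x. \<bar>x\<bar> \<le> M * y \<longrightarrow>
        norm (odd_even_gf (nome (Complex x y))
              - of_real (2 * sqrt 2 / 3) * exp (of_real pi * \<i> / (24 * Complex x y)))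
          \<le> C * (y * exp (pi / 24 * Im (- 1 / Complex x y)))" by blast
next
  \<comment> \<open>Ensures \<open>\<alpha> * M \<le> 1\<close> and \<open>\<alpha> \<le> 1\<close>
    for \<open>\<alpha> = 2*pi*y\<close>.\<close>
  define \<delta> where "\<delta> = min (1 / (2 * pi * M)) (1 / (2 * pi))"
  have \<delta>: "\<delta> > 0" using assms by (simp add: \<delta>_def)
  have "\<forall>\<^sub>F y in at_right 0. y \<in> {0<..<\<delta>}" using \<delta> by (rule eventually_at_right_real)
  then have "\<forall>\<^sub>F y in at_right 0. \<forall>x. M * y < \<bar>x\<bar> \<and> \<bar>x\<bar> \<le> 1 / 2 \<longrightarrow>
        norm (odd_even_gf (nome (Complex x y)))
          \<le> (8 * exp (M + 2) * sqrt 2 / (2 * pi)) * (1 / (y * sqrt 2) *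
                 exp (1 / y * (pi / 8 - 1 / pi * (1 - 1 / sqrt (1 + M ^ 2)))))"
  proof eventually_elim
    case (elim y)
    show ?case
    proof (intro allI impI)
      fix x assume x: "M * y < \<bar>x\<bar> \<and> \<bar>x\<bar> \<le> 1 / 2"
      have y: "y > 0" "2 * pi * y * M \<le> 1" "2 * pi * y \<le> 1"
        using elim assms by (simp_all add: \<delta>_def field_simps)
      have "norm (odd_even_gf (nome (Complex x y)))
         \<le> 8 * exp (M + 2) / (2 * pi * y) * exp ((pi\<^sup>2 / 4 - 2 + 2 / sqrt (1 + M\<^sup>2)) / (2 * pi * y))"
        using x y by (intro odd_even_gf_minor_arc assms) auto
      also have "(pi\<^sup>2 / 4 - 2 + 2 / sqrt (1 + M\<^sup>2)) / (2 * pi * y) = 1 / y * (pi / 8 - 1 / pi * (1 - 1 / sqrt (1 + M ^ 2)))"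
      proof -
        have "(pi\<^sup>2 / 4 - 2 + 2 * S) / (2 * pi * y) = 1 / y * (pi / 8 - 1 / pi * (1 - S))" for S
          using y by (simp add: field_simps power2_eq_square)
        from this[of "1 / sqrt (1 + M\<^sup>2)"] show ?thesis by simp
      qed
      also have "8 * exp (M + 2) / (2 * pi * y) * E = (8 * exp (M + 2) * sqrt 2 / (2 * pi)) * (1 / (y * sqrt 2) * E)" for E
        by simp
      finally show "norm (odd_even_gf (nome (Complex x y)))
          \<le> (8 * exp (M + 2) * sqrt 2 / (2 * pi)) * (1 / (y * sqrt 2) *
                 exp (1 / y * (pi / 8 - 1 / pi * (1 - 1 / sqrt (1 + M ^ 2)))))" .
    qed
  qed
  then show "\<exists>C. \<forall>\<^sub>F y in at_right 0. \<forall>x. M * y < \<bar>x\<bar> \<and> \<bar>x\<bar> \<le> 1 / 2 \<longrightarrow>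
        norm (odd_even_gf (nome (Complex x y)))
          \<le> C * (1 / (y * sqrt 2) *
                 exp (1 / y * (pi / 8 - 1 / pi * (1 - 1 / sqrt (1 + M ^ 2)))))" by blast
qed

end
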